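(* Let $(L,A)$ be a Lie-Rinehart algebra over $\boldsymbol{k}$ and let $V$ be a finitely generated projective $A$-module. Let $\nabla$ and $\nabla^{\eta}=\nabla+\eta$ be $L$-connections on $V$, where $\eta\in\operatorname{Hom}_A(L,\operatorname{End}_A(V))$, with curvature endomorphisms $\mathcal{R}$ and $\mathcal{R}^{\eta}$. Then for each $f\in\boldsymbol{k}[x]$ the element $\operatorname{trace}_V(f(\mathcal{R}))\in\operatorname{Alt}_A(L,A)$ is $d_{\operatorname{dR}}$-closed. Moreover, $$\operatorname{trace}_V(f(\mathcal{R}^{\eta}))-\operatorname{trace}_V(f(\mathcal{R}))=d_{\operatorname{dR}}\int_0^1\operatorname{trace}_V\bigl(\eta\cup f'(\mathcal{R}^{s})\bigr)\,ds,$$ where $\mathcal{R}^{s}\in\operatorname{Alt}_A^2(L,\operatorname{End}_A(V))[s]$ is the curvature endomorphism of $\nabla^s=\nabla+s\eta$, so that the naive de Rham cohomology class $[\operatorname{trace}_V(f(\mathcal{R}))]\in\mathrm{H}_{\operatorname{dR}}(L,A)$ is independent of the choice of $\nabla$.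
   Context: $\boldsymbol{k}$ is a field of characteristic zero. A Lie-Rinehart algebra $(L,A)$ consists of a commutative unital $\boldsymbol{k}$-algebra $A$ and an $A$-module $L$ with a $\boldsymbol{k}$-bilinear Lie bracket such that $L$ acts on $A$ by $\boldsymbol{k}$-linear derivations $a\mapsto X(a)$, with $(aX)(b)=a(X(b))$ and $[X,aY]=X(a)Y+a[X,Y]$. For an $A$-module $W$, $\operatorname{Alt}_A^m(L,W)$ is the $A$-module of alternating $A$-multilinear maps $L^m\to W$ and $\operatorname{Alt}_A(L,W)=\bigoplus_m\operatorname{Alt}_A^m(L,W)$. The naive de Rham differential on $\operatorname{Alt}_A(L,A)$ is $$(d_{\operatorname{dR}}\omega)(X_0,\dots,X_m)=\sum_l(-1)^lX_l\bigl(\omega(X_0,\dots,\widehat{X_l},\dots,X_m)\bigr)+\sum_{k<l}(-1)^{k+l}\omega([X_k,X_l],X_0,\dots,\widehat{X_k},\dots,\widehat{X_l},\dots,X_m),$$ and $\mathrm{H}_{\operatorname{dR}}(L,A)$ is its cohomology. For $\omega\in\operatorname{Alt}_A^k(L,\operatorname{End}_A(V))$ and $\omega'\in\operatorname{Alt}_A^m(L,\operatorname{End}_A(V))$, $$(\omega\cup\omega')(X_1,\dots,X_{k+m})=\sum_{\sigma}(-1)^{|\sigma|}\omega(X_{\sigma(1)},\dots,X_{\sigma(k)})\,\omega'(X_{\sigma(k+1)},\dots,X_{\sigma(k+m)}),$$ the sum running over all $(k,m)$-shuffles, with composition of endomorphisms. For $f=\sum_m a_mx^m$, $f(\mathcal{R})=\sum_m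 a_m\mathcal{R}^{\cup m}$ with $\mathcal{R}^{\cup 0}=\operatorname{id}_V$; $f'$ is the derivative of $f$. An $L$-connection on $V$ is an $A$-linear assignment $L\ni X\mapsto\nabla_X\in\operatorname{End}_{\boldsymbol{k}}(V)$ with $\nabla_X(av)=X(a)v+a\nabla_Xv$; its curvature endomorphism is $\mathcal{R}(X,Y)=[\nabla_X,\nabla_Y]-\nabla_{[X,Y]}\in\operatorname{End}_A(V)$; and $(\nabla+\eta)_X=\nabla_X+\eta(X)$. The trace is defined by choosing finitely many $v_i\in V$, $v^i\in\operatorname{Hom}_A(V,A)$ with $\sum_iv^i(v)v_i=v$ for all $v\in V$ and setting $\operatorname{trace}_V(\varphi)=\sum_iv^i(\varphi(v_i))$ (independent of choices); it is applied to $\operatorname{End}_A(V)$-valued forms value by value. The integral over $s$ is the formal integral $\int_0^1s^n\,ds=1/(n+1)$ of polynomials in $s$. *)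

theory Defs
  imports
    "HOL-Computational_Algebra.Polynomial"
    "HOL-Combinatorics.Permutations"
    "HOL-Library.Function_Algebras"
begin

text \<open>
  The sort \<open>{comm_ring, comm_monoid_mult}\<close> describes commutative unital rings \<^emph>\<open>including\<close> the
  zero ring. The class \<^class>\<open>comm_ring_1\<close>, and with it the library locale \<^locale>\<open>module\<close>,
  would impose \<open>0 \<noteq> 1\<close> on \<open>A\<close>; hence the following variant of that locale.
  Addition, subtraction and finite sums of functions are pointwise (\<open>Function_Algebras\<close>).
\<close>

locale amodule =
  fixes s :: "'a::{comm_ring,comm_monoid_mult} \<Rightarrow> 'w::ab_group_add \<Rightarrow> 'w"
  assumes scale_right_distrib: "s a (x + y) = s a x + s a y"
    and scale_left_distrib: "s (a + b) x = s a x + s b x"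
    and scale_scale: "s a (s b x) = s (a * b) x"
    and scale_one: "s 1 x = x"

definition ahom :: "('a \<Rightarrow> 'v::plus \<Rightarrow> 'v) \<Rightarrow> ('a \<Rightarrow> 'w::plus \<Rightarrow> 'w) \<Rightarrow> ('v \<Rightarrow> 'w) \<Rightarrow> bool" where
  "ahom s s' h \<longleftrightarrow> (\<forall>x y. h (x + y) = h x + h y) \<and> (\<forall>a x. h (s a x) = s' a (h x))"

definition finitely_generated :: "('a \<Rightarrow> 'v::ab_group_add \<Rightarrow> 'v) \<Rightarrow> bool" where
  "finitely_generated s \<longleftrightarrow> (\<exists>S. finite S \<and> (\<forall>v. \<exists>c. v = (\<Sum>w\<in>S. s (c w) w)))"

text \<open>
  \<open>V\<close> is projective iff it is a direct summand of a free module, equivalently iff the canonical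
  epimorphism from the free module on the underlying set of \<open>V\<close> onto \<open>V\<close> has an \<open>A\<close>-linear
  section \<open>\<iota>\<close>. The lifting property itself would quantify over modules on arbitrary types.
\<close>

definition projective :: "('a::{comm_ring,comm_monoid_mult} \<Rightarrow> 'v::ab_group_add \<Rightarrow> 'v) \<Rightarrow> bool" where
  "projective s \<longleftrightarrow>
     (\<exists>\<iota> :: 'v \<Rightarrow> 'v \<Rightarrow> 'a.
        (\<forall>v. finite {w. \<iota> v w \<noteq> 0}) \<and>
        ahom s (\<lambda>a g w. a * g w) \<iota> \<and>
        (\<forall>v. (\<Sum>w | \<iota> v w \<noteq> 0. s (\<iota> v w) w) = v))"

definition endo_scale :: "('a \<Rightarrow> 'v \<Rightarrow> 'v) \<Rightarrow> 'a \<Rightarrow> ('v \<Rightarrow> 'v) \<Rightarrow> 'v \<Rightarrow> 'v" where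
  "endo_scale s a \<phi> = (\<lambda>v. s a (\<phi> v))"

definition End :: "('a \<Rightarrow> 'v::plus \<Rightarrow> 'v) \<Rightarrow> ('v \<Rightarrow> 'v) set" where
  "End s = {\<phi>. ahom s s \<phi>}"

definition dual_basis ::
  "('a::{comm_ring,comm_monoid_mult} \<Rightarrow> 'v::ab_group_add \<Rightarrow> 'v)
    \<Rightarrow> nat \<times> (nat \<Rightarrow> 'v) \<times> (nat \<Rightarrow> 'v \<Rightarrow> 'a) \<Rightarrow> bool" where
  "dual_basis s = (\<lambda>(n, e, \<epsilon>).
     (\<forall>i<n. ahom s (*) (\<epsilon> i)) \<and> (\<forall>v. (\<Sum>i<n. s (\<epsilon> i v) (e i)) = v))"

definition trace ::
  "('a::{comm_ring,comm_monoid_mult} \<Rightarrow> 'v::ab_group_add \<Rightarrow> 'v) \<Rightarrow> ('v \<Rightarrow> 'v) \<Rightarrow> 'a" where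
  "trace s \<phi> = (case (SOME b. dual_basis s b) of (n, e, \<epsilon>) \<Rightarrow> \<Sum>i<n. \<epsilon> i (\<phi> (e i)))"

text \<open>The \<open>k\<close>-module structure induced on an \<open>A\<close>-module, \<open>sk\<close> being the scaling of \<open>A\<close> by \<open>k\<close>.\<close>

definition induced_scale :: "('k \<Rightarrow> 'a \<Rightarrow> 'a) \<Rightarrow> ('a::one \<Rightarrow> 'v \<Rightarrow> 'v) \<Rightarrow> 'k \<Rightarrow> 'v \<Rightarrow> 'v" where
  "induced_scale sk s c x = s (sk c 1) x"

locale lie_rinehart =
  vector_space sk + L: amodule sL
  for sk :: "'k::field_char_0 \<Rightarrow> 'a::{comm_ring,comm_monoid_mult} \<Rightarrow> 'a"
    and sL :: "'a \<Rightarrow> 'l::ab_group_add \<Rightarrow> 'l"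
    and br :: "'l \<Rightarrow> 'l \<Rightarrow> 'l"
    and act :: "'l \<Rightarrow> 'a \<Rightarrow> 'a" +
  assumes algebra_compat: "sk c (a * b) = sk c a * b"
    and bracket_add_left: "br (X + Y) Z = br X Z + br Y Z"
    and bracket_add_right: "br X (Y + Z) = br X Y + br X Z"
    and bracket_scale_left: "br (induced_scale sk sL c X) Y = induced_scale sk sL c (br X Y)"
    and bracket_scale_right: "br X (induced_scale sk sL c Y) = induced_scale sk sL c (br X Y)"
    and bracket_self: "br X X = 0"
    and jacobi: "br X (br Y Z) + br Y (br Z X) + br Z (br X Y) = 0"
    and act_add: "act X (a + b) = act X a + act X b"
    and act_scale: "act X (sk c a) = sk c (act X a)"
    and act_mult: "act X (a * b) = act X a * b + a * act X b"
    and act_add_left: "act (X + Y) a = act X a + act Y a"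
    and act_scale_left: "act (sL a X) b = a * act X b"
    and act_bracket: "act (br X Y) a = act X (act Y a) - act Y (act X a)"
    and bracket_leibniz: "br X (sL a Y) = sL (act X a) Y + sL a (br X Y)"

definition connection ::
  "('k \<Rightarrow> 'a::{comm_ring,comm_monoid_mult} \<Rightarrow> 'a) \<Rightarrow> ('a \<Rightarrow> 'l::ab_group_add \<Rightarrow> 'l)
    \<Rightarrow> ('l \<Rightarrow> 'a \<Rightarrow> 'a) \<Rightarrow> ('a \<Rightarrow> 'v::ab_group_add \<Rightarrow> 'v) \<Rightarrow> ('l \<Rightarrow> 'v \<Rightarrow> 'v) \<Rightarrow> bool" where
  "connection sk sL act sV D \<longleftrightarrow>
     ahom sL (endo_scale sV) D \<and>
     (\<forall>X. ahom (induced_scale sk sV) (induced_scale sk sV) (D X)) \<and>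
     (\<forall>X a v. D X (sV a v) = sV (act X a) v + sV a (D X v))"

text \<open>
  An element of \<open>Alt\<^sub>A(L,W)\<close> is a function on lists over \<open>L\<close>: its restriction to lists of length
  \<open>m\<close> is the component of degree \<open>m\<close>. Homogeneous forms of degree \<open>m\<close> vanish on lists of
  any other length. \<open>W\<close> is a set of elements of an ambient type, to allow for \<open>End\<^sub>A(V)\<close>.
\<close>

definition Alt_deg ::
  "('a \<Rightarrow> 'l::plus \<Rightarrow> 'l) \<Rightarrow> ('a \<Rightarrow> 'w::{plus,zero} \<Rightarrow> 'w) \<Rightarrow> 'w set \<Rightarrow> nat \<Rightarrow> ('l list \<Rightarrow> 'w) set" where
  "Alt_deg sL sW W m = {\<omega>.
     (\<forall>xs. length xs = m \<longrightarrow> \<omega> xs \<in> W) \<and>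
     (\<forall>xs. length xs \<noteq> m \<longrightarrow> \<omega> xs = 0) \<and>
     (\<forall>xs i. length xs = m \<and> i < m \<longrightarrow> ahom sL sW (\<lambda>X. \<omega> (xs[i := X]))) \<and>
     (\<forall>xs i j. length xs = m \<and> i < j \<and> j < m \<and> xs ! i = xs ! j \<longrightarrow> \<omega> xs = 0)}"

definition component :: "nat \<Rightarrow> ('l list \<Rightarrow> 'w::zero) \<Rightarrow> 'l list \<Rightarrow> 'w" where
  "component m \<omega> = (\<lambda>xs. if length xs = m then \<omega> xs else 0)"

definition Alt ::
  "('a \<Rightarrow> 'l::plus \<Rightarrow> 'l) \<Rightarrow> ('a \<Rightarrow> 'w::{plus,zero} \<Rightarrow> 'w) \<Rightarrow> 'w set \<Rightarrow> ('l list \<Rightarrow> 'w) set" where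
  "Alt sL sW W = {\<omega>. (\<forall>m. component m \<omega> \<in> Alt_deg sL sW W m) \<and>
                      (\<exists>N. \<forall>m>N. component m \<omega> = (\<lambda>_. 0))}"

text \<open>
  \<open>Alt\<^sub>A\<^sup>m(L,W)[s]\<close>: a polynomial in \<open>s\<close> with coefficients in the forms is regarded as a form with
  values in \<open>W[s]\<close>, whose degree in \<open>s\<close> is bounded uniformly.
\<close>

definition Alt_deg_poly ::
  "('a \<Rightarrow> 'l::plus \<Rightarrow> 'l) \<Rightarrow> ('a \<Rightarrow> 'w::{plus,zero} \<Rightarrow> 'w) \<Rightarrow> 'w set \<Rightarrow> nat
    \<Rightarrow> ('l list \<Rightarrow> 'w poly) set" where
  "Alt_deg_poly sL sW W m = {\<omega>.
     (\<forall>i. (\<lambda>xs. coeff (\<omega> xs) i) \<in> Alt_deg sL sW W m) \<and> (\<exists>N. \<forall>xs. degree (\<omega> xs) \<le> N)}"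

definition signed :: "bool \<Rightarrow> 'w::uminus \<Rightarrow> 'w" where
  "signed b x = (if b then x else - x)"

text \<open>\<open>nths xs (- I)\<close> is \<open>xs\<close> with the entries at the positions in \<open>I\<close> omitted.\<close>

definition d_dR ::
  "('l \<Rightarrow> 'l \<Rightarrow> 'l) \<Rightarrow> ('l \<Rightarrow> 'a \<Rightarrow> 'a) \<Rightarrow> ('l list \<Rightarrow> 'a::ab_group_add) \<Rightarrow> 'l list \<Rightarrow> 'a" where
  "d_dR br act \<omega> xs =
     (\<Sum>l<length xs. signed (even l) (act (xs ! l) (\<omega> (nths xs (- {l}))))) +
     (\<Sum>l<length xs. \<Sum>k<l. signed (even (k + l)) (\<omega> (br (xs ! k) (xs ! l) # nths xs (- {k, l}))))"

definition shuffle_perms :: "nat \<Rightarrow> nat \<Rightarrow> (nat \<Rightarrow> nat) set" where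
  "shuffle_perms k m =
     {\<sigma>. \<sigma> permutes {..<k + m} \<and> strict_mono_on {..<k} \<sigma> \<and> strict_mono_on {k..<k + m} \<sigma>}"

text \<open>
  The cup product, relative to a product \<open>mul\<close> on the values, extended biadditively to
  inhomogeneous forms: on a list of length \<open>n\<close> it collects all bidegrees \<open>(k, n - k)\<close>.
  For \<open>End(V)\<close>-valued forms \<open>mul\<close> is composition.
\<close>

definition cup ::
  "('w \<Rightarrow> 'w \<Rightarrow> 'w) \<Rightarrow> ('l list \<Rightarrow> 'w::ab_group_add) \<Rightarrow> ('l list \<Rightarrow> 'w) \<Rightarrow> 'l list \<Rightarrow> 'w" where
  "cup mul \<omega> \<omega>' xs =
     (\<Sum>k\<le>length xs. \<Sum>\<sigma>\<in>shuffle_perms k (length xs - k).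
        signed (evenperm \<sigma>)
          (mul (\<omega> (map (\<lambda>i. xs ! \<sigma> i) [0..<k])) (\<omega>' (map (\<lambda>i. xs ! \<sigma> i) [k..<length xs]))))"

primrec cup_power ::
  "('w \<Rightarrow> 'w \<Rightarrow> 'w) \<Rightarrow> 'w \<Rightarrow> ('l list \<Rightarrow> 'w::ab_group_add) \<Rightarrow> nat \<Rightarrow> 'l list \<Rightarrow> 'w" where
  "cup_power mul u \<omega> 0 = (\<lambda>xs. if xs = [] then u else 0)"
| "cup_power mul u \<omega> (Suc m) = cup mul \<omega> (cup_power mul u \<omega> m)"

text \<open>\<open>f(\<omega>) = \<Sum>\<^sub>m a\<^sub>m \<omega>\<^sup>m\<close> for \<open>f = \<Sum>\<^sub>m a\<^sub>m x\<^sup>m\<close>, relative to scaling \<open>sc\<close>, product and unit of the values.\<close>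

definition poly_form ::
  "('k::zero \<Rightarrow> 'w \<Rightarrow> 'w) \<Rightarrow> ('w \<Rightarrow> 'w \<Rightarrow> 'w) \<Rightarrow> 'w \<Rightarrow> 'k poly
    \<Rightarrow> ('l list \<Rightarrow> 'w::ab_group_add) \<Rightarrow> 'l list \<Rightarrow> 'w" where
  "poly_form sc mul u f \<omega> xs = (\<Sum>m\<le>degree f. sc (coeff f m) (cup_power mul u \<omega> m xs))"

definition one_form :: "('l \<Rightarrow> 'w) \<Rightarrow> 'l list \<Rightarrow> 'w::zero" where
  "one_form h xs = (case xs of [X] \<Rightarrow> h X | _ \<Rightarrow> 0)"

definition curvature ::
  "('w \<Rightarrow> 'w \<Rightarrow> 'w) \<Rightarrow> ('l \<Rightarrow> 'l \<Rightarrow> 'l) \<Rightarrow> ('l \<Rightarrow> 'w) \<Rightarrow> 'l list \<Rightarrow> 'w::ab_group_add" where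
  "curvature mul br D xs =
     (case xs of [X, Y] \<Rightarrow> mul (D X) (D Y) - mul (D Y) (D X) - D (br X Y) | _ \<Rightarrow> 0)"

definition trace_form ::
  "('k::zero \<Rightarrow> 'a::{comm_ring,comm_monoid_mult} \<Rightarrow> 'a) \<Rightarrow> ('a \<Rightarrow> 'v::ab_group_add \<Rightarrow> 'v)
    \<Rightarrow> ('l \<Rightarrow> 'l \<Rightarrow> 'l) \<Rightarrow> 'k poly \<Rightarrow> ('l \<Rightarrow> 'v \<Rightarrow> 'v) \<Rightarrow> 'l list \<Rightarrow> 'a" where
  "trace_form sk sV br f D xs =
     trace sV (poly_form (endo_scale (induced_scale sk sV)) (\<circ>) id f (curvature (\<circ>) br D) xs)"

text \<open>
  The product of \<open>End(V)[s]\<close>. The ring multiplication of \<^typ>\<open>'w poly\<close> is not available, since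
  composition is not the multiplication of a type class.
\<close>

definition endo_poly_mult ::
  "('v \<Rightarrow> 'v::ab_group_add) poly \<Rightarrow> ('v \<Rightarrow> 'v) poly \<Rightarrow> ('v \<Rightarrow> 'v) poly" where
  "endo_poly_mult p q = (\<Sum>i\<le>degree p. \<Sum>j\<le>degree q. monom (coeff p i \<circ> coeff q j) (i + j))"

definition pencil :: "('l \<Rightarrow> 'v \<Rightarrow> 'v) \<Rightarrow> ('l \<Rightarrow> 'v \<Rightarrow> 'v) \<Rightarrow> 'l \<Rightarrow> ('v \<Rightarrow> 'v::ab_group_add) poly" where
  "pencil D \<eta> X = [:D X, \<eta> X:]"

definition pencil_curvature ::
  "('l \<Rightarrow> 'l \<Rightarrow> 'l) \<Rightarrow> ('l \<Rightarrow> 'v \<Rightarrow> 'v) \<Rightarrow> ('l \<Rightarrow> 'v \<Rightarrow> 'v) \<Rightarrow> 'l list \<Rightarrow> ('v \<Rightarrow> 'v::ab_group_add) poly"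
  where
  "pencil_curvature br D \<eta> = curvature endo_poly_mult br (pencil D \<eta>)"

definition formal_integral ::
  "('k::field_char_0 \<Rightarrow> 'a \<Rightarrow> 'a) \<Rightarrow> 'a::comm_monoid_add poly \<Rightarrow> 'a" where
  "formal_integral sk p = (\<Sum>n\<le>degree p. sk (1 / of_nat (n + 1)) (coeff p n))"

text \<open>\<open>\<integral>\<^sub>0\<^sup>1 trace\<^sub>V(\<eta> \<union> f'(\<R>\<^sup>s)) ds\<close>, the trace being applied to each coefficient in \<open>s\<close>.\<close>

definition transgression ::
  "('k::field_char_0 \<Rightarrow> 'a::{comm_ring,comm_monoid_mult} \<Rightarrow> 'a) \<Rightarrow> ('a \<Rightarrow> 'v::ab_group_add \<Rightarrow> 'v)
    \<Rightarrow> ('l \<Rightarrow> 'l \<Rightarrow> 'l) \<Rightarrow> 'k poly \<Rightarrow> ('l \<Rightarrow> 'v \<Rightarrow> 'v) \<Rightarrow> ('l \<Rightarrow> 'v \<Rightarrow> 'v) \<Rightarrow> 'l list \<Rightarrow> 'a" where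
  "transgression sk sV br f D \<eta> xs =
     formal_integral sk (map_poly (trace sV)
       (cup endo_poly_mult
          (one_form (\<lambda>X. [:\<eta> X:]))
          (poly_form (\<lambda>c. map_poly (endo_scale (induced_scale sk sV) c)) endo_poly_mult [:id:]
             (pderiv f) (pencil_curvature br D \<eta>))
          xs))"

definition closed_forms ::
  "('a \<Rightarrow> 'l \<Rightarrow> 'l) \<Rightarrow> ('l \<Rightarrow> 'l \<Rightarrow> 'l) \<Rightarrow> ('l \<Rightarrow> 'a \<Rightarrow> 'a)
    \<Rightarrow> ('l::ab_group_add list \<Rightarrow> 'a::{comm_ring,comm_monoid_mult}) set" where
  "closed_forms sL br act = {\<omega> \<in> Alt sL (*) UNIV. d_dR br act \<omega> = 0}"

definition cohomologous ::
  "('a \<Rightarrow> 'l \<Rightarrow> 'l) \<Rightarrow> ('l \<Rightarrow> 'l \<Rightarrow> 'l) \<Rightarrow> ('l \<Rightarrow> 'a \<Rightarrow> 'a)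
    \<Rightarrow> ('l::ab_group_add list \<Rightarrow> 'a::{comm_ring,comm_monoid_mult}) rel" where
  "cohomologous sL br act =
     {(\<omega>, \<omega>'). \<omega> \<in> closed_forms sL br act \<and> \<omega>' \<in> closed_forms sL br act \<and>
                \<omega>' - \<omega> \<in> d_dR br act ` Alt sL (*) UNIV}"

definition H_dR ::
  "('a \<Rightarrow> 'l \<Rightarrow> 'l) \<Rightarrow> ('l \<Rightarrow> 'l \<Rightarrow> 'l) \<Rightarrow> ('l \<Rightarrow> 'a \<Rightarrow> 'a)
    \<Rightarrow> ('l::ab_group_add list \<Rightarrow> 'a::{comm_ring,comm_monoid_mult}) set set" where
  "H_dR sL br act = closed_forms sL br act // cohomologous sL br act"

definition dR_class ::
  "('a \<Rightarrow> 'l \<Rightarrow> 'l) \<Rightarrow> ('l \<Rightarrow> 'l \<Rightarrow> 'l) \<Rightarrow> ('l \<Rightarrow> 'a \<Rightarrow> 'a)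
    \<Rightarrow> ('l::ab_group_add list \<Rightarrow> 'a::{comm_ring,comm_monoid_mult}) \<Rightarrow> ('l list \<Rightarrow> 'a) set" where
  "dR_class sL br act \<omega> = cohomologous sL br act `` {\<omega>}"

end

theory Submission
  imports Defs "HOL-Computational_Algebra.Formal_Power_Series"
begin

text \<open>
  A form is a function on lists over \<open>L\<close>, so it is determined by its value on the empty list and
  by its insertions \<open>i\<^sub>X \<omega> = (\<lambda>xs. \<omega> (X # xs))\<close>. In these terms every operation obeys a short
  recursion: the shuffle product satisfies
  \<open>i\<^sub>X (\<omega> \<smile> \<omega>') = i\<^sub>X \<omega> \<smile> \<omega>' + (-1)\<^bsup>deg \<omega>\<^esup> \<omega> \<smile> i\<^sub>X \<omega>'\<close> (\<open>cup_Cons\<close>), and the differential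
  satisfies Cartan's formula \<open>i\<^sub>X d = \<L>\<^sub>X - d i\<^sub>X\<close> (\<open>cartan_d\<close>, \<open>d_dR_eq_cartan_d\<close>). Associativity,
  the Leibniz rule \<open>cartan_d_cup\<close>, the alternating property of products and the graded symmetry of
  traces of products (\<open>trace_cup_commute\<close>) are then inductions on lists in which no shuffle occurs.

  The endomorphism-valued part is done in an arbitrary ring \<open>E\<close> that contains the operators
  \<open>\<nabla>\<^sub>X\<close>. The covariant derivative \<open>d\<^sup>\<nabla>\<close> is the Cartan differential of the inner derivations
  \<open>[\<nabla>\<^sub>X, -]\<close>. The Jacobi identity gives the Bianchi identity \<open>d\<^sup>\<nabla> \<R> = 0\<close>, hence
  \<open>d\<^sup>\<nabla> \<R>\<^sup>m = 0\<close>. As \<open>X (trace \<phi>) = trace [\<nabla>\<^sub>X, \<phi>]\<close> for \<open>A\<close>-linear \<open>\<phi>\<close> (\<open>trace_derivation\<close>), the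
  form \<open>trace \<R>\<^sup>m\<close> is closed. If moreover \<open>\<partial>\<close> is a derivation of \<open>E\<close> with
  \<open>\<partial> \<nabla>\<^sub>X = \<eta> X\<close>, then \<open>\<partial> \<R> = d\<^sup>\<nabla> \<eta>\<close>, and since \<open>\<R>\<close> has even degree, the symmetry of the trace
  gives
  \<open>trace (\<partial> (\<R>\<^bsup>m+1\<^esup>)) = (m+1) trace (d\<^sup>\<nabla> \<eta> \<smile> \<R>\<^sup>m) = (m+1) d (trace (\<eta> \<smile> \<R>\<^sup>m))\<close>
  (\<open>derivative_trace_power\<close>).

  This is applied to power series in \<open>s\<close> over the ring of additive endomorphisms of \<open>V\<close>, with the
  operators \<open>\<nabla>\<^sub>X + s \<eta> X\<close> and \<open>\<partial> = d/ds\<close>. Comparing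
  coefficients of \<open>s\<^sup>i\<close> and dividing by \<open>i + 1\<close>, which is what the formal integral does, expresses the
  coefficients of positive degree of \<open>trace (\<R>\<^sup>s)\<^bsup>m+1\<^esup>\<close> as differentials. The constant coefficient
  is \<open>trace \<R>\<^bsup>m+1\<^esup>\<close>, and the sum of all coefficients, the value at \<open>s = 1\<close>, is
  \<open>trace (\<R>\<^sup>\<eta>)\<^bsup>m+1\<^esup>\<close>; the transgression formula follows by linearity in \<open>f\<close>. Any two connections
  differ by an \<open>A\<close>-linear \<open>\<eta>\<close>, so the formula also shows that the class does not depend on the
  connection.
\<close>

unbundle fps_syntax

section \<open>Shuffles\<close>

definition insertion :: "'l \<Rightarrow> ('l list \<Rightarrow> 'w) \<Rightarrow> 'l list \<Rightarrow> 'w" where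
  "insertion X \<omega> = (\<lambda>xs. \<omega> (X # xs))"

text \<open>
  The grading involution, multiplication by \<open>(-1)\<^sup>p\<close> in degree \<open>p\<close>. It carries the Koszul signs, so
  that forms need not be homogeneous.
\<close>

definition grading :: "('l list \<Rightarrow> 'w::uminus) \<Rightarrow> 'l list \<Rightarrow> 'w" where
  "grading \<omega> = (\<lambda>xs. signed (even (length xs)) (\<omega> xs))"

text \<open>
  Permutations of \<open>n\<close> positions become permutations of \<open>n + 1\<close> positions when a new first entry is
  put in front of the list. If that entry goes to the first block, the permutation is \<open>shift_up \<sigma>\<close>; if
  it goes to the start of the second block, at position \<open>k\<close>, it is \<open>shift_up \<sigma>\<close> preceded by the
  cycle that moves position \<open>k\<close> to the front.
\<close>

definition shift_up :: "(nat \<Rightarrow> nat) \<Rightarrow> nat \<Rightarrow> nat" where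
  "shift_up \<sigma> i = (case i of 0 \<Rightarrow> 0 | Suc j \<Rightarrow> Suc (\<sigma> j))"

definition front_cycle :: "nat \<Rightarrow> nat \<Rightarrow> nat" where
  "front_cycle k i = (if i = k then 0 else if i < k then Suc i else i)"

lemma shift_up_simps [simp]: "shift_up \<sigma> 0 = 0" "shift_up \<sigma> (Suc i) = Suc (\<sigma> i)"
  by (simp_all add: shift_up_def)

lemma front_cycle_Suc: "front_cycle (Suc k) = front_cycle k \<circ> Transposition.transpose k (Suc k)"
  by (auto simp: fun_eq_iff front_cycle_def transpose_def)

lemma front_cycle_0: "front_cycle 0 = id"
  by (auto simp: fun_eq_iff front_cycle_def)

lemma front_cycle_permutes: "front_cycle k permutes {..k}"
proof (induction k)
  case (Suc k)
  have "front_cycle k permutes {..Suc k}"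
    by (rule permutes_subset[OF Suc]) auto
  moreover have "Transposition.transpose k (Suc k) permutes {..Suc k}"
    by (rule permutes_swap_id) auto
  ultimately show ?case unfolding front_cycle_Suc by (intro permutes_compose)
qed (auto simp: permutes_def front_cycle_def)

lemma permutation_front_cycle: "permutation (front_cycle k)"
  using front_cycle_permutes permutation_permutes by blast

lemma evenperm_front_cycle: "evenperm (front_cycle k) \<longleftrightarrow> even k"
proof (induction k)
  case (Suc k)
  then show ?case
    unfolding front_cycle_Suc
    by (subst evenperm_comp) (simp_all add: permutation_front_cycle permutation_swap_id evenperm_swap)
qed (simp add: front_cycle_0)

lemma shift_up_comp: "shift_up (\<sigma> \<circ> \<tau>) = shift_up \<sigma> \<circ> shift_up \<tau>"
  by (auto simp: fun_eq_iff shift_up_def split: nat.splits)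

lemma inj_shift_up: "inj shift_up"
proof (rule injI, rule ext)
  fix \<sigma> \<tau> i assume "shift_up \<sigma> = shift_up \<tau>"
  then have "shift_up \<sigma> (Suc i) = shift_up \<tau> (Suc i)" by simp
  then show "\<sigma> i = \<tau> i" by simp
qed

lemma shift_up_permutes:
  assumes "\<sigma> permutes {..<n}" shows "shift_up \<sigma> permutes {..<Suc n}"
proof (rule bij_imp_permutes)
  have \<sigma>: "\<sigma> i < n \<longleftrightarrow> i < n" for i using permutes_in_image[OF assms, of i] by simp
  have "inj (shift_up \<sigma>)"
  proof (rule injI)
    fix i j assume "shift_up \<sigma> i = shift_up \<sigma> j"
    then show "i = j" using permutes_inj[OF assms] by (cases i; cases j) (simp_all add: inj_eq)
  qed
  moreover have "shift_up \<sigma> i < Suc n" if "i < Suc n" for i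
    using \<sigma> that by (cases i) simp_all
  then have "shift_up \<sigma> ` {..<Suc n} \<subseteq> {..<Suc n}" by auto
  ultimately show "bij_betw (shift_up \<sigma>) {..<Suc n} {..<Suc n}"
    by (intro bij_betw_imageI endo_inj_surj) (auto intro: inj_on_subset)
  show "shift_up \<sigma> x = x" if "x \<notin> {..<Suc n}" for x
    using that permutes_not_in[OF assms] by (cases x) simp_all
qed

lemma evenperm_shift_up:
  assumes "\<sigma> permutes {..<n}" shows "evenperm (shift_up \<sigma>) \<longleftrightarrow> evenperm \<sigma>"
  using finite_lessThan[of n] assms
proof (induction rule: permutes_rev_induct)
  case id
  have "shift_up id = id" by (auto simp: fun_eq_iff shift_up_def split: nat.splits)
  then show ?case by (simp only:)
next
  case (swap a b p)
  have p: "permutation p" and up: "permutation (shift_up p)"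
    using swap shift_up_permutes permutation_permutes by blast+
  have t: "shift_up (Transposition.transpose a b) = Transposition.transpose (Suc a) (Suc b)"
    by (auto simp: fun_eq_iff shift_up_def transpose_def split: nat.splits)
  show ?case
    using swap.hyps(3) swap.IH unfolding shift_up_comp t
    by (simp only: evenperm_comp p up permutation_swap_id evenperm_swap nat.inject)
qed

text \<open>
  This inverts \<^term>\<open>shift_up\<close> and so gives the surjectivity in the two descriptions of shuffles
  below.
\<close>

lemma fixing_zero_is_shift_up:
  assumes "\<tau> permutes {..<Suc n}" "\<tau> 0 = 0"
  obtains \<sigma> where "\<sigma> permutes {..<n}" "\<tau> = shift_up \<sigma>"
proof
  define \<sigma> where "\<sigma> i = \<tau> (Suc i) - 1" for i
  have pos: "\<tau> (Suc i) > 0" for i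
    using permutes_inj[OF assms(1)] assms(2) by (metis gr0I injD nat.distinct(1))
  have \<tau>: "\<tau> i < Suc n \<longleftrightarrow> i < Suc n" for i using permutes_in_image[OF assms(1), of i] by simp
  show up: "\<tau> = shift_up \<sigma>"
    using pos assms(2) by (auto simp: fun_eq_iff shift_up_def \<sigma>_def split: nat.splits)
  show "\<sigma> permutes {..<n}"
  proof (rule bij_imp_permutes)
    have "inj \<sigma>"
    proof (rule injI)
      fix i j assume "\<sigma> i = \<sigma> j"
      then have "\<tau> (Suc i) = \<tau> (Suc j)" by (simp add: up)
      then show "i = j" using permutes_inj[OF assms(1)] by (simp add: inj_eq)
    qed
    moreover have "\<sigma> i < n" if "i < n" for i using \<tau>[of "Suc i"] that by (simp add: up)
    then have "\<sigma> ` {..<n} \<subseteq> {..<n}" by auto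
    ultimately show "bij_betw \<sigma> {..<n} {..<n}"
      by (intro bij_betw_imageI endo_inj_surj) (auto intro: inj_on_subset)
    show "\<sigma> x = x" if "x \<notin> {..<n}" for x
      using permutes_not_in[OF assms(1), of "Suc x"] that by (simp add: up)
  qed
qed

lemma shuffle_first_block:
  "{\<tau> \<in> shuffle_perms (Suc k) m. \<tau> 0 = 0} = shift_up ` shuffle_perms k m" (is "?L = ?R")
proof
  show "?L \<subseteq> ?R"
  proof
    fix \<tau> assume \<tau>: "\<tau> \<in> ?L"
    then obtain \<sigma> where \<sigma>: "\<sigma> permutes {..<k + m}" "\<tau> = shift_up \<sigma>"
      using fixing_zero_is_shift_up[of \<tau> "k + m"] by (auto simp: shuffle_perms_def)
    have "strict_mono_on {..<k} \<sigma>"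
    proof (rule strict_mono_onI)
      fix r s assume "r \<in> {..<k}" "s \<in> {..<k}" "r < s"
      then show "\<sigma> r < \<sigma> s" using \<tau> strict_mono_onD[of "{..<Suc k}" \<tau> "Suc r" "Suc s"]
        by (auto simp: shuffle_perms_def \<sigma>)
    qed
    moreover have "strict_mono_on {k..<k + m} \<sigma>"
    proof (rule strict_mono_onI)
      fix r s assume "r \<in> {k..<k + m}" "s \<in> {k..<k + m}" "r < s"
      then show "\<sigma> r < \<sigma> s" using \<tau> strict_mono_onD[of "{Suc k..<Suc k + m}" \<tau> "Suc r" "Suc s"]
        by (auto simp: shuffle_perms_def \<sigma>)
    qed
    ultimately show "\<tau> \<in> ?R" using \<sigma> by (auto simp: shuffle_perms_def)
  qed
  show "?R \<subseteq> ?L"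
  proof
    fix \<tau> assume "\<tau> \<in> ?R"
    then obtain \<sigma> where \<sigma>: "\<sigma> permutes {..<k + m}" "strict_mono_on {..<k} \<sigma>"
      "strict_mono_on {k..<k + m} \<sigma>" "\<tau> = shift_up \<sigma>" by (auto simp: shuffle_perms_def)
    have "strict_mono_on {..<Suc k} \<tau>"
      using strict_mono_onD[OF \<sigma>(2)]
      by (auto simp: strict_mono_on_def \<sigma>(4) shift_up_def split: nat.splits)
    moreover have "strict_mono_on {Suc k..<Suc k + m} \<tau>"
      using strict_mono_onD[OF \<sigma>(3)]
      by (auto simp: strict_mono_on_def \<sigma>(4) shift_up_def split: nat.splits)
    ultimately show "\<tau> \<in> ?L" using shift_up_permutes[OF \<sigma>(1)] \<sigma>(4)
      by (auto simp: shuffle_perms_def)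
  qed
qed

lemma shuffle_second_block:
  "{\<tau> \<in> shuffle_perms k (Suc m). \<tau> k = 0} = (\<lambda>\<sigma>. shift_up \<sigma> \<circ> front_cycle k) ` shuffle_perms k m"
  (is "?L = ?R")
proof
  have fc: "front_cycle k permutes {..<Suc (k + m)}"
    by (rule permutes_subset[OF front_cycle_permutes]) auto
  show "?L \<subseteq> ?R"
  proof
    fix \<tau> assume \<tau>: "\<tau> \<in> ?L"
    let ?\<rho> = "\<tau> \<circ> inv (front_cycle k)"
    have "?\<rho> permutes {..<Suc (k + m)}"
      using \<tau> permutes_compose[OF permutes_inv[OF fc]] by (auto simp: shuffle_perms_def)
    moreover have "inv (front_cycle k) 0 = k"
      using permutes_inverses(2)[OF fc, of k] by (simp add: front_cycle_def)
    then have "?\<rho> 0 = 0" using \<tau> by simp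
    ultimately obtain \<sigma> where \<sigma>: "\<sigma> permutes {..<k + m}" "?\<rho> = shift_up \<sigma>"
      using fixing_zero_is_shift_up by blast
    have \<tau>_eq: "\<tau> = shift_up \<sigma> \<circ> front_cycle k"
      using permutes_inverses(2)[OF fc] by (simp add: \<sigma>(2)[symmetric] fun_eq_iff)
    have "strict_mono_on {..<k} \<sigma>"
    proof (rule strict_mono_onI)
      fix r s assume "r \<in> {..<k}" "s \<in> {..<k}" "r < s"
      then show "\<sigma> r < \<sigma> s" using \<tau> strict_mono_onD[of "{..<k}" \<tau> r s]
        by (auto simp: shuffle_perms_def \<tau>_eq front_cycle_def)
    qed
    moreover have "strict_mono_on {k..<k + m} \<sigma>"
    proof (rule strict_mono_onI)
      fix r s assume "r \<in> {k..<k + m}" "s \<in> {k..<k + m}" "r < s"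
      then show "\<sigma> r < \<sigma> s" using \<tau> strict_mono_onD[of "{k..<k + Suc m}" \<tau> "Suc r" "Suc s"]
        by (auto simp: shuffle_perms_def \<tau>_eq front_cycle_def)
    qed
    ultimately show "\<tau> \<in> ?R" using \<sigma>(1) \<tau>_eq by (auto simp: shuffle_perms_def)
  qed
  show "?R \<subseteq> ?L"
  proof
    fix \<tau> assume "\<tau> \<in> ?R"
    then obtain \<sigma> where \<sigma>: "\<sigma> permutes {..<k + m}" "strict_mono_on {..<k} \<sigma>"
      "strict_mono_on {k..<k + m} \<sigma>" "\<tau> = shift_up \<sigma> \<circ> front_cycle k"
      by (auto simp: shuffle_perms_def)
    have "\<tau> permutes {..<k + Suc m}"
      using permutes_compose[OF fc shift_up_permutes[OF \<sigma>(1)]] by (simp add: \<sigma>(4))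
    moreover have "strict_mono_on {..<k} \<tau>"
      using strict_mono_onD[OF \<sigma>(2)] by (auto simp: strict_mono_on_def \<sigma>(4) front_cycle_def)
    moreover have "strict_mono_on {k..<k + Suc m} \<tau>"
      using strict_mono_onD[OF \<sigma>(3)]
      by (auto simp: strict_mono_on_def \<sigma>(4) front_cycle_def shift_up_def split: nat.splits)
    ultimately show "\<tau> \<in> ?L" by (auto simp: shuffle_perms_def \<sigma>(4) front_cycle_def)
  qed
qed

lemma finite_shuffle_perms: "finite (shuffle_perms k m)"
  by (rule finite_subset[OF _ finite_permutations[of "{..<k + m}"]]) (auto simp: shuffle_perms_def)

text \<open>
  In a shuffle of a nonempty list, the first entry of the list heads one of the two blocks, because
  each block is increasing. Splitting by this block gives a recursion for sums over shuffles.
\<close>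

lemma sum_shuffle_perms_Suc:
  fixes F :: "(nat \<Rightarrow> nat) \<Rightarrow> 'w::comm_monoid_add"
  assumes "k \<le> Suc n"
  shows "sum F (shuffle_perms k (Suc n - k)) =
    (if 0 < k then \<Sum>\<sigma>\<in>shuffle_perms (k - 1) (Suc n - k). F (shift_up \<sigma>) else 0) +
    (if k \<le> n then \<Sum>\<sigma>\<in>shuffle_perms k (n - k). F (shift_up \<sigma> \<circ> front_cycle k) else 0)"
proof -
  let ?S = "shuffle_perms k (Suc n - k)"
  (* The first entry is in the first block (A) or in the second (B). *)
  let ?A = "{\<tau> \<in> ?S. 0 < k \<and> \<tau> 0 = 0}" and ?B = "{\<tau> \<in> ?S. k \<le> n \<and> \<tau> k = 0}"
  have cover: "(0 < k \<and> \<tau> 0 = 0) \<or> (k \<le> n \<and> \<tau> k = 0)" if "\<tau> \<in> ?S" for \<tau>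
  proof -
    have perm: "\<tau> permutes {..<Suc n}" and mono1: "strict_mono_on {..<k} \<tau>"
      and mono2: "strict_mono_on {k..<Suc n} \<tau>"
      using that assms by (auto simp: shuffle_perms_def)
    obtain p where p: "p < Suc n" "\<tau> p = 0"
      using permutes_image[OF perm] by (metis imageE lessThan_iff zero_less_Suc)
    show ?thesis
    proof (cases "p < k")
      case True
      have "p = 0"
      proof (rule ccontr)
        assume "p \<noteq> 0"
        then have "\<tau> 0 < \<tau> p" using True by (intro strict_mono_onD[OF mono1]) auto
        then show False using p by simp
      qed
      then show ?thesis using p True by simp
    next
      case False
      have "p = k"
      proof (rule ccontr)
        assume "p \<noteq> k"
        then have "\<tau> k < \<tau> p" using False p by (intro strict_mono_onD[OF mono2]) auto
        then show False using p by simp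
      qed
      then show ?thesis using p False by simp
    qed
  qed
  have disj: "?A \<inter> ?B = {}"
  proof -
    have ne: "\<tau> 0 \<noteq> \<tau> k" if "\<tau> \<in> ?S" "0 < k" for \<tau>
      using that permutes_inj by (fastforce simp: shuffle_perms_def inj_eq)
    show ?thesis
    proof (rule equals0I)
      fix \<tau> assume "\<tau> \<in> ?A \<inter> ?B"
      then have "\<tau> \<in> ?S" "0 < k" "\<tau> 0 = \<tau> k" by auto
      then show False using ne by blast
    qed
  qed
  have "?S = ?A \<union> ?B" using cover by blast
  then have "sum F ?S = sum F ?A + sum F ?B"
    using disj by (metis (no_types, lifting) finite_Un finite_shuffle_perms sum.union_disjoint)
  moreover have "sum F ?A = (if 0 < k then \<Sum>\<sigma>\<in>shuffle_perms (k - 1) (Suc n - k). F (shift_up \<sigma>) else 0)"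
  proof (cases k)
    case (Suc j)
    then have "?A = shift_up ` shuffle_perms j (n - j)"
      using shuffle_first_block[of j "n - j"] by auto
    then show ?thesis
      using Suc by (simp add: sum.reindex inj_on_subset[OF inj_shift_up])
  qed simp
  moreover have "sum F ?B =
      (if k \<le> n then \<Sum>\<sigma>\<in>shuffle_perms k (n - k). F (shift_up \<sigma> \<circ> front_cycle k) else 0)"
  proof (cases "k \<le> n")
    case True
    then have "?B = (\<lambda>\<sigma>. shift_up \<sigma> \<circ> front_cycle k) ` shuffle_perms k (n - k)"
      using shuffle_second_block[of k "n - k"] by (simp add: Suc_diff_le)
    moreover have "inj (\<lambda>\<sigma>. shift_up \<sigma> \<circ> front_cycle k)"
    proof (rule injI)
      fix \<sigma> \<tau> assume "shift_up \<sigma> \<circ> front_cycle k = shift_up \<tau> \<circ> front_cycle k"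
      then have "shift_up \<sigma> = shift_up \<tau>"
        using permutes_surj[OF front_cycle_permutes[of k]] by (metis fun.map_comp surj_iff comp_id)
      then show "\<sigma> = \<tau>" using inj_shift_up by (simp add: inj_eq)
    qed
    ultimately show ?thesis
      using True by (simp add: sum.reindex inj_on_subset)
  qed simp
  ultimately show ?thesis by simp
qed

lemma signed_simps [simp]:
  fixes x y :: "'w::ab_group_add"
  shows "signed True x = x" "signed False x = - x" "signed b (0::'w) = 0"
    "signed b (x + y) = signed b x + signed b y" "signed b (- x) = - signed b x"
    "signed b (x - y) = signed b x - signed b y"
    "signed b (signed c x) = signed (b = c) x" "signed (\<not> b) x = - signed b x"
  by (auto simp: signed_def)

lemma signed_mult:
  fixes x y :: "'e::ring"
  shows "signed b x * y = signed b (x * y)" "x * signed b y = signed b (x * y)"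
  by (auto simp: signed_def)

lemma cup_Nil: "cup mul \<omega> \<omega>' [] = mul (\<omega> []) (\<omega>' [])"
proof -
  have "shuffle_perms 0 0 = {id}" by (auto simp: shuffle_perms_def strict_mono_on_def)
  then show ?thesis by (simp add: cup_def)
qed

text \<open>
  The first argument \<open>X\<close> is the first argument of \<open>\<omega>\<close> or that of \<open>\<omega>'\<close>; in the second case the sign
  is that of the cycle which carries \<open>X\<close> past the arguments of \<open>\<omega>\<close>. So \<open>i\<^sub>X\<close> is an antiderivation of
  the cup product. Together with \<open>cup_Nil\<close> this determines the product, and the identities for it below
  follow by induction from these two equations.
\<close>

lemma cup_Cons:
  fixes \<omega> \<omega>' :: "'l list \<Rightarrow> 'e::ring"
  shows "cup (*) \<omega> \<omega>' (X # xs) =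
    cup (*) (insertion X \<omega>) \<omega>' xs + cup (*) (grading \<omega>) (insertion X \<omega>') xs"
proof -
  define n where "n = length xs"
  define F where "F k \<tau> = signed (evenperm \<tau>) (\<omega> (map (\<lambda>i. (X # xs) ! \<tau> i) [0..<k]) *
      \<omega>' (map (\<lambda>i. (X # xs) ! \<tau> i) [k..<Suc n]))" for k \<tau>
  have "cup (*) \<omega> \<omega>' (X # xs) = (\<Sum>k\<le>Suc n. sum (F k) (shuffle_perms k (Suc n - k)))"
    by (simp add: cup_def n_def F_def)
  also have "\<dots> = (\<Sum>k\<le>Suc n.
      (if 0 < k then \<Sum>\<sigma>\<in>shuffle_perms (k - 1) (Suc n - k). F k (shift_up \<sigma>) else 0)) +
    (\<Sum>k\<le>Suc n. (if k \<le> n then \<Sum>\<sigma>\<in>shuffle_perms k (n - k). F k (shift_up \<sigma> \<circ> front_cycle k) else 0))"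
    by (subst sum.distrib[symmetric], rule sum.cong) (auto simp: sum_shuffle_perms_Suc)
  also have "\<dots> = (\<Sum>k\<le>n. \<Sum>\<sigma>\<in>shuffle_perms k (n - k). F (Suc k) (shift_up \<sigma>)) +
      (\<Sum>k\<le>n. \<Sum>\<sigma>\<in>shuffle_perms k (n - k). F k (shift_up \<sigma> \<circ> front_cycle k))"
    by (subst (1) sum.atMost_Suc_shift) (simp del: sum.atMost_Suc_shift)
  also have "(\<Sum>k\<le>n. \<Sum>\<sigma>\<in>shuffle_perms k (n - k). F (Suc k) (shift_up \<sigma>)) =
      cup (*) (insertion X \<omega>) \<omega>' xs"
    unfolding cup_def n_def[symmetric]
  proof (intro sum.cong refl)
    fix k \<sigma> assume k: "k \<in> {..n}" and \<sigma>: "\<sigma> \<in> shuffle_perms k (n - k)"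
    then have "evenperm (shift_up \<sigma>) = evenperm \<sigma>"
      by (intro evenperm_shift_up) (auto simp: shuffle_perms_def)
    moreover have "map (\<lambda>i. (X # xs) ! shift_up \<sigma> i) [0..<Suc k] = X # map (\<lambda>i. xs ! \<sigma> i) [0..<k]"
      by (simp only: upt_conv_Cons[of 0 "Suc k"] map_Suc_upt[symmetric] zero_less_Suc list.map map_map) simp
    moreover have "map (\<lambda>i. (X # xs) ! shift_up \<sigma> i) [Suc k..<Suc n] = map (\<lambda>i. xs ! \<sigma> i) [k..<n]"
      by (simp only: map_Suc_upt[symmetric] map_map) simp
    ultimately show "F (Suc k) (shift_up \<sigma>) = signed (evenperm \<sigma>)
       (insertion X \<omega> (map (\<lambda>i. xs ! \<sigma> i) [0..<k]) * \<omega>' (map (\<lambda>i. xs ! \<sigma> i) [k..<n]))"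
      by (simp only: F_def insertion_def)
  qed
  also have "(\<Sum>k\<le>n. \<Sum>\<sigma>\<in>shuffle_perms k (n - k). F k (shift_up \<sigma> \<circ> front_cycle k)) =
      cup (*) (grading \<omega>) (insertion X \<omega>') xs"
    unfolding cup_def n_def[symmetric]
  proof (intro sum.cong refl)
    fix k \<sigma> assume k: "k \<in> {..n}" and \<sigma>: "\<sigma> \<in> shuffle_perms k (n - k)"
    then have \<sigma>_perm: "\<sigma> permutes {..<n}" by (auto simp: shuffle_perms_def)
    then have "evenperm (shift_up \<sigma> \<circ> front_cycle k) = (evenperm \<sigma> = even k)"
      using evenperm_shift_up shift_up_permutes permutation_permutes permutation_front_cycle
        evenperm_front_cycle evenperm_comp by (metis finite_lessThan)
    moreover have "map (\<lambda>i. (X # xs) ! (shift_up \<sigma> \<circ> front_cycle k) i) [0..<k] = map (\<lambda>i. xs ! \<sigma> i) [0..<k]"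
      by (auto simp: front_cycle_def)
    moreover have "map (\<lambda>i. (X # xs) ! (shift_up \<sigma> \<circ> front_cycle k) i) [k..<Suc n] = X # map (\<lambda>i. xs ! \<sigma> i) [k..<n]"
    proof -
      have "[k..<Suc n] = k # map Suc [k..<n]" using k by (simp add: upt_conv_Cons map_Suc_upt del: upt_Suc)
      then show ?thesis by (auto simp: front_cycle_def simp del: upt_Suc)
    qed
    ultimately show "F k (shift_up \<sigma> \<circ> front_cycle k) = signed (evenperm \<sigma>)
       (grading \<omega> (map (\<lambda>i. xs ! \<sigma> i) [0..<k]) * insertion X \<omega>' (map (\<lambda>i. xs ! \<sigma> i) [k..<n]))"
      by (simp only: F_def insertion_def grading_def signed_mult length_map length_upt diff_zero signed_simps)
  qed
  finally show ?thesis .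
qed

section \<open>The cup product of forms with values in a ring\<close>

abbreviation cup_ring :: "('l list \<Rightarrow> 'e::ring) \<Rightarrow> ('l list \<Rightarrow> 'e) \<Rightarrow> 'l list \<Rightarrow> 'e" (infixl "\<smile>" 70)
  where "\<omega> \<smile> \<omega>' \<equiv> cup (*) \<omega> \<omega>'"

lemma insertion_apply: "insertion X \<omega> xs = \<omega> (X # xs)"
  by (simp add: insertion_def)

lemma insertion_linear:
  fixes \<omega> \<omega>' :: "'l list \<Rightarrow> 'w::ab_group_add"
  shows "insertion X (\<omega> + \<omega>') = insertion X \<omega> + insertion X \<omega>'"
    "insertion X (\<omega> - \<omega>') = insertion X \<omega> - insertion X \<omega>'"
    "insertion X (- \<omega>) = - insertion X \<omega>"
    "insertion X (0 :: 'l list \<Rightarrow> 'w) = 0"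
  by (auto simp: insertion_def fun_eq_iff)

lemma grading_linear:
  fixes \<omega> \<omega>' :: "'l list \<Rightarrow> 'w::ab_group_add"
  shows "grading (\<omega> + \<omega>') = grading \<omega> + grading \<omega>'"
    "grading (- \<omega>) = - grading \<omega>"
    "grading (0 :: 'l list \<Rightarrow> 'w) = 0"
    "grading (grading \<omega>) = \<omega>"
  by (auto simp: grading_def fun_eq_iff)

lemma insertion_grading:
  fixes \<omega> :: "'l list \<Rightarrow> 'w::ab_group_add"
  shows "insertion X (grading \<omega>) = - grading (insertion X \<omega>)"
  by (auto simp: insertion_def grading_def fun_eq_iff)

lemma cup_linear:
  shows cup_add_left: "(\<omega> + \<omega>') \<smile> \<rho> = \<omega> \<smile> \<rho> + \<omega>' \<smile> \<rho>"
    and cup_add_right: "\<rho> \<smile> (\<omega> + \<omega>') = \<rho> \<smile> \<omega> + \<rho> \<smile> \<omega>'"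
    and cup_minus_left: "(- \<omega>) \<smile> \<rho> = - (\<omega> \<smile> \<rho>)"
    and cup_minus_right: "\<rho> \<smile> (- \<omega>) = - (\<rho> \<smile> \<omega>)"
    and cup_zero_left: "0 \<smile> \<rho> = 0"
    and cup_zero_right: "\<rho> \<smile> 0 = 0"
  by (auto simp: fun_eq_iff cup_def distrib_left distrib_right sum.distrib sum_negf)

lemma insertion_cup:
  "insertion X (\<omega> \<smile> \<omega>') = insertion X \<omega> \<smile> \<omega>' + grading \<omega> \<smile> insertion X \<omega>'"
  by (simp add: fun_eq_iff insertion_apply cup_Cons)

lemma cup_diff_left: "(\<omega> - \<omega>') \<smile> \<rho> = \<omega> \<smile> \<rho> - \<omega>' \<smile> \<rho>"
  using cup_add_left[of \<omega> "- \<omega>'" \<rho>] by (simp add: cup_minus_left)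

lemma cup_diff_right: "\<rho> \<smile> (\<omega> - \<omega>') = \<rho> \<smile> \<omega> - \<rho> \<smile> \<omega>'"
  using cup_add_right[of \<rho> \<omega> "- \<omega>'"] by (simp add: cup_minus_right)

lemma insertion_map: "insertion X (\<lambda>ys. h (\<omega> ys)) = (\<lambda>ys. h (insertion X \<omega> ys))"
  by (simp add: insertion_def)

lemmas form_simps = insertion_linear grading_linear cup_linear insertion_grading insertion_cup

text \<open>
  This proof sets the pattern for the ones that follow: two functions on lists agree if they agree on
  the empty list and after each insertion, and after an insertion both sides are sums of terms to which
  the induction hypothesis applies.
\<close>

lemma grading_cup: "grading (\<omega> \<smile> \<omega>') = grading \<omega> \<smile> grading \<omega>'"
proof
  show "grading (\<omega> \<smile> \<omega>') xs = (grading \<omega> \<smile> grading \<omega>') xs" for xs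
  proof (induction xs arbitrary: \<omega> \<omega>')
    case (Cons X xs)
    have "grading (\<omega> \<smile> \<omega>') (X # xs) = insertion X (grading (\<omega> \<smile> \<omega>')) xs"
      by (simp add: insertion_apply)
    also have "\<dots> = (insertion X (grading \<omega> \<smile> grading \<omega>')) xs"
      by (simp add: form_simps Cons.IH)
    finally show ?case by (simp add: insertion_apply)
  qed (simp add: grading_def cup_Nil)
qed

lemma cup_assoc: "(\<omega> \<smile> \<omega>') \<smile> \<omega>'' = \<omega> \<smile> (\<omega>' \<smile> \<omega>'')"
proof
  show "((\<omega> \<smile> \<omega>') \<smile> \<omega>'') xs = (\<omega> \<smile> (\<omega>' \<smile> \<omega>'')) xs" for xs
  proof (induction xs arbitrary: \<omega> \<omega>' \<omega>'')
    case (Cons X xs)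
    have "((\<omega> \<smile> \<omega>') \<smile> \<omega>'') (X # xs) = insertion X ((\<omega> \<smile> \<omega>') \<smile> \<omega>'') xs"
      by (simp add: insertion_apply)
    also have "\<dots> = insertion X (\<omega> \<smile> (\<omega>' \<smile> \<omega>'')) xs"
      by (simp add: form_simps grading_cup Cons.IH)
    finally show ?case by (simp add: insertion_apply)
  qed (simp add: cup_Nil mult.assoc)
qed

definition unit_form :: "'w::zero \<Rightarrow> 'l list \<Rightarrow> 'w" where
  "unit_form u = (\<lambda>xs. if xs = [] then u else 0)"

lemma insertion_unit_form: "insertion X (unit_form u) = (0 :: 'l list \<Rightarrow> 'w::ab_group_add)"
  by (simp add: insertion_def unit_form_def fun_eq_iff)

lemma grading_unit_form: "grading (unit_form u) = (unit_form u :: 'l list \<Rightarrow> 'w::ab_group_add)"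
  by (simp add: grading_def unit_form_def fun_eq_iff)

lemma cup_unit_right:
  fixes u :: "'e::ring"
  assumes "\<And>x. x * u = x" shows "\<omega> \<smile> unit_form u = \<omega>"
proof
  show "(\<omega> \<smile> unit_form u) xs = \<omega> xs" for xs
  proof (induction xs arbitrary: \<omega>)
    case (Cons X xs)
    have "(\<omega> \<smile> unit_form u) (X # xs) = insertion X (\<omega> \<smile> unit_form u) xs"
      by (simp add: insertion_apply)
    also have "\<dots> = insertion X \<omega> xs" by (simp add: form_simps insertion_unit_form Cons.IH)
    finally show ?case by (simp add: insertion_apply)
  qed (simp add: cup_Nil unit_form_def assms)
qed

lemma cup_unit_left:
  fixes u :: "'e::ring"
  assumes "\<And>x. u * x = x" shows "unit_form u \<smile> \<omega> = \<omega>"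
proof
  show "(unit_form u \<smile> \<omega>) xs = \<omega> xs" for xs
  proof (induction xs arbitrary: \<omega>)
    case (Cons X xs)
    have "(unit_form u \<smile> \<omega>) (X # xs) = insertion X (unit_form u \<smile> \<omega>) xs"
      by (simp add: insertion_apply)
    also have "\<dots> = insertion X \<omega> xs"
      by (simp add: form_simps insertion_unit_form grading_unit_form Cons.IH)
    finally show ?case by (simp add: insertion_apply)
  qed (simp add: cup_Nil unit_form_def assms)
qed

definition nonunital_subring :: "'e::ring set \<Rightarrow> bool" where
  "nonunital_subring S \<longleftrightarrow> 0 \<in> S \<and> (\<forall>x\<in>S. - x \<in> S) \<and> (\<forall>x\<in>S. \<forall>y\<in>S. x + y \<in> S \<and> x * y \<in> S)"

lemma cup_in_subring:
  assumes "nonunital_subring S" "\<And>xs. \<omega> xs \<in> S" "\<And>xs. \<omega>' xs \<in> S"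
  shows "(\<omega> \<smile> \<omega>') xs \<in> S"
proof -
  have sum: "sum f I \<in> S" if "\<And>i. i \<in> I \<Longrightarrow> f i \<in> S" for f :: "'i \<Rightarrow> _" and I
    using that assms(1) by (induction I rule: infinite_finite_induct) (auto simp: nonunital_subring_def)
  show ?thesis
    unfolding cup_def using assms by (intro sum) (auto simp: nonunital_subring_def signed_def intro!: sum)
qed

lemma cup_homogeneous:
  fixes \<omega> \<omega>' :: "'l list \<Rightarrow> 'e::ring"
  assumes "\<And>xs. length xs \<noteq> p \<Longrightarrow> \<omega> xs = 0" "\<And>xs. length xs \<noteq> q \<Longrightarrow> \<omega>' xs = 0"
    and "length xs \<noteq> p + q"
  shows "(\<omega> \<smile> \<omega>') xs = 0"
  unfolding cup_def
proof (intro sum.neutral ballI)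
  fix k \<sigma> assume "k \<in> {..length xs}"
  then have "k \<noteq> p \<or> length xs - k \<noteq> q" using assms(3) by auto
  then have "\<omega> (map (\<lambda>i. xs ! \<sigma> i) [0..<k]) = 0 \<or> \<omega>' (map (\<lambda>i. xs ! \<sigma> i) [k..<length xs]) = 0"
    using assms(1)[of "map (\<lambda>i. xs ! \<sigma> i) [0..<k]"]
      assms(2)[of "map (\<lambda>i. xs ! \<sigma> i) [k..<length xs]"] by (simp only: length_map length_upt) auto
  then show "signed (evenperm \<sigma>) (\<omega> (map (\<lambda>i. xs ! \<sigma> i) [0..<k]) *
      \<omega>' (map (\<lambda>i. xs ! \<sigma> i) [k..<length xs])) = 0"
    by (elim disjE) (simp_all only: mult_zero_left mult_zero_right signed_simps)
qed

lemma one_form_other: "length xs \<noteq> 1 \<Longrightarrow> one_form h xs = 0"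
  by (auto simp: one_form_def split: list.splits)

text \<open>
  Insertion changes the parity of \<open>\<omega>\<close>, so the even and the odd case are proved together. In the odd
  case the sign is determined by the degree of \<open>\<omega>'\<close>; the grading involution records it.
\<close>

lemma trace_cup_commute_aux:
  fixes \<tau> :: "'e::ring \<Rightarrow> 't::ab_group_add" and \<omega> \<omega>' :: "'l list \<Rightarrow> 'e"
  assumes S: "nonunital_subring S"
    and add: "\<And>x y. \<tau> (x + y) = \<tau> x + \<tau> y"
    and comm: "\<And>x y. x \<in> S \<Longrightarrow> y \<in> S \<Longrightarrow> \<tau> (x * y) = \<tau> (y * x)"
    and "\<And>xs. \<omega> xs \<in> S" "\<And>xs. \<omega>' xs \<in> S"
  shows "(grading \<omega> = \<omega> \<longrightarrow> \<tau> ((\<omega> \<smile> \<omega>') xs) = \<tau> ((\<omega>' \<smile> \<omega>) xs)) \<and>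
    (grading \<omega> = - \<omega> \<longrightarrow> \<tau> ((\<omega> \<smile> \<omega>') xs) = \<tau> ((grading \<omega>' \<smile> \<omega>) xs))"
  using assms(4,5)
proof (induction xs arbitrary: \<omega> \<omega>')
  case Nil
  then show ?case using comm by (simp add: cup_Nil grading_def)
next
  case (Cons X xs)
  have \<tau>d: "\<tau> (x - y) = \<tau> x - \<tau> y" for x y
    using add[of "x - y" y] by simp
  have ins: "(\<omega> \<smile> \<omega>') (X # xs) = (insertion X \<omega> \<smile> \<omega>') xs + (grading \<omega> \<smile> insertion X \<omega>') xs"
    for \<omega> \<omega>' :: "'l list \<Rightarrow> 'e" by (simp add: cup_Cons)
  have SX: "insertion X \<omega> ys \<in> S" "insertion X \<omega>' ys \<in> S" for ys
    using Cons.prems by (simp_all add: insertion_apply)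
  have parity: "grading (insertion X \<omega>) = - insertion X (grading \<omega>)"
    by (simp add: insertion_grading)
  show ?case
  proof (intro conjI impI)
    assume ev: "grading \<omega> = \<omega>"
    then have "grading (insertion X \<omega>) = - insertion X \<omega>" by (simp add: parity)
    then have "\<tau> ((insertion X \<omega> \<smile> \<omega>') xs) = \<tau> ((grading \<omega>' \<smile> insertion X \<omega>) xs)"
      using Cons.IH[of "insertion X \<omega>" \<omega>', OF SX(1) Cons.prems(2)] by blast
    moreover have "\<tau> ((\<omega> \<smile> insertion X \<omega>') xs) = \<tau> ((insertion X \<omega>' \<smile> \<omega>) xs)"
      using Cons.IH[of \<omega> "insertion X \<omega>'", OF Cons.prems(1) SX(2)] ev by blast
    ultimately show "\<tau> ((\<omega> \<smile> \<omega>') (X # xs)) = \<tau> ((\<omega>' \<smile> \<omega>) (X # xs))"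
      by (simp add: ins add ev add.commute)
  next
    assume od: "grading \<omega> = - \<omega>"
    then have "grading (insertion X \<omega>) = insertion X \<omega>" by (simp add: parity insertion_linear)
    then have "\<tau> ((insertion X \<omega> \<smile> \<omega>') xs) = \<tau> ((\<omega>' \<smile> insertion X \<omega>) xs)"
      using Cons.IH[of "insertion X \<omega>" \<omega>', OF SX(1) Cons.prems(2)] by blast
    moreover have "\<tau> ((\<omega> \<smile> insertion X \<omega>') xs) = \<tau> ((grading (insertion X \<omega>') \<smile> \<omega>) xs)"
      using Cons.IH[of \<omega> "insertion X \<omega>'", OF Cons.prems(1) SX(2)] od by blast
    ultimately show "\<tau> ((\<omega> \<smile> \<omega>') (X # xs)) = \<tau> ((grading \<omega>' \<smile> \<omega>) (X # xs))"
      by (simp add: ins od form_simps \<tau>d)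
  qed
qed

lemma trace_cup_commute:
  fixes \<tau> :: "'e::ring \<Rightarrow> 't::ab_group_add"
  assumes "nonunital_subring S"
    and "\<And>x y. \<tau> (x + y) = \<tau> x + \<tau> y"
    and "\<And>x y. x \<in> S \<Longrightarrow> y \<in> S \<Longrightarrow> \<tau> (x * y) = \<tau> (y * x)"
    and "\<And>xs. \<omega> xs \<in> S" "\<And>xs. \<omega>' xs \<in> S"
    and "grading \<omega> = \<omega>"
  shows "\<tau> ((\<omega> \<smile> \<omega>') xs) = \<tau> ((\<omega>' \<smile> \<omega>) xs)"
  using trace_cup_commute_aux[where \<tau> = \<tau> and S = S and \<omega> = \<omega> and \<omega>' = \<omega>' and xs = xs] assms by blast

section \<open>The Cartan differential\<close>

text \<open>
  The part \<open>\<Sum>\<^sub>j \<omega>(\<dots>, [X, X\<^sub>j], \<dots>)\<close> of the Lie derivative; the Lie derivative itself is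
  \<open>\<L>\<^sub>X \<omega> = \<delta> X \<circ> \<omega> - lie_args br X \<omega>\<close>. The differential \<open>cartan_d\<close> below is defined by Cartan's formula
  \<open>i\<^sub>X d = \<L>\<^sub>X - d i\<^sub>X\<close>, where the family \<open>\<delta>\<close> is the action of \<open>L\<close> on the values: the given
  action on \<open>A\<close>, or commutators with the connection on endomorphisms.
\<close>

fun lie_args :: "('l \<Rightarrow> 'l \<Rightarrow> 'l) \<Rightarrow> 'l \<Rightarrow> ('l list \<Rightarrow> 'w::ab_group_add) \<Rightarrow> 'l list \<Rightarrow> 'w" where
  "lie_args br X \<omega> [] = 0"
| "lie_args br X \<omega> (Y # xs) = \<omega> (br X Y # xs) + lie_args br X (insertion Y \<omega>) xs"

fun cartan_d ::
  "('l \<Rightarrow> 'l \<Rightarrow> 'l) \<Rightarrow> ('l \<Rightarrow> 'w \<Rightarrow> 'w) \<Rightarrow> ('l list \<Rightarrow> 'w::ab_group_add) \<Rightarrow> 'l list \<Rightarrow> 'w" where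
  "cartan_d br \<delta> \<omega> [] = 0"
| "cartan_d br \<delta> \<omega> (X # xs) = \<delta> X (\<omega> xs) - lie_args br X \<omega> xs - cartan_d br \<delta> (insertion X \<omega>) xs"

lemma insertion_lie_args:
  "insertion Y (lie_args br X \<omega>) = insertion (br X Y) \<omega> + lie_args br X (insertion Y \<omega>)"
  by (simp add: fun_eq_iff insertion_apply)

lemma insertion_cartan_d:
  "insertion X (cartan_d br \<delta> \<omega>) = (\<lambda>ys. \<delta> X (\<omega> ys)) - lie_args br X \<omega> - cartan_d br \<delta> (insertion X \<omega>)"
  by (simp add: fun_eq_iff insertion_apply)

lemma lie_args_add: "lie_args br X (\<omega> + \<omega>') = lie_args br X \<omega> + lie_args br X \<omega>'"
proof
  show "lie_args br X (\<omega> + \<omega>') xs = (lie_args br X \<omega> + lie_args br X \<omega>') xs" for xs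
    by (induction xs arbitrary: \<omega> \<omega>') (simp_all add: insertion_linear)
qed

lemma lie_args_map:
  assumes "\<And>x y. h (x + y) = h x + h y" "h 0 = 0"
  shows "lie_args br X (\<lambda>ys. h (\<omega> ys)) = (\<lambda>ys. h (lie_args br X \<omega> ys))"
proof
  show "lie_args br X (\<lambda>ys. h (\<omega> ys)) xs = h (lie_args br X \<omega> xs)" for xs
    by (induction xs arbitrary: \<omega>) (simp_all add: assms insertion_map)
qed

lemma lie_args_minus: "lie_args br X (- \<omega>) = - lie_args br X \<omega>"
  using lie_args_map[of uminus br X \<omega>] by (simp add: fun_Compl_def)

lemma grading_lie_args: "grading (lie_args br X \<omega>) = lie_args br X (grading \<omega>)"
proof
  show "grading (lie_args br X \<omega>) xs = lie_args br X (grading \<omega>) xs" for xs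
  proof (induction xs arbitrary: \<omega>)
    case (Cons Y xs)
    have "grading (lie_args br X \<omega>) (Y # xs) = insertion Y (grading (lie_args br X \<omega>)) xs"
      by (simp add: insertion_apply)
    also have "\<dots> = insertion Y (lie_args br X (grading \<omega>)) xs"
      by (simp add: form_simps insertion_lie_args lie_args_minus Cons.IH del: lie_args.simps)
    finally show ?case by (simp only: insertion_apply)
  qed (simp add: grading_def)
qed

lemma lie_args_cup:
  "lie_args br X (\<omega> \<smile> \<omega>') = lie_args br X \<omega> \<smile> \<omega>' + \<omega> \<smile> lie_args br X \<omega>'"
proof
  show "lie_args br X (\<omega> \<smile> \<omega>') xs = (lie_args br X \<omega> \<smile> \<omega>' + \<omega> \<smile> lie_args br X \<omega>') xs" for xs
  proof (induction xs arbitrary: \<omega> \<omega>')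
    case (Cons Y xs)
    have "lie_args br X (\<omega> \<smile> \<omega>') (Y # xs) = insertion Y (lie_args br X (\<omega> \<smile> \<omega>')) xs"
      by (simp only: insertion_apply)
    also have "\<dots> = insertion Y (lie_args br X \<omega> \<smile> \<omega>' + \<omega> \<smile> lie_args br X \<omega>') xs"
      by (simp add: form_simps insertion_lie_args lie_args_add grading_lie_args Cons.IH)
    finally show ?case by (simp only: insertion_apply)
  qed (simp add: cup_Nil)
qed

lemma lie_args_homogeneous:
  assumes "\<And>ys. length ys \<noteq> n \<Longrightarrow> \<omega> ys = (0 :: 'w::ab_group_add)" "length xs \<noteq> n"
  shows "lie_args br X \<omega> xs = 0"
  using assms
proof (induction xs arbitrary: \<omega> n)
  case (Cons Y xs)
  have "lie_args br X (insertion Y \<omega>) xs = 0"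
  proof (cases n)
    case 0
    then have "insertion Y \<omega> = 0" using Cons.prems(1) by (simp add: fun_eq_iff insertion_apply)
    then show ?thesis using lie_args_map[of "\<lambda>_. 0 :: 'w" br X \<omega>] by (simp add: zero_fun_def)
  next
    case (Suc m)
    then show ?thesis using Cons.prems by (intro Cons.IH[of m]) (auto simp: insertion_apply)
  qed
  then show ?case using Cons.prems by simp
qed simp

lemma cartan_d_add:
  assumes "\<And>X x y. \<delta> X (x + y) = \<delta> X x + \<delta> X y"
  shows "cartan_d br \<delta> (\<omega> + \<omega>') = cartan_d br \<delta> \<omega> + cartan_d br \<delta> \<omega>'"
proof
  show "cartan_d br \<delta> (\<omega> + \<omega>') xs = (cartan_d br \<delta> \<omega> + cartan_d br \<delta> \<omega>') xs" for xs
    by (induction xs arbitrary: \<omega> \<omega>') (simp_all add: insertion_linear lie_args_add assms)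
qed

text \<open>
  A map of values that intertwines the two actions commutes with the differentials. It is used for
  traces, for coefficients of power series and for negation.
\<close>

lemma cartan_d_map:
  fixes h :: "'w::ab_group_add \<Rightarrow> 't::ab_group_add"
  assumes add: "\<And>x y. h (x + y) = h x + h y"
    and comm: "\<And>X xs. h (\<delta> X (\<omega> xs)) = \<delta>' X (h (\<omega> xs))"
  shows "cartan_d br \<delta>' (\<lambda>ys. h (\<omega> ys)) = (\<lambda>ys. h (cartan_d br \<delta> \<omega> ys))"
proof
  have h0: "h 0 = 0" using add[of 0 0] by simp
  have diff: "h (x - y) = h x - h y" for x y using add[of "x - y" y] by (simp add: algebra_simps)
  show "cartan_d br \<delta>' (\<lambda>ys. h (\<omega> ys)) xs = h (cartan_d br \<delta> \<omega> xs)" for xs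
    using comm
  proof (induction xs arbitrary: \<omega>)
    case (Cons X xs)
    have "cartan_d br \<delta>' (\<lambda>ys. h (insertion X \<omega> ys)) xs = h (cartan_d br \<delta> (insertion X \<omega>) xs)"
      by (rule Cons.IH) (simp add: insertion_apply Cons.prems)
    then show ?case
      by (simp add: insertion_map lie_args_map[OF add h0] Cons.prems diff)
  qed (simp add: h0)
qed

lemma cartan_d_minus:
  assumes "\<And>X x y. \<delta> X (x + y) = \<delta> X x + \<delta> X (y :: 'w::ab_group_add)"
  shows "cartan_d br \<delta> (- \<omega>) = - cartan_d br \<delta> \<omega>"
proof -
  have "\<delta> X 0 = 0" for X using assms[of X 0 0] by simp
  then have "\<delta> X (- x) = - \<delta> X x" for X x
    using assms[of X x "- x"] by (simp add: add_eq_0_iff)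
  then show ?thesis
    using cartan_d_map[of uminus \<delta> \<omega> \<delta> br] by (simp add: fun_Compl_def)
qed

lemma cartan_d_grading:
  assumes "\<And>X x y. \<delta> X (x + y) = \<delta> X x + \<delta> X (y :: 'w::ab_group_add)"
  shows "cartan_d br \<delta> (grading \<omega>) = - grading (cartan_d br \<delta> \<omega>)"
proof
  have \<delta>: "\<delta> X 0 = 0" for X using assms[of X 0 0] by simp
  then have \<delta>m: "\<delta> X (- x) = - \<delta> X x" for X x
    using assms[of X x "- x"] by (simp add: add_eq_0_iff)
  show "cartan_d br \<delta> (grading \<omega>) xs = (- grading (cartan_d br \<delta> \<omega>)) xs" for xs
  proof (induction xs arbitrary: \<omega>)
    case (Cons X xs)
    have "\<delta> X (grading \<omega> xs) = signed (even (length xs)) (\<delta> X (\<omega> xs))"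
      by (simp add: grading_def signed_def \<delta>m)
    moreover have "lie_args br X (grading \<omega>) xs = signed (even (length xs)) (lie_args br X \<omega> xs)"
      by (simp only: grading_lie_args[symmetric]) (simp add: grading_def)
    moreover have "cartan_d br \<delta> (insertion X (grading \<omega>)) xs =
        signed (even (length xs)) (cartan_d br \<delta> (insertion X \<omega>) xs)"
      by (simp add: insertion_grading cartan_d_minus[OF assms] Cons.IH) (simp add: grading_def)
    ultimately show ?case by (simp add: grading_def)
  qed (simp add: grading_def)
qed

text \<open>
  By Cartan's formula the insertion of \<open>X\<close> into either side reduces to the rule for shorter lists, since
  \<open>\<L>\<^sub>X\<close> is a derivation of the cup product, \<open>i\<^sub>X\<close> is an antiderivation of it, and \<open>d\<close> anticommutes
  with the grading involution.
\<close>

lemma cartan_d_cup: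
  fixes \<delta> :: "'l \<Rightarrow> 'e::ring \<Rightarrow> 'e"
  assumes add: "\<And>X x y. \<delta> X (x + y) = \<delta> X x + \<delta> X y"
    and leibniz: "\<And>X x y. \<delta> X (x * y) = \<delta> X x * y + x * \<delta> X y"
  shows "cartan_d br \<delta> (\<omega> \<smile> \<omega>') = cartan_d br \<delta> \<omega> \<smile> \<omega>' + grading \<omega> \<smile> cartan_d br \<delta> \<omega>'"
proof
  have \<delta>0: "\<delta> X 0 = 0" for X using add[of X 0 0] by simp
  then have \<delta>m: "\<delta> X (- x) = - \<delta> X x" for X x
    using add[of X x "- x"] by (simp add: add_eq_0_iff)
  have \<delta>_sum: "\<delta> X (sum f I) = (\<Sum>i\<in>I. \<delta> X (f i))" for X I and f :: "'i \<Rightarrow> 'e"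
    by (induction I rule: infinite_finite_induct) (auto simp: \<delta>0 add)
  have \<delta>_cup: "(\<lambda>ys. \<delta> X ((\<omega> \<smile> \<omega>') ys)) = (\<lambda>ys. \<delta> X (\<omega> ys)) \<smile> \<omega>' + \<omega> \<smile> (\<lambda>ys. \<delta> X (\<omega>' ys))" for X and \<omega> \<omega>' :: "'l list \<Rightarrow> 'e"
    by (auto simp: fun_eq_iff cup_def \<delta>_sum signed_def leibniz \<delta>m sum.distrib[symmetric] intro!: sum.cong)
  show "cartan_d br \<delta> (\<omega> \<smile> \<omega>') xs =
      (cartan_d br \<delta> \<omega> \<smile> \<omega>' + grading \<omega> \<smile> cartan_d br \<delta> \<omega>') xs" for xs
  proof (induction xs arbitrary: \<omega> \<omega>')
    case (Cons X xs)
    have "cartan_d br \<delta> (\<omega> \<smile> \<omega>') (X # xs) = insertion X (cartan_d br \<delta> (\<omega> \<smile> \<omega>')) xs"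
      by (simp only: insertion_apply)
    also have "\<dots> = insertion X (cartan_d br \<delta> \<omega> \<smile> \<omega>' + grading \<omega> \<smile> cartan_d br \<delta> \<omega>') xs"
      by (simp add: form_simps cup_diff_left cup_diff_right insertion_cartan_d \<delta>_cup lie_args_cup
          cartan_d_add[OF add] Cons.IH cartan_d_grading[OF add]
          cup_minus_left[unfolded fun_Compl_def])
    finally show ?case by (simp only: insertion_apply)
  qed (simp add: cup_Nil)
qed

section \<open>Alternating forms\<close>

text \<open>
  Only adjacent repetitions are required to vanish: this condition and multilinearity are stable under
  insertion, hence suited to induction on lists. By the usual exchange argument they imply that
  all repetitions vanish (\<open>alternating_vanishes\<close>).
\<close>

definition alternating ::
  "('a \<Rightarrow> 'l::plus \<Rightarrow> 'l) \<Rightarrow> ('a \<Rightarrow> 'w::{plus,zero} \<Rightarrow> 'w) \<Rightarrow> ('l list \<Rightarrow> 'w) \<Rightarrow> bool" where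
  "alternating sL sW \<omega> \<longleftrightarrow>
     (\<forall>ys zs. ahom sL sW (\<lambda>X. \<omega> (ys @ X # zs))) \<and> (\<forall>ys X zs. \<omega> (ys @ X # X # zs) = 0)"

lemma ahom_add: "ahom s s' h \<Longrightarrow> h (x + y) = h x + h y"
  by (simp add: ahom_def)

lemma ahom_scale: "ahom s s' h \<Longrightarrow> h (s a x) = s' a (h x)"
  by (simp add: ahom_def)

lemma ahom_zero: "ahom s s' h \<Longrightarrow> h (0::'v::ab_group_add) = (0::'w::ab_group_add)"
  by (metis add_cancel_right_right ahom_add)

lemma alternating_linear: "alternating sL sW \<omega> \<Longrightarrow> ahom sL sW (\<lambda>X. \<omega> (ys @ X # zs))"
  by (simp add: alternating_def)

lemma alternating_repeat: "alternating sL sW \<omega> \<Longrightarrow> \<omega> (ys @ X # X # zs) = 0"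
  by (simp add: alternating_def)

lemma alternating_add:
  "alternating sL sW \<omega> \<Longrightarrow> \<omega> (ys @ (X + Y) # zs) = \<omega> (ys @ X # zs) + \<omega> (ys @ Y # zs)"
  using ahom_add[OF alternating_linear] .

lemma alternating_scale:
  "alternating sL sW \<omega> \<Longrightarrow> \<omega> (ys @ sL a X # zs) = sW a (\<omega> (ys @ X # zs))"
  using ahom_scale[OF alternating_linear] .

lemma alternatingI:
  assumes "\<And>ys X Y zs. \<omega> (ys @ (X + Y) # zs) = \<omega> (ys @ X # zs) + \<omega> (ys @ Y # zs)"
    and "\<And>ys a X zs. \<omega> (ys @ sL a X # zs) = sW a (\<omega> (ys @ X # zs))"
    and "\<And>ys X zs. \<omega> (ys @ X # X # zs) = 0"
  shows "alternating sL sW \<omega>"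
  unfolding alternating_def ahom_def using assms by blast

lemma alternating_insertion:
  assumes "alternating sL sW \<omega>" shows "alternating sL sW (insertion X \<omega>)"
  unfolding alternating_def insertion_def
  using alternating_linear[OF assms, of "X # _"] alternating_repeat[OF assms, of "X # _"] by simp

lemma alternating_swap:
  fixes \<omega> :: "'l::ab_group_add list \<Rightarrow> 'w::ab_group_add"
  assumes "alternating sL sW \<omega>"
  shows "\<omega> (ys @ X # Y # zs) = - \<omega> (ys @ Y # X # zs)"
proof -
  note rep = alternating_repeat[OF assms]
  have add1: "\<omega> (ys @ (U + V) # zs) = \<omega> (ys @ U # zs) + \<omega> (ys @ V # zs)" for U V ys zs
    using ahom_add[OF alternating_linear[OF assms]] .
  have add2: "\<omega> (ys @ W # (U + V) # zs) = \<omega> (ys @ W # U # zs) + \<omega> (ys @ W # V # zs)" for U V W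
    using add1[of "ys @ [W]" U V zs] by simp
  (* Polarisation of the vanishing on repeated arguments. *)
  have "0 = \<omega> (ys @ (X + Y) # (X + Y) # zs)" by (simp add: rep)
  also have "\<dots> = \<omega> (ys @ X # Y # zs) + \<omega> (ys @ Y # X # zs)"
    by (simp only: add1 add2) (simp add: rep)
  finally show ?thesis by (metis eq_neg_iff_add_eq_0)
qed

text \<open>
  Transpositions of neighbours, which only change the sign, bring the two equal arguments together.
\<close>

lemma alternating_vanishes:
  fixes \<omega> :: "'l::ab_group_add list \<Rightarrow> 'w::ab_group_add"
  assumes "alternating sL sW \<omega>" "i < j" "j < length xs" "xs ! i = xs ! j"
  shows "\<omega> xs = 0"
proof -
  have *: "\<omega> (ys @ X # us @ X # zs) = 0" for ys X us zs
  proof (induction us arbitrary: ys)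
    case Nil
    then show ?case using alternating_repeat[OF assms(1)] by simp
  next
    case (Cons U us)
    have "\<omega> (ys @ X # U # us @ X # zs) = - \<omega> ((ys @ [U]) @ X # us @ X # zs)"
      using alternating_swap[OF assms(1), of ys X U "us @ X # zs"] by simp
    then show ?case using Cons.IH[of "ys @ [U]"] by simp
  qed
  define X ys zs where "X = xs ! i" and "ys = take i xs" and "zs = drop (Suc i) xs"
  define us ws where "us = take (j - Suc i) zs" and "ws = drop (Suc j) xs"
  have 1: "xs = ys @ X # zs"
    using assms(2,3) by (simp add: id_take_nth_drop X_def ys_def zs_def)
  have "zs = us @ zs ! (j - Suc i) # drop (Suc (j - Suc i)) zs"
    unfolding us_def by (rule id_take_nth_drop) (use assms(2,3) in \<open>simp add: zs_def\<close>)
  then have 2: "zs = us @ X # ws"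
    using assms(2-4) by (simp add: X_def ws_def zs_def)
  show ?thesis by (simp only: 1 2 *)
qed

lemma alternating_imp_Alt_deg:
  fixes \<omega> :: "'l::ab_group_add list \<Rightarrow> 'w::ab_group_add"
  assumes "alternating sL sW \<omega>" "\<And>xs. \<omega> xs \<in> W"
  shows "component m \<omega> \<in> Alt_deg sL sW W m"
proof -
  have "ahom sL sW (\<lambda>X. component m \<omega> (xs[i := X]))" if "length xs = m" "i < m" for xs i
    using that alternating_linear[OF assms(1), of "take i xs" "drop (Suc i) xs"]
    by (simp add: component_def upd_conv_take_nth_drop)
  then show ?thesis
    unfolding Alt_deg_def mem_Collect_eq
    using alternating_vanishes[OF assms(1)] assms(2) by (intro conjI allI impI) (auto simp: component_def)
qed

lemma alternating_imp_Alt: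
  fixes \<omega> :: "'l::ab_group_add list \<Rightarrow> 'w::ab_group_add"
  assumes "alternating sL sW \<omega>" "\<And>xs. \<omega> xs \<in> W" "\<And>xs. N < length xs \<Longrightarrow> \<omega> xs = 0"
  shows "\<omega> \<in> Alt sL sW W"
proof -
  have "component m \<omega> = (\<lambda>_. 0)" if "m > N" for m
    unfolding component_def using that assms(3) by metis
  then show ?thesis
    using alternating_imp_Alt_deg[OF assms(1,2)] unfolding Alt_def mem_Collect_eq by blast
qed

lemma Alt_imp_alternating:
  fixes \<omega> :: "'l::ab_group_add list \<Rightarrow> 'w::ab_group_add"
  assumes "\<omega> \<in> Alt sL sW W"
  shows "alternating sL sW \<omega>"
proof -
  have "ahom sL sW (\<lambda>X. \<omega> (ys @ X # zs))" for ys zs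
  proof -
    let ?n = "length ys + Suc (length zs)"
    have "component ?n \<omega> \<in> Alt_deg sL sW W ?n" using assms by (simp add: Alt_def)
    then have "ahom sL sW (\<lambda>X. component ?n \<omega> ((ys @ undefined # zs)[length ys := X]))"
      unfolding Alt_deg_def mem_Collect_eq
      by (elim conjE allE[of _ "ys @ undefined # zs"] allE[of _ "length ys"]) simp
    then show ?thesis by (simp add: component_def)
  qed
  moreover have "\<omega> (ys @ X # X # zs) = 0" for ys X zs
  proof -
    let ?xs = "ys @ X # X # zs"
    have "component (length ?xs) \<omega> \<in> Alt_deg sL sW W (length ?xs)" using assms by (simp add: Alt_def)
    moreover have "?xs ! length ys = ?xs ! Suc (length ys)" by (simp add: nth_append)
    ultimately have "component (length ?xs) \<omega> ?xs = 0"
      unfolding Alt_deg_def mem_Collect_eq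
      by (elim conjE allE[of _ ?xs] allE[of _ "length ys"] allE[of _ "Suc (length ys)"]) simp
    then show ?thesis by (simp add: component_def)
  qed
  ultimately show ?thesis by (simp add: alternating_def)
qed

lemma alternating_map:
  assumes "alternating sL sW \<omega>"
    and "\<And>x y. h (x + y) = h x + h y" "\<And>a xs. h (sW a (\<omega> xs)) = sW' a (h (\<omega> xs))" "h 0 = 0"
  shows "alternating sL sW' (\<lambda>ys. h (\<omega> ys))"
  by (rule alternatingI)
    (simp_all only: alternating_add[OF assms(1)] alternating_scale[OF assms(1)]
      alternating_repeat[OF assms(1)] assms(2-))

lemma alternating_sum:
  fixes \<omega> :: "'i \<Rightarrow> 'l::ab_group_add list \<Rightarrow> 'w::ab_group_add"
  assumes "\<And>i. i \<in> I \<Longrightarrow> alternating sL sW (\<omega> i)"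
    and "\<And>a x y. sW a (x + y) = sW a x + sW a y"
  shows "alternating sL sW (\<lambda>ys. \<Sum>i\<in>I. \<omega> i ys)"
proof -
  have "sW a 0 = 0" for a using assms(2)[of a 0 0] by simp
  then have sW_sum: "sW a (\<Sum>i\<in>I. f i) = (\<Sum>i\<in>I. sW a (f i))" for a f
    by (induction I rule: infinite_finite_induct) (auto simp: assms(2))
  show ?thesis
  proof (rule alternatingI)
    show "(\<Sum>i\<in>I. \<omega> i (ys @ (X + Y) # zs)) = (\<Sum>i\<in>I. \<omega> i (ys @ X # zs)) + (\<Sum>i\<in>I. \<omega> i (ys @ Y # zs))"
      for ys X Y zs
      unfolding sum.distrib[symmetric] by (intro sum.cong refl alternating_add[OF assms(1)])
    show "(\<Sum>i\<in>I. \<omega> i (ys @ sL a X # zs)) = sW a (\<Sum>i\<in>I. \<omega> i (ys @ X # zs))" for ys a X zs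
      unfolding sW_sum by (intro sum.cong refl alternating_scale[OF assms(1)])
    show "(\<Sum>i\<in>I. \<omega> i (ys @ X # X # zs)) = 0" for ys X zs
      by (intro sum.neutral ballI alternating_repeat[OF assms(1)])
  qed
qed

lemma nths_Cons_compl:
  "nths (X # xs) (- {0}) = xs" "nths (X # xs) (- {Suc l}) = X # nths xs (- {l})"
  "nths (X # xs) (- {0, Suc l}) = nths xs (- {l})"
  "nths (X # xs) (- {Suc k, Suc l}) = X # nths xs (- {k, l})"
proof -
  have "- {l} = {j. j \<noteq> l}" "- {k, l} = {j. j \<noteq> k \<and> j \<noteq> l}" by auto
  then show "nths (X # xs) (- {0}) = xs" "nths (X # xs) (- {Suc l}) = X # nths xs (- {l})"
    "nths (X # xs) (- {0, Suc l}) = nths xs (- {l})"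
    "nths (X # xs) (- {Suc k, Suc l}) = X # nths xs (- {k, l})"
    by (simp_all add: nths_Cons nths_all)
qed

text \<open>
  For an alternating form the bracket can be moved to the front, which produces the signs of the
  terms \<open>\<omega>([X, X\<^sub>l], \<dots>)\<close> of the de Rham differential.
\<close>

lemma lie_args_alternating:
  fixes \<omega> :: "'l::ab_group_add list \<Rightarrow> 'w::ab_group_add"
  assumes "alternating sL sW \<omega>"
  shows "lie_args br X \<omega> xs =
    (\<Sum>l<length xs. signed (even l) (\<omega> (br X (xs ! l) # nths xs (- {l}))))"
  using assms
proof (induction xs arbitrary: \<omega>)
  case (Cons Y xs)
  have "\<omega> (br X (xs ! l) # Y # zs) = - insertion Y \<omega> (br X (xs ! l) # zs)" for l zs
    unfolding insertion_apply by (rule alternating_swap[OF Cons.prems, of "[]", unfolded append_Nil])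
  then show ?case
    using Cons.IH[OF alternating_insertion[OF Cons.prems, of Y]]
    by (simp add: sum.lessThan_Suc_shift nths_Cons_compl del: sum.lessThan_Suc)
qed simp

text \<open>
  In \<open>d \<omega> (X # xs)\<close> the terms in which \<open>X\<close> is differentiated along or bracketed form the Lie
  derivative. In all others \<open>X\<close> is an argument of \<open>\<omega>\<close>; moved to the front and inserted into \<open>\<omega>\<close>, it
  leaves \<open>- d (i\<^sub>X \<omega>) xs\<close>.
\<close>

lemma d_dR_eq_cartan_d:
  fixes \<omega> :: "'l::ab_group_add list \<Rightarrow> 'a::ab_group_add"
  assumes "alternating sL sW \<omega>"
  shows "d_dR br act \<omega> = cartan_d br act \<omega>"
proof
  show "d_dR br act \<omega> xs = cartan_d br act \<omega> xs" for xs
    using assms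
  proof (induction xs arbitrary: \<omega>)
    case (Cons X xs)
    have swap: "\<omega> (Z # X # zs) = - insertion X \<omega> (Z # zs)" for Z zs
      unfolding insertion_apply by (rule alternating_swap[OF Cons.prems, of "[]", unfolded append_Nil])
    have ins: "\<omega> (X # zs) = insertion X \<omega> zs" for zs
      by (simp add: insertion_apply)
    let ?n = "length xs"
    have "d_dR br act \<omega> (X # xs) = act X (\<omega> xs)
      - (\<Sum>l<?n. signed (even l) (act (xs ! l) (insertion X \<omega> (nths xs (- {l})))))
      - (\<Sum>l<?n. signed (even l) (\<omega> (br X (xs ! l) # nths xs (- {l}))))
      - (\<Sum>l<?n. \<Sum>k<l. signed (even (k + l)) (insertion X \<omega> (br (xs ! k) (xs ! l) # nths xs (- {k, l}))))"
      by (simp add: d_dR_def sum.lessThan_Suc_shift nths_Cons_compl swap ins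
          sum.distrib sum_subtractf sum_negf del: sum.lessThan_Suc)
    also have "\<dots> = act X (\<omega> xs) - lie_args br X \<omega> xs - d_dR br act (insertion X \<omega>) xs"
      by (simp add: d_dR_def lie_args_alternating[OF Cons.prems] algebra_simps)
    also have "\<dots> = cartan_d br act \<omega> (X # xs)"
      using Cons.IH[OF alternating_insertion[OF Cons.prems]] by simp
    finally show ?case .
  qed (simp add: d_dR_def)
qed

lemma cup_scale_left:
  fixes c :: "'e::ring" shows "(\<lambda>ys. c * \<omega> ys) \<smile> \<omega>' = (\<lambda>ys. c * (\<omega> \<smile> \<omega>') ys)"
  by (simp add: fun_eq_iff cup_def sum_distrib_left mult.assoc signed_mult)

lemma cup_scale_right:
  fixes c :: "'e::ring"
  assumes "\<And>xs. \<omega> xs * c = c * \<omega> xs"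
  shows "\<omega> \<smile> (\<lambda>ys. c * \<omega>' ys) = (\<lambda>ys. c * (\<omega> \<smile> \<omega>') ys)"
  by (simp add: fun_eq_iff cup_def sum_distrib_left mult.assoc[symmetric] signed_mult assms)

lemma alternating_grading:
  fixes \<omega> :: "'l::ab_group_add list \<Rightarrow> 'w::ab_group_add"
  assumes "alternating sL sW \<omega>" "\<And>a x. sW a (- x) = - sW a x"
  shows "alternating sL sW (grading \<omega>)"
  by (rule alternatingI)
    (simp_all add: alternating_add[OF assms(1)] alternating_scale[OF assms(1)]
      alternating_repeat[OF assms(1)] grading_def signed_def assms(2))

text \<open>
  The repetition condition is \<open>i\<^sub>X i\<^sub>X (\<omega> \<smile> \<omega>') = 0\<close>: the two mixed terms of
  \<open>i\<^sub>X i\<^sub>X (\<omega> \<smile> \<omega>')\<close> cancel as insertion anticommutes with the grading involution. Scalars pass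
  through \<open>\<omega>\<close> because its values commute with them.
\<close>

lemma alternating_cup:
  fixes \<omega> \<omega>' :: "'l::ab_group_add list \<Rightarrow> 'e::ring"
  assumes "alternating sL (\<lambda>a x. \<iota> a * x) \<omega>" "alternating sL (\<lambda>a x. \<iota> a * x) \<omega>'"
    and "\<And>a xs. \<omega> xs * \<iota> a = \<iota> a * \<omega> xs"
  shows "alternating sL (\<lambda>a x. \<iota> a * x) (\<omega> \<smile> \<omega>')"
proof -
  have grading: "alternating sL (\<lambda>a x. \<iota> a * x) (grading \<omega>)"
    if "alternating sL (\<lambda>a x. \<iota> a * x) \<omega>" for \<omega> :: "'l list \<Rightarrow> 'e"
    using that by (rule alternating_grading) simp
  have grading_comm: "grading \<omega> xs * \<iota> a = \<iota> a * grading \<omega> xs"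
    if "\<And>xs. \<omega> xs * \<iota> a = \<iota> a * \<omega> xs" for \<omega> :: "'l list \<Rightarrow> 'e" and xs a
    by (simp add: grading_def signed_mult that)
  have ins_add: "insertion (X + Y) \<omega> = insertion X \<omega> + insertion Y \<omega>"
    and ins_scale: "insertion (sL a X) \<omega> = (\<lambda>ys. \<iota> a * insertion X \<omega> ys)"
    and ins_rep: "insertion X (insertion X \<omega>) = 0"
    if "alternating sL (\<lambda>a x. \<iota> a * x) \<omega>" for \<omega> :: "'l list \<Rightarrow> 'e" and X Y a
    using alternating_add[OF that, of "[]"] alternating_scale[OF that, of "[]"]
      alternating_repeat[OF that, of "[]"]
    by (simp_all add: insertion_def fun_eq_iff)
  have linear: "ahom sL (\<lambda>a x. \<iota> a * x) (\<lambda>X. (\<omega> \<smile> \<omega>') (ys @ X # zs))" for ys zs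
    using assms
  proof (induction ys arbitrary: \<omega> \<omega>')
    case Nil
    have right: "grading \<omega> \<smile> (\<lambda>ys. \<iota> a * \<rho> ys) = (\<lambda>ys. \<iota> a * (grading \<omega> \<smile> \<rho>) ys)" for a \<rho>
      by (rule cup_scale_right) (rule grading_comm[OF Nil(3)])
    show ?case
      unfolding ahom_def append_Nil cup_Cons
      by (simp add: ins_add[OF Nil(1)] ins_add[OF Nil(2)] ins_scale[OF Nil(1)] ins_scale[OF Nil(2)]
          cup_scale_left right cup_linear distrib_left)
  next
    case (Cons Y ys)
    have "ahom sL (\<lambda>a x. \<iota> a * x) (\<lambda>X. (insertion Y \<omega> \<smile> \<omega>') (ys @ X # zs))"
      using Cons.prems by (intro Cons.IH alternating_insertion) (simp_all add: insertion_apply)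
    moreover have "ahom sL (\<lambda>a x. \<iota> a * x) (\<lambda>X. (grading \<omega> \<smile> insertion Y \<omega>') (ys @ X # zs))"
      using Cons.prems by (intro Cons.IH alternating_insertion grading grading_comm) simp_all
    ultimately show ?case
      by (simp add: ahom_def cup_Cons algebra_simps)
  qed
  have "(\<omega> \<smile> \<omega>') (ys @ X # X # zs) = 0" for ys X zs
    using assms
  proof (induction ys arbitrary: \<omega> \<omega>')
    case Nil
    have "insertion X (insertion X (\<omega> \<smile> \<omega>')) = 0"
      using Nil by (simp add: form_simps ins_rep)
    then show ?case by (simp add: insertion_def fun_eq_iff)
  next
    case (Cons Y ys)
    have "(insertion Y \<omega> \<smile> \<omega>') (ys @ X # X # zs) = 0"
      using Cons.prems by (intro Cons.IH alternating_insertion) (simp_all add: insertion_apply)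
    moreover have "(grading \<omega> \<smile> insertion Y \<omega>') (ys @ X # X # zs) = 0"
      using Cons.prems by (intro Cons.IH alternating_insertion grading grading_comm) simp_all
    ultimately show ?case by (simp add: cup_Cons)
  qed
  with linear show ?thesis by (simp add: alternating_def)
qed

section \<open>Connections with values in a ring\<close>

lemma (in lie_rinehart) bracket_antisym: "br X Y = - br Y X"
proof -
  have "br X Y + br Y X = br (X + Y) (X + Y)"
    using bracket_add_left[of X Y "X + Y"] by (simp only: bracket_add_right[of X X Y] bracket_add_right[of Y X Y] bracket_self add_0_left add_0_right)
  then have "br X Y + br Y X = 0" by (simp only: bracket_self)
  then show ?thesis by (simp add: eq_neg_iff_add_eq_0)
qed

lemma (in lie_rinehart) jacobi_leibniz: "br X (br Y Z) = br (br X Y) Z + br Y (br X Z)"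
proof -
  have zero: "br Y 0 = 0" using bracket_add_right[of Y 0 0] by simp
  have "br Y (br X Z) + br Y (br Z X) = br Y (br X Z + br Z X)" by (simp only: bracket_add_right)
  also have "br X Z + br Z X = 0" by (simp only: bracket_antisym[of X Z] left_minus)
  finally have "br Y (br Z X) = - br Y (br X Z)" by (simp add: zero eq_neg_iff_add_eq_0 add.commute)
  then show ?thesis
    using jacobi[of X Y Z] bracket_antisym[of "br X Y" Z] by (simp add: algebra_simps add_eq_0_iff)
qed

text \<open>
  The algebra of operators generated by a connection: \<open>\<iota> a\<close> stands for multiplication by \<open>a\<close>
  on \<open>V\<close> and \<open>D X\<close> for \<open>\<nabla>\<^sub>X\<close>. The unit is a parameter \<open>u\<close>, since the classes of rings with unit
  impose \<open>0 \<noteq> 1\<close>, which fails for the endomorphisms of the zero module.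
\<close>

locale connection_ring = lie_rinehart sk sL br act
  for sk :: "'k::field_char_0 \<Rightarrow> 'a::{comm_ring,comm_monoid_mult} \<Rightarrow> 'a"
    and sL :: "'a \<Rightarrow> 'l::ab_group_add \<Rightarrow> 'l" and br act +
  fixes \<iota> :: "'a \<Rightarrow> 'e::ring" and u :: 'e and D :: "'l \<Rightarrow> 'e"
  assumes unit_left: "u * x = x" and unit_right: "x * u = x"
    and \<iota>_add: "\<iota> (a + b) = \<iota> a + \<iota> b"
    and D_add: "D (X + Y) = D X + D Y"
    and D_scale: "D (sL a X) = \<iota> a * D X"
    and D_leibniz: "D X * \<iota> a = \<iota> (act X a) + \<iota> a * D X"
begin

text \<open>
  The centraliser of the scalars. Among additive endomorphisms of \<open>V\<close>, these are the \<open>A\<close>-linear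
  ones.
\<close>

definition linear_endos :: "'e set" where
  "linear_endos = {\<phi>. \<forall>a. \<phi> * \<iota> a = \<iota> a * \<phi>}"

definition ad :: "'l \<Rightarrow> 'e \<Rightarrow> 'e" where
  "ad X \<phi> = D X * \<phi> - \<phi> * D X"

definition curv :: "'l list \<Rightarrow> 'e" where
  "curv = curvature (*) br D"

abbreviation power :: "nat \<Rightarrow> 'l list \<Rightarrow> 'e" where
  "power m \<equiv> cup_power (*) u curv m"

abbreviation d_nabla :: "('l list \<Rightarrow> 'e) \<Rightarrow> 'l list \<Rightarrow> 'e" where
  "d_nabla \<equiv> cartan_d br ad"

lemma power_0: "power 0 = unit_form u"
  by (simp add: unit_form_def)

lemma power_Suc: "power (Suc m) = curv \<smile> power m"
  by (simp add: fun_eq_iff)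

lemma ad_add: "ad X (\<phi> + \<psi>) = ad X \<phi> + ad X \<psi>"
  by (simp add: ad_def algebra_simps)

lemma ad_mult: "ad X (\<phi> * \<psi>) = ad X \<phi> * \<psi> + \<phi> * ad X \<psi>"
  by (simp add: ad_def algebra_simps)

lemma D_zero: "D 0 = 0" using D_add[of 0 0] by simp

lemma D_minus: "D (- X) = - D X"
  using D_add[of X "- X"] by (simp add: D_zero add_eq_0_iff)

lemma D_diff: "D (X - Y) = D X - D Y"
  using D_add[of "X - Y" Y] by simp

lemma \<iota>_diff: "\<iota> (a - b) = \<iota> a - \<iota> b"
  using \<iota>_add[of "a - b" b] by simp

lemma subring_linear_endos: "nonunital_subring linear_endos"
  by (auto simp: nonunital_subring_def linear_endos_def distrib_left distrib_right mult.assoc)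
    (metis mult.assoc)

lemma linear_endosD: "\<phi> \<in> linear_endos \<Longrightarrow> \<phi> * \<iota> a = \<iota> a * \<phi>"
  by (simp add: linear_endos_def)

lemma unit_linear: "u \<in> linear_endos"
  by (simp add: linear_endos_def unit_left unit_right)

lemma curv_pair: "curv [X, Y] = D X * D Y - D Y * D X - D (br X Y)"
  by (simp add: curv_def curvature_def)

lemma curv_other: "length xs \<noteq> 2 \<Longrightarrow> curv xs = 0"
  by (auto simp: curv_def curvature_def split: list.splits)

lemma curv_antisym: "curv [X, Y] = - curv [Y, X]"
  using D_minus[of "br Y X"] by (simp add: curv_pair bracket_antisym[of X Y])

text \<open>
  The second derivatives in the commutator cancel against the action of the bracket.
\<close>

lemma curv_linear: "curv xs \<in> linear_endos"
proof (cases "length xs = 2")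
  case True
  then obtain X Y where xs: "xs = [X, Y]"
    by (metis (no_types, lifting) Suc_1 length_0_conv length_Suc_conv One_nat_def)
  have DD: "D X * D Y * \<iota> a = \<iota> (act X (act Y a)) + \<iota> (act Y a) * D X + \<iota> (act X a) * D Y + \<iota> a * D X * D Y"
    for X Y a
  proof -
    have "D X * D Y * \<iota> a = D X * \<iota> (act Y a) + (D X * \<iota> a) * D Y"
      by (simp only: mult.assoc D_leibniz[of Y] distrib_left)
    then show ?thesis by (simp add: D_leibniz algebra_simps)
  qed
  show ?thesis
    by (simp add: xs linear_endos_def curv_pair left_diff_distrib DD D_leibniz act_bracket \<iota>_diff)
      (simp add: algebra_simps)
qed (simp add: curv_other linear_endos_def)

lemma curv_scale_left: "curv [sL a X, Y] = \<iota> a * curv [X, Y]"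
proof -
  have "br (sL a X) Y = sL a (br X Y) - sL (act Y a) X"
    using bracket_leibniz[of Y a X] bracket_antisym[of "sL a X" Y] bracket_antisym[of Y X]
      L.scale_right_distrib[of a "br X Y" "- br X Y"] L.scale_right_distrib[of a 0 0]
    by (simp add: algebra_simps add_eq_0_iff)
  moreover have "D Y * (\<iota> a * D X) = \<iota> (act Y a) * D X + \<iota> a * (D Y * D X)"
    by (simp only: mult.assoc[symmetric] D_leibniz distrib_right)
  ultimately show ?thesis
    by (simp add: curv_pair D_scale D_diff mult.assoc right_diff_distrib)
qed

lemma curv_alternating: "alternating sL (\<lambda>a x. \<iota> a * x) curv"
proof -
  have add_left: "curv [X + X', Y] = curv [X, Y] + curv [X', Y]" for X X' Y
    by (simp add: curv_pair D_add bracket_add_left algebra_simps)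
  have add_right: "curv [Y, X + X'] = curv [Y, X] + curv [Y, X']" for X X' Y
    by (simp add: curv_pair D_add bracket_add_right algebra_simps)
  have scale_right: "curv [Y, sL a X] = \<iota> a * curv [Y, X]" for X Y a
    using curv_antisym[of Y] curv_scale_left by simp
  have linear: "ahom sL (\<lambda>a x. \<iota> a * x) (\<lambda>X. curv (ys @ X # zs))" for ys zs
  proof (cases "length (ys @ undefined # zs) = 2")
    case True
    then consider Z where "ys = []" "zs = [Z]" | Y where "ys = [Y]" "zs = []"
      by (cases ys; cases zs) (auto simp: length_Suc_conv numeral_2_eq_2)
    then show ?thesis
      by cases (simp_all add: ahom_def add_left add_right curv_scale_left scale_right)
  qed (simp add: ahom_def curv_other)
  have "curv (ys @ X # X # zs) = 0" for ys X zs
  proof (cases "ys = [] \<and> zs = []")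
    case True
    then show ?thesis by (simp add: curv_pair bracket_self D_zero)
  qed (auto intro: curv_other)
  with linear show ?thesis by (simp add: alternating_def)
qed

lemma grading_curv: "grading curv = curv"
proof
  show "grading curv xs = curv xs" for xs
    by (cases "length xs = 2") (simp_all add: grading_def curv_other)
qed

lemma d_nabla_homogeneous:
  assumes "\<And>ys. length ys \<noteq> n \<Longrightarrow> \<omega> ys = 0" "length xs \<noteq> Suc n"
  shows "d_nabla \<omega> xs = 0"
  using assms
proof (induction xs arbitrary: \<omega> n)
  case (Cons X xs)
  have "d_nabla (insertion X \<omega>) xs = 0"
  proof (cases n)
    case 0
    then have "insertion X \<omega> = (\<lambda>ys. 0)" using Cons.prems(1) by (simp add: fun_eq_iff insertion_apply)
    then show ?thesis using cartan_d_map[of "\<lambda>_. 0 :: 'e" ad \<omega> ad br] by (simp add: ad_def)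
  next
    case (Suc m)
    then show ?thesis using Cons.prems by (intro Cons.IH[of m]) (auto simp: insertion_apply)
  qed
  moreover have "ad X 0 = 0" by (simp add: ad_def)
  ultimately show ?case using Cons.prems lie_args_homogeneous[of n \<omega> xs br X] by simp
qed simp

text \<open>
  On three vectors the covariant derivative of the curvature is a sum of triple products of \<open>D X\<close>,
  \<open>D Y\<close>, \<open>D Z\<close>, in which all terms cancel in pairs, and of \<open>D\<close> applied to the Jacobi identity.
\<close>

lemma bianchi: "d_nabla curv = 0"
proof
  fix xs show "d_nabla curv xs = 0 xs"
  proof (cases "length xs = Suc 2")
    case True
    then obtain X Y Z where xs: "xs = [X, Y, Z]"
      by (auto simp: length_Suc_conv numeral_2_eq_2)
    have "D (br X (br Y Z)) = D (br (br X Y) Z) + D (br Y (br X Z))"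
      by (simp only: jacobi_leibniz[of X Y Z] D_add)
    then show ?thesis
      unfolding xs
      by (simp add: insertion_apply curv_pair ad_def algebra_simps curv_other)
  next
    case False
    then show ?thesis using d_nabla_homogeneous[of 2 curv xs] curv_other by simp
  qed
qed

lemma power_linear: "power m xs \<in> linear_endos"
proof (induction m arbitrary: xs)
  case 0
  then show ?case using unit_linear subring_linear_endos by (simp add: nonunital_subring_def)
next
  case (Suc m)
  then show ?case unfolding power_Suc
    by (intro cup_in_subring[OF subring_linear_endos] curv_linear)
qed

lemma power_alternating: "alternating sL (\<lambda>a x. \<iota> a * x) (power m)"
proof (induction m)
  case 0
  show ?case by (simp add: alternating_def ahom_def)
next
  case (Suc m)
  then show ?case unfolding power_Suc
    by (intro alternating_cup curv_alternating linear_endosD curv_linear)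
qed

lemma power_add: "power m \<smile> power n = power (m + n)"
proof (induction m)
  case 0
  then show ?case by (simp only: power_0 cup_unit_left[OF unit_left] add_0)
next
  case (Suc m)
  then show ?case by (simp only: power_Suc cup_assoc add_Suc)
qed

lemma d_nabla_power: "d_nabla (power m) = 0"
proof (induction m)
  case 0
  have "d_nabla (unit_form u) xs = 0" for xs
  proof (cases xs)
    case (Cons X ys)
    have "d_nabla (insertion X (unit_form u)) ys = 0"
      using cartan_d_map[of "\<lambda>_. 0 :: 'e" ad "unit_form u" ad br]
      by (simp add: insertion_unit_form ad_def zero_fun_def)
    moreover have "lie_args br X (unit_form u) ys = 0"
      using lie_args_homogeneous[of 0 "unit_form u" ys br X] by (cases "ys = []") (simp_all add: unit_form_def)
    moreover have "ad X (unit_form u ys) = 0"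
      by (simp add: unit_form_def ad_def unit_left unit_right)
    ultimately show ?thesis by (simp add: Cons)
  qed simp
  then show ?case unfolding power_0 by (simp add: fun_eq_iff)
next
  case (Suc m)
  then show ?case unfolding power_Suc
    by (simp only: cartan_d_cup[OF ad_add ad_mult] bianchi cup_zero_left cup_zero_right add_0)
qed

end

text \<open>
  The \<open>n\<close>-fold sum \<open>x + \<dots> + x\<close>. The numeral \<open>of_nat n\<close> lives in classes with \<open>0 \<noteq> 1\<close>, to which
  neither \<open>A\<close> nor its endomorphism rings need belong.
\<close>

definition nat_scale :: "nat \<Rightarrow> 'w::comm_monoid_add \<Rightarrow> 'w" where
  "nat_scale n x = (\<Sum>_<n. x)"

lemma nat_scale_Suc: "nat_scale (Suc n) x = x + nat_scale n x"
  by (simp add: nat_scale_def add.commute)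

text \<open>
  The derivation \<open>der\<close> plays the role of \<open>d/ds\<close> along a family of connections with velocity \<open>\<eta>\<close>.
  The trace \<open>\<tau>\<close> is symmetric on linear endomorphisms and takes commutators with the connection to the
  action \<open>\<delta>\<close> on scalars.
\<close>

locale transgression_setting = connection_ring sk sL br act \<iota> u D
  for sk :: "'k::field_char_0 \<Rightarrow> 'a::{comm_ring,comm_monoid_mult} \<Rightarrow> 'a"
    and sL :: "'a \<Rightarrow> 'l::ab_group_add \<Rightarrow> 'l" and br act
    and \<iota> :: "'a \<Rightarrow> 'e::ring" and u D +
  fixes \<eta> :: "'l \<Rightarrow> 'e" and der :: "'e \<Rightarrow> 'e"
    and \<tau> :: "'e \<Rightarrow> 't::ab_group_add" and \<delta> :: "'l \<Rightarrow> 't \<Rightarrow> 't"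
  assumes der_add: "der (x + y) = der x + der y"
    and der_mult: "der (x * y) = der x * y + x * der y"
    and der_D: "der (D X) = \<eta> X"
    and \<eta>_linear: "\<eta> X \<in> linear_endos"
    and der_linear: "\<phi> \<in> linear_endos \<Longrightarrow> der \<phi> \<in> linear_endos"
    and \<tau>_add: "\<tau> (x + y) = \<tau> x + \<tau> y"
    and \<tau>_commute: "\<phi> \<in> linear_endos \<Longrightarrow> \<psi> \<in> linear_endos \<Longrightarrow> \<tau> (\<phi> * \<psi>) = \<tau> (\<psi> * \<phi>)"
    and \<tau>_ad: "\<phi> \<in> linear_endos \<Longrightarrow> \<tau> (ad X \<phi>) = \<delta> X (\<tau> \<phi>)"
begin

lemma der_zero: "der 0 = 0" using der_add[of 0 0] by simp

lemma der_diff: "der (x - y) = der x - der y"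
  using der_add[of "x - y" y] by simp

lemma der_minus: "der (- x) = - der x"
  using der_diff[of 0 x] by (simp add: der_zero)

lemma \<tau>_zero: "\<tau> 0 = 0" using \<tau>_add[of 0 0] by simp

lemma trace_closed: "cartan_d br \<delta> (\<lambda>xs. \<tau> (power m xs)) = 0"
proof -
  have "cartan_d br \<delta> (\<lambda>xs. \<tau> (power m xs)) = (\<lambda>xs. \<tau> (d_nabla (power m) xs))"
    by (rule cartan_d_map[OF \<tau>_add]) (simp add: \<tau>_ad power_linear)
  then show ?thesis by (simp add: d_nabla_power \<tau>_zero fun_eq_iff)
qed

lemma \<eta>_form_linear: "one_form \<eta> xs \<in> linear_endos"
  using \<eta>_linear subring_linear_endos by (auto simp: one_form_def nonunital_subring_def split: list.splits)

text \<open>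
  The Leibniz rule turns the commutator in \<open>\<R>(X, Y)\<close> into commutators of \<open>D\<close> with \<open>\<eta>\<close>, which are the
  terms of Cartan's formula for the one-form \<open>\<eta>\<close>.
\<close>

lemma derivative_curv: "(\<lambda>xs. der (curv xs)) = d_nabla (one_form \<eta>)"
proof
  fix xs show "der (curv xs) = d_nabla (one_form \<eta>) xs"
  proof (cases "length xs = Suc 1")
    case True
    then obtain X Y where xs: "xs = [X, Y]" by (auto simp: length_Suc_conv)
    show ?thesis
      by (simp add: xs curv_pair der_diff der_mult der_D insertion_apply one_form_def ad_def)
  next
    case False
    then have "d_nabla (one_form \<eta>) xs = 0"
      by (rule d_nabla_homogeneous[rotated]) (auto simp: one_form_def split: list.splits)
    then show ?thesis using False by (simp add: curv_other der_zero)
  qed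
qed

lemma der_cup: "(\<lambda>xs. der ((\<omega> \<smile> \<omega>') xs)) = (\<lambda>xs. der (\<omega> xs)) \<smile> \<omega>' + \<omega> \<smile> (\<lambda>xs. der (\<omega>' xs))"
proof -
  have sum: "der (sum f I) = (\<Sum>i\<in>I. der (f i))" for I and f :: "'i \<Rightarrow> 'e"
    by (induction I rule: infinite_finite_induct) (auto simp: der_zero der_add)
  show ?thesis
    by (auto simp: fun_eq_iff cup_def sum signed_def der_mult der_minus sum.distrib[symmetric] intro!: sum.cong)
qed

text \<open>
  Under the trace the even form \<open>\<R>\<close> can be moved cyclically, so each of the \<open>m + 1\<close> terms of
  \<open>\<partial> (\<R>\<^bsup>m+1\<^esup>)\<close> contributes the same. The extra factor \<open>\<R>\<^sup>n\<close> absorbs the powers that have been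
  moved.
\<close>

lemma trace_derivative_power_cup:
  "\<tau> (((\<lambda>ys. der (power (Suc m) ys)) \<smile> power n) xs) =
    nat_scale (Suc m) (\<tau> (((\<lambda>ys. der (curv ys)) \<smile> power (m + n)) xs))"
proof (induction m arbitrary: n)
  case 0
  have "power (Suc 0) = curv" by (simp only: power_Suc power_0 cup_unit_right[OF unit_right])
  then show ?case by (simp add: nat_scale_def)
next
  case (Suc m)
  let ?R' = "\<lambda>ys. der (curv ys)" and ?P' = "\<lambda>ys. der (power (Suc m) ys)"
  have P'_linear: "?P' ys \<in> linear_endos" for ys by (intro der_linear power_linear)
  have "\<tau> (((\<lambda>ys. der (power (Suc (Suc m)) ys)) \<smile> power n) xs) =
      \<tau> ((?R' \<smile> (power (Suc m) \<smile> power n)) xs) + \<tau> ((curv \<smile> (?P' \<smile> power n)) xs)"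
    by (simp only: power_Suc[of "Suc m"] der_cup cup_add_left cup_assoc plus_fun_apply \<tau>_add)
  also have "\<tau> ((curv \<smile> (?P' \<smile> power n)) xs) = \<tau> (((?P' \<smile> power n) \<smile> curv) xs)"
    by (rule trace_cup_commute[where S = linear_endos])
      (rule subring_linear_endos \<tau>_add \<tau>_commute curv_linear grading_curv
        cup_in_subring[OF subring_linear_endos P'_linear power_linear] | assumption)+
  also have "(?P' \<smile> power n) \<smile> curv = ?P' \<smile> power (Suc n)"
  proof -
    have "power n \<smile> power 1 = power (Suc n)" by (simp only: power_add) simp
    moreover have "power 1 = curv" by (simp only: One_nat_def power_Suc power_0 cup_unit_right[OF unit_right])
    ultimately show ?thesis by (simp only: cup_assoc)
  qed
  finally show ?case
    by (simp only: power_add Suc.IH nat_scale_Suc[of "Suc m"]) simp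
qed

text \<open>
  As the powers of \<open>\<R>\<close> are covariantly constant, \<open>d\<^sup>\<nabla> \<eta> \<smile> \<R>\<^sup>m = d\<^sup>\<nabla> (\<eta> \<smile> \<R>\<^sup>m)\<close>, and
  the trace turns the covariant derivative into the differential of scalar forms.
\<close>

lemma derivative_trace_power:
  "\<tau> (der (power (Suc m) xs)) =
    nat_scale (Suc m) (cartan_d br \<delta> (\<lambda>ys. \<tau> ((one_form \<eta> \<smile> power m) ys)) xs)"
proof -
  have "\<tau> (der (power (Suc m) xs)) = \<tau> (((\<lambda>ys. der (power (Suc m) ys)) \<smile> power 0) xs)"
    by (simp only: power_0 cup_unit_right[OF unit_right])
  also have "\<dots> = nat_scale (Suc m) (\<tau> ((d_nabla (one_form \<eta>) \<smile> power m) xs))"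
    by (simp only: trace_derivative_power_cup derivative_curv add_0_right)
  also have "d_nabla (one_form \<eta>) \<smile> power m = d_nabla (one_form \<eta> \<smile> power m)"
    by (simp only: cartan_d_cup[OF ad_add ad_mult] d_nabla_power cup_zero_right add_0_right)
  also have "\<tau> (d_nabla (one_form \<eta> \<smile> power m) xs) =
      cartan_d br \<delta> (\<lambda>ys. \<tau> ((one_form \<eta> \<smile> power m) ys)) xs"
    by (subst cartan_d_map[OF \<tau>_add, where \<delta> = ad])
      (simp_all add: \<tau>_ad cup_in_subring[OF subring_linear_endos \<eta>_form_linear power_linear])
  finally show ?thesis .
qed

end

section \<open>Formal derivatives of power series\<close>

lemma nat_scale_linear:
  shows nat_scale_add: "nat_scale n (x + y) = nat_scale n x + nat_scale n (y :: 'w::ab_group_add)"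
    and nat_scale_add_left: "nat_scale (m + n) x = nat_scale m x + nat_scale n (x :: 'w::ab_group_add)"
    and nat_scale_zero: "nat_scale n (0 :: 'w::ab_group_add) = 0"
    and nat_scale_0: "nat_scale 0 (x :: 'w::ab_group_add) = 0"
proof -
  show "nat_scale n (x + y) = nat_scale n x + nat_scale n (y :: 'w::ab_group_add)"
    by (simp add: nat_scale_def sum.distrib)
  show "nat_scale (m + n) x = nat_scale m x + nat_scale n (x :: 'w::ab_group_add)"
    by (induction m) (simp add: nat_scale_def, simp add: nat_scale_Suc add.assoc)
qed (simp_all add: nat_scale_def)

lemma nat_scale_mult:
  fixes x y :: "'e::ring"
  shows "nat_scale n (x * y) = nat_scale n x * y" "nat_scale n (x * y) = x * nat_scale n y"
  by (simp_all add: nat_scale_def sum_distrib_left sum_distrib_right)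

lemma nat_scale_sum: "nat_scale n (sum f I) = (\<Sum>i\<in>I. nat_scale n (f i :: 'w::ab_group_add))"
  by (simp add: nat_scale_def sum.swap[of _ _ I])

lemma nat_scale_map:
  assumes "\<And>x y. h (x + y) = h x + h (y :: 'w::ab_group_add)"
  shows "h (nat_scale n x) = nat_scale n (h x :: 't::ab_group_add)"
proof -
  have "h 0 = 0" using assms[of 0 0] by simp
  then show ?thesis by (induction n) (simp_all add: nat_scale_def assms)
qed

definition series_derivative :: "'e::comm_monoid_add fps \<Rightarrow> 'e fps" where
  "series_derivative F = Abs_fps (\<lambda>n. nat_scale (Suc n) (F $ Suc n))"

lemma series_derivative_nth: "series_derivative F $ n = nat_scale (Suc n) (F $ Suc n)"
  by (simp add: series_derivative_def)

lemma series_derivative_add: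
  "series_derivative (F + G) = series_derivative F + series_derivative (G :: 'e::ab_group_add fps)"
  by (simp add: fps_eq_iff series_derivative_nth nat_scale_add)

lemma series_derivative_mult:
  fixes F G :: "'e::ring fps"
  shows "series_derivative (F * G) = series_derivative F * G + F * series_derivative G"
proof (rule fps_ext)
  fix n
  (* The weight n + 1 of the coefficient splits as i + (n + 1 - i), one part for each factor. *)
  have "series_derivative (F * G) $ n =
      (\<Sum>i=0..Suc n. nat_scale (i + (Suc n - i)) (F $ i * G $ (Suc n - i)))"
    unfolding series_derivative_nth fps_mult_nth nat_scale_sum by (intro sum.cong) auto
  also have "\<dots> = (\<Sum>i=0..Suc n. nat_scale i (F $ i) * G $ (Suc n - i)) +
      (\<Sum>i=0..Suc n. F $ i * nat_scale (Suc n - i) (G $ (Suc n - i)))"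
    unfolding nat_scale_add_left sum.distrib
    by (intro arg_cong2[where f = "(+)"] sum.cong refl nat_scale_mult)
  also have "(\<Sum>i=0..Suc n. nat_scale i (F $ i) * G $ (Suc n - i)) =
      (\<Sum>i=0..n. nat_scale (Suc i) (F $ Suc i) * G $ (n - i))"
    by (subst sum.atLeast0_atMost_Suc_shift) (simp add: nat_scale_0)
  also have "(\<Sum>i=0..Suc n. F $ i * nat_scale (Suc n - i) (G $ (Suc n - i))) =
      (\<Sum>i=0..n. F $ i * nat_scale (Suc (n - i)) (G $ Suc (n - i)))"
    by (simp add: nat_scale_0, intro sum.cong refl, simp add: Suc_diff_le)
  finally show "series_derivative (F * G) $ n =
      (series_derivative F * G + F * series_derivative G) $ n"
    by (simp add: fps_mult_nth series_derivative_nth)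
qed

definition series_degree_le :: "nat \<Rightarrow> 'e::zero fps \<Rightarrow> bool" where
  "series_degree_le N F \<longleftrightarrow> (\<forall>n>N. F $ n = 0)"

lemma series_degree_le_mult:
  fixes F G :: "'e::ring fps"
  assumes "series_degree_le M F" "series_degree_le N G" shows "series_degree_le (M + N) (F * G)"
  unfolding series_degree_le_def
proof (intro allI impI)
  fix n assume "n > M + N"
  then have "F $ i * G $ (n - i) = 0" for i
    using assms by (cases "i > M") (simp_all add: series_degree_le_def)
  then show "(F * G) $ n = 0" by (simp add: fps_mult_nth)
qed

section \<open>Cup products and related value domains\<close>

text \<open>
  The cup product is built from the product of values, sums and signs, so a relation between two
  domains of values that respects these operations passes to cup products. It transports computations
  from polynomials with endomorphism coefficients to power series over a ring, and from there to
  evaluations at \<open>s = 0\<close> and \<open>s = 1\<close>. The relations for the two factors and for the result may differ.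
\<close>

lemma cup_rel:
  fixes mul :: "'w::ab_group_add \<Rightarrow> 'w \<Rightarrow> 'w" and mul' :: "'e::ab_group_add \<Rightarrow> 'e \<Rightarrow> 'e"
  assumes "\<And>xs. P (\<omega> xs) (\<Omega> xs)" "\<And>xs. Q (\<omega>' xs) (\<Omega>' xs)"
    and mul: "\<And>x y x' y'. P x y \<Longrightarrow> Q x' y' \<Longrightarrow> R (mul x x') (mul' y y')"
    and zero: "R 0 0"
    and add: "\<And>x y x' y'. R x y \<Longrightarrow> R x' y' \<Longrightarrow> R (x + x') (y + y')"
    and minus: "\<And>x y. R x y \<Longrightarrow> R (- x) (- y)"
  shows "R (cup mul \<omega> \<omega>' xs) (cup mul' \<Omega> \<Omega>' xs)"
proof -
  have sum: "R (sum f I) (sum g I)" if "\<And>i. i \<in> I \<Longrightarrow> R (f i) (g i)" for I and f :: "'i \<Rightarrow> 'w" and g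
    using that by (induction I rule: infinite_finite_induct) (auto intro: zero add)
  have "R (signed b (mul (\<omega> ys) (\<omega>' zs))) (signed b (mul' (\<Omega> ys) (\<Omega>' zs)))" for b ys zs
    unfolding signed_def using assms(1,2) by (auto intro: mul minus)
  then show ?thesis unfolding cup_def by (intro sum)
qed

lemma cup_power_rel:
  fixes mul :: "'w::ab_group_add \<Rightarrow> 'w \<Rightarrow> 'w" and mul' :: "'e::ab_group_add \<Rightarrow> 'e \<Rightarrow> 'e"
  assumes "\<And>xs. R (\<omega> xs) (\<Omega> xs)" and unit: "R u u'"
    and mul: "\<And>x y x' y'. R x y \<Longrightarrow> R x' y' \<Longrightarrow> R (mul x x') (mul' y y')"
    and zero: "R 0 0"
    and add: "\<And>x y x' y'. R x y \<Longrightarrow> R x' y' \<Longrightarrow> R (x + x') (y + y')"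
    and minus: "\<And>x y. R x y \<Longrightarrow> R (- x) (- y)"
  shows "R (cup_power mul u \<omega> m xs) (cup_power mul' u' \<Omega> m xs)"
proof (induction m arbitrary: xs)
  case 0
  then show ?case by (simp add: unit zero)
next
  case (Suc m)
  show ?case unfolding cup_power.simps
    by (rule cup_rel[where P = R and Q = R]) (rule assms Suc | assumption)+
qed

lemma curvature_rel:
  fixes mul :: "'w::ab_group_add \<Rightarrow> 'w \<Rightarrow> 'w" and mul' :: "'e::ab_group_add \<Rightarrow> 'e \<Rightarrow> 'e"
  assumes D: "\<And>X. R (D X) (D' X)"
    and mul: "\<And>x y x' y'. R x y \<Longrightarrow> R x' y' \<Longrightarrow> R (mul x x') (mul' y y')"
    and zero: "R 0 0"
    and add: "\<And>x y x' y'. R x y \<Longrightarrow> R x' y' \<Longrightarrow> R (x + x') (y + y')"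
    and minus: "\<And>x y. R x y \<Longrightarrow> R (- x) (- y)"
  shows "R (curvature mul br D xs) (curvature mul' br D' xs)"
proof -
  have diff: "R (x - x') (y - y')" if "R x y" "R x' y'" for x x' y y'
    using add[OF that(1) minus[OF that(2)]] by simp
  show ?thesis
  proof (cases "length xs = 2")
    case True
    then obtain X Y where "xs = [X, Y]" by (auto simp: length_Suc_conv numeral_2_eq_2)
    then show ?thesis by (simp add: curvature_def diff mul D)
  next
    case False
    then have "curvature mul br D xs = 0" "curvature mul' br D' xs = 0"
      by (auto simp: curvature_def split: list.splits)
    then show ?thesis by (simp add: zero)
  qed
qed

lemma series_degree_le_cup:
  fixes \<omega> \<omega>' :: "'l list \<Rightarrow> 'e::ring fps"
  assumes "\<And>xs. series_degree_le M (\<omega> xs)" "\<And>xs. series_degree_le N (\<omega>' xs)"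
  shows "series_degree_le (M + N) ((\<omega> \<smile> \<omega>') xs)"
proof -
  (* A property of values is a relation that ignores its second argument. *)
  show ?thesis
    by (rule cup_rel[where P = "\<lambda>F _. series_degree_le M F" and Q = "\<lambda>F _. series_degree_le N F"
          and R = "\<lambda>F _. series_degree_le (M + N) F" and mul' = "\<lambda>_ _. 0 :: 'e fps"
          and \<Omega> = "\<lambda>_. 0" and \<Omega>' = "\<lambda>_. 0" and xs = xs])
      (use assms in \<open>auto simp: series_degree_le_mult\<close>, auto simp: series_degree_le_def)
qed

section \<open>The ring of additive endomorphisms\<close>

text \<open>
  Composition of arbitrary functions is not distributive on the right; on additive maps it is the
  product of a ring. Besides the \<open>A\<close>-linear endomorphisms the ring contains the operators \<open>\<nabla>\<^sub>X\<close>.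
\<close>

typedef (overloaded) 'v endo = "{\<phi> :: 'v::ab_group_add \<Rightarrow> 'v. \<forall>x y. \<phi> (x + y) = \<phi> x + \<phi> y}"
  morphisms apply_endo Endo
  by (rule exI[of _ "\<lambda>v. v"]) simp

lemma apply_endo_add: "apply_endo \<phi> (x + y) = apply_endo \<phi> x + apply_endo \<phi> y"
  using apply_endo[of \<phi>] by simp

lemma apply_endo_zero: "apply_endo \<phi> 0 = 0"
  using apply_endo_add[of \<phi> 0 0] by simp

lemma apply_Endo: "(\<And>x y. \<phi> (x + y) = \<phi> x + \<phi> y) \<Longrightarrow> apply_endo (Endo \<phi>) = \<phi>"
  by (simp add: Endo_inverse)

lemma endo_eqI: "(\<And>v. apply_endo \<phi> v = apply_endo \<psi> v) \<Longrightarrow> \<phi> = \<psi>"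
  by (simp add: apply_endo_inject[symmetric] fun_eq_iff)

instantiation endo :: (ab_group_add) ring
begin

definition "0 = Endo (\<lambda>_. 0)"
definition "\<phi> + \<psi> = Endo (\<lambda>v. apply_endo \<phi> v + apply_endo \<psi> v)"
definition "- \<phi> = Endo (\<lambda>v. - apply_endo \<phi> v)"
definition "\<phi> - \<psi> = Endo (\<lambda>v. apply_endo \<phi> v - apply_endo \<psi> v)"
definition "\<phi> * \<psi> = Endo (\<lambda>v. apply_endo \<phi> (apply_endo \<psi> v))"

lemma apply_endo_simps [simp]:
  "apply_endo 0 v = 0"
  "apply_endo (\<phi> + \<psi>) v = apply_endo \<phi> v + apply_endo \<psi> v"
  "apply_endo (- \<phi>) v = - apply_endo \<phi> v"
  "apply_endo (\<phi> - \<psi>) v = apply_endo \<phi> v - apply_endo \<psi> v"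
  "apply_endo (\<phi> * \<psi>) v = apply_endo \<phi> (apply_endo \<psi> v)"
  by (simp_all add: zero_endo_def plus_endo_def uminus_endo_def minus_endo_def times_endo_def
      apply_Endo apply_endo_add)

instance
  by standard (auto intro!: endo_eqI simp: apply_endo_add)

end

lemma apply_endo_sum_left: "apply_endo (sum f I) v = (\<Sum>i\<in>I. apply_endo (f i) v)"
  by (induction I rule: infinite_finite_induct) simp_all

definition id_endo :: "'v::ab_group_add endo" where
  "id_endo = Endo (\<lambda>v. v)"

lemma apply_id_endo [simp]: "apply_endo id_endo v = v"
  by (simp add: id_endo_def apply_Endo)

lemma apply_fun_simps:
  "apply_endo 0 = 0" "apply_endo (\<phi> + \<psi>) = apply_endo \<phi> + apply_endo \<psi>"
  "apply_endo (- \<phi>) = - apply_endo \<phi>" "apply_endo (\<phi> * \<psi>) = apply_endo \<phi> \<circ> apply_endo \<psi>"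
  by (simp_all add: fun_eq_iff)

section \<open>Polynomials with endomorphism coefficients\<close>

definition additive_coeffs :: "('v::ab_group_add \<Rightarrow> 'v) poly \<Rightarrow> bool" where
  "additive_coeffs p \<longleftrightarrow> (\<forall>n x y. coeff p n (x + y) = coeff p n x + coeff p n y)"

text \<open>
  Power series over the endomorphism ring form a ring, so that the results on connections with
  values in a ring apply to them; this relation identifies a polynomial with its series.
\<close>

definition represents :: "('v::ab_group_add \<Rightarrow> 'v) poly \<Rightarrow> 'v endo fps \<Rightarrow> bool" where
  "represents p F \<longleftrightarrow> (\<forall>n. coeff p n = apply_endo (F $ n))"

lemma represents_linear:
  shows represents_zero: "represents 0 0"
    and represents_add: "represents p F \<Longrightarrow> represents q G \<Longrightarrow> represents (p + q) (F + G)"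
    and represents_minus: "represents p F \<Longrightarrow> represents (- p) (- F)"
  by (simp_all add: represents_def apply_fun_simps)

lemma represents_mult:
  assumes "represents p F" "represents q G"
  shows "represents (endo_poly_mult p q) (F * G)"
  unfolding represents_def
proof (intro allI ext)
  fix n v
  have p: "coeff p i = apply_endo (F $ i)" and q: "coeff q i = apply_endo (G $ i)" for i
    using assms by (simp_all add: represents_def)
  define h where "h i j = apply_endo (F $ i) (apply_endo (G $ j) v)" for i j
  have zero: "h i j = 0" if "i > degree p \<or> j > degree q" for i j
    using that p[of i] q[of j] coeff_eq_0[of p i] coeff_eq_0[of q j]
    by (auto simp: h_def fun_eq_iff apply_endo_zero)
  have "coeff (endo_poly_mult p q) n v = (\<Sum>i\<le>degree p. \<Sum>j\<le>degree q. if i + j = n then h i j else 0)"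
  proof -
    have sum: "sum f I v = (\<Sum>i\<in>I. f i v)" for f :: "nat \<Rightarrow> 'a \<Rightarrow> 'a" and I
      by (induction I rule: infinite_finite_induct) auto
    show ?thesis
      unfolding endo_poly_mult_def coeff_sum sum
      by (intro sum.cong refl) (simp add: h_def p q)
  qed
  also have "\<dots> = (\<Sum>i\<le>degree p. if i \<le> n then h i (n - i) else 0)"
  proof (intro sum.cong refl)
    fix i
    have "(\<Sum>j\<le>degree q. if i + j = n then h i j else 0) =
        (\<Sum>j\<le>degree q. if j = n - i then (if i \<le> n then h i (n - i) else 0) else 0)"
      by (intro sum.cong refl) auto
    also have "\<dots> = (if i \<le> n then h i (n - i) else 0)"
      using zero[of i "n - i"] by (auto simp: not_le)
    finally show "(\<Sum>j\<le>degree q. if i + j = n then h i j else 0) = (if i \<le> n then h i (n - i) else 0)" .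
  qed
  also have "\<dots> = (\<Sum>i=0..n. h i (n - i))"
    by (rule sum.mono_neutral_cong) (auto simp: zero)
  also have "\<dots> = apply_endo ((F * G) $ n) v"
    by (simp add: fps_mult_nth apply_endo_sum_left h_def)
  finally show "coeff (endo_poly_mult p q) n v = apply_endo ((F * G) $ n) v" .
qed

text \<open>
  The value of the polynomial at \<open>s = 1\<close> is \<open>\<phi>\<close>. Additivity of the coefficients makes evaluation
  multiplicative.
\<close>

definition coeff_sum_is :: "('v::ab_group_add \<Rightarrow> 'v) poly \<Rightarrow> ('v \<Rightarrow> 'v) \<Rightarrow> bool" where
  "coeff_sum_is p \<phi> \<longleftrightarrow> additive_coeffs p \<and> (\<Sum>n\<le>degree p. coeff p n) = \<phi>"

lemma coeff_sum_extend:
  assumes "degree p \<le> N" shows "(\<Sum>n\<le>degree p. coeff p n) = (\<Sum>n\<le>N. coeff p n)"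
  by (rule sum.mono_neutral_left) (use assms in \<open>auto simp: coeff_eq_0\<close>)

lemma coeff_sum_add:
  "(\<Sum>n\<le>degree (p + q). coeff (p + q) n) = (\<Sum>n\<le>degree p. coeff p n) + (\<Sum>n\<le>degree q. coeff q n)"
proof -
  let ?N = "max (degree p) (degree q)"
  have "(\<Sum>n\<le>degree (p + q). coeff (p + q) n) = (\<Sum>n\<le>?N. coeff (p + q) n)"
    by (rule coeff_sum_extend) (rule degree_add_le_max)
  also have "\<dots> = (\<Sum>n\<le>?N. coeff p n) + (\<Sum>n\<le>?N. coeff q n)"
    by (simp add: sum.distrib)
  finally show ?thesis by (simp add: coeff_sum_extend[of p ?N] coeff_sum_extend[of q ?N])
qed

lemma coeff_sum_sum:
  "(\<Sum>n\<le>degree (sum f I). coeff (sum f I) n) = (\<Sum>i\<in>I. \<Sum>n\<le>degree (f i). coeff (f i) n)"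
proof (induction I rule: infinite_finite_induct)
  case (insert i I)
  show ?case by (simp only: sum.insert[OF insert.hyps] coeff_sum_add insert.IH)
qed simp_all

lemma coeff_sum_monom: "(\<Sum>n\<le>degree (monom c k). coeff (monom c k) n) = c"
  by (subst coeff_sum_extend[OF degree_monom_le]) simp

lemma coeff_sum_is_linear:
  shows coeff_sum_is_zero: "coeff_sum_is 0 0"
    and coeff_sum_is_add: "coeff_sum_is p \<phi> \<Longrightarrow> coeff_sum_is q \<psi> \<Longrightarrow> coeff_sum_is (p + q) (\<phi> + \<psi>)"
    and coeff_sum_is_minus: "coeff_sum_is p \<phi> \<Longrightarrow> coeff_sum_is (- p) (- \<phi>)"
  by (auto simp: coeff_sum_is_def additive_coeffs_def coeff_sum_add sum_negf simp del: coeff_add)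
    (simp add: algebra_simps)

lemma coeff_sum_is_mult:
  assumes "coeff_sum_is p \<phi>" "coeff_sum_is q \<psi>"
  shows "coeff_sum_is (endo_poly_mult p q) (\<phi> \<circ> \<psi>)"
proof -
  have p: "coeff p n (x + y) = coeff p n x + coeff p n y"
    and q: "coeff q n (x + y) = coeff q n x + coeff q n y" for n x y
    using assms by (auto simp: coeff_sum_is_def additive_coeffs_def)
  have p0: "coeff p n 0 = 0" for n using p[of n 0 0] by simp
  have sum: "sum f I v = (\<Sum>i\<in>I. f i v)" for f :: "nat \<Rightarrow> 'a \<Rightarrow> 'a" and I v
    by (induction I rule: infinite_finite_induct) auto
  have p_sum: "coeff p n (sum f I) = (\<Sum>i\<in>I. coeff p n (f i))" for n f and I :: "nat set"
    by (induction I rule: infinite_finite_induct) (auto simp: p p0)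
  have "additive_coeffs (endo_poly_mult p q)"
    unfolding additive_coeffs_def endo_poly_mult_def coeff_sum sum
    by (auto simp: p q sum.distrib[symmetric] intro!: sum.cong)
  moreover have "(\<Sum>n\<le>degree (endo_poly_mult p q). coeff (endo_poly_mult p q) n) = \<phi> \<circ> \<psi>"
  proof -
    have "(\<Sum>n\<le>degree (endo_poly_mult p q). coeff (endo_poly_mult p q) n) =
        (\<Sum>i\<le>degree p. \<Sum>j\<le>degree q. coeff p i \<circ> coeff q j)"
      unfolding endo_poly_mult_def by (simp only: coeff_sum_sum coeff_sum_monom)
    also have "\<dots> = (\<Sum>i\<le>degree p. coeff p i) \<circ> (\<Sum>j\<le>degree q. coeff q j)"
      by (simp add: fun_eq_iff sum p_sum)
    finally show ?thesis using assms by (simp add: coeff_sum_is_def)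
  qed
  ultimately show ?thesis by (simp add: coeff_sum_is_def)
qed

section \<open>Dual bases and traces\<close>

lemma amodule_zero_left:
  assumes "amodule s" shows "s 0 x = 0"
proof -
  interpret amodule s by fact
  show ?thesis using scale_left_distrib[of 0 0 x] by simp
qed

lemma ahom_sum:
  fixes h :: "'v::ab_group_add \<Rightarrow> 'w::ab_group_add"
  shows "ahom s s' h \<Longrightarrow> h (sum f I) = (\<Sum>i\<in>I. h (f i))"
  by (induction I rule: infinite_finite_induct) (simp_all add: ahom_zero ahom_add)

text \<open>
  The section given by projectivity takes a finite generating set to finitely many finitely supported
  functions. The union of their supports is a finite set \<open>F\<close> outside of which the coordinates of every
  vector vanish; it is the required basis.
\<close>

lemma dual_basis_exists:
  assumes mod: "amodule s" and fg: "finitely_generated s" and proj: "projective s"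
  shows "\<exists>b. dual_basis s b"
proof -
  interpret amodule s by fact
  obtain G where G: "finite G" "\<And>v. \<exists>c. v = (\<Sum>w\<in>G. s (c w) w)"
    using fg by (auto simp: finitely_generated_def)
  obtain \<sigma> :: "'b \<Rightarrow> 'b \<Rightarrow> 'a" where fin: "\<And>v. finite {w. \<sigma> v w \<noteq> 0}"
    and hom: "ahom s (\<lambda>a g w. a * g w) \<sigma>" and sec: "\<And>v. (\<Sum>w | \<sigma> v w \<noteq> 0. s (\<sigma> v w) w) = v"
    using proj unfolding projective_def by auto
  define F where "F = (\<Union>w\<in>G. {x. \<sigma> w x \<noteq> 0})"
  have "finite F" using G fin by (simp add: F_def)
  have supp: "\<sigma> v x = 0" if "x \<notin> F" for v x
  proof -
    have sum_apply: "(\<Sum>w\<in>I. f w) x = (\<Sum>w\<in>I. f w x)" for f :: "'b \<Rightarrow> 'b \<Rightarrow> 'a" and I x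
      by (induction I rule: infinite_finite_induct) auto
    obtain c where "v = (\<Sum>w\<in>G. s (c w) w)" using G by blast
    then have "\<sigma> v = \<sigma> (\<Sum>w\<in>G. s (c w) w)" by (rule arg_cong)
    also have "\<dots> = (\<Sum>w\<in>G. \<sigma> (s (c w) w))" by (rule ahom_sum[OF hom])
    also have "\<dots> = (\<Sum>w\<in>G. (\<lambda>x. c w * \<sigma> w x))" by (simp only: ahom_scale[OF hom])
    finally have "\<sigma> v x = (\<Sum>w\<in>G. c w * \<sigma> w x)" by (simp only: sum_apply)
    also have "\<dots> = 0" using that by (intro sum.neutral) (auto simp: F_def)
    finally show ?thesis .
  qed
  obtain e n where e: "bij_betw e {..<n::nat} F"
    using ex_bij_betw_nat_finite[OF \<open>finite F\<close>] by (metis atLeast0LessThan)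
  have "(\<Sum>i<n. s (\<sigma> v (e i)) (e i)) = v" for v
  proof -
    have "(\<Sum>i<n. s (\<sigma> v (e i)) (e i)) = (\<Sum>w\<in>F. s (\<sigma> v w) w)"
      by (rule sum.reindex_bij_betw[OF e])
    also have "\<dots> = (\<Sum>w | \<sigma> v w \<noteq> 0. s (\<sigma> v w) w)"
      by (rule sum.mono_neutral_right[OF \<open>finite F\<close>])
        (use supp in \<open>auto simp: amodule_zero_left[OF mod]\<close>)
    finally show ?thesis using sec by simp
  qed
  moreover have "ahom s (*) (\<lambda>v. \<sigma> v (e i))" for i
    using hom by (simp add: ahom_def)
  ultimately have "dual_basis s (n, e, \<lambda>i v. \<sigma> v (e i))"
    by (simp add: dual_basis_def)
  then show ?thesis by blast
qed

text \<open>
  The trace is evaluated on a chosen dual basis; \<open>e\<close> and \<open>\<epsilon>\<close> are that choice.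
\<close>

locale dual_basis_module = amodule s
  for s :: "'a::{comm_ring,comm_monoid_mult} \<Rightarrow> 'v::ab_group_add \<Rightarrow> 'v" +
  fixes n :: nat and e :: "nat \<Rightarrow> 'v" and \<epsilon> :: "nat \<Rightarrow> 'v \<Rightarrow> 'a"
  assumes \<epsilon>_hom: "i < n \<Longrightarrow> ahom s (*) (\<epsilon> i)"
    and expand: "(\<Sum>i<n. s (\<epsilon> i v) (e i)) = v"
    and trace_eq: "trace s \<phi> = (\<Sum>i<n. \<epsilon> i (\<phi> (e i)))"
begin

lemma \<epsilon>_add: "i < n \<Longrightarrow> \<epsilon> i (x + y) = \<epsilon> i x + \<epsilon> i y"
  using ahom_add[OF \<epsilon>_hom] .

lemma \<epsilon>_scale: "i < n \<Longrightarrow> \<epsilon> i (s a x) = a * \<epsilon> i x"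
  using ahom_scale[OF \<epsilon>_hom] .

lemma trace_add: "trace s (\<phi> + \<psi>) = trace s \<phi> + trace s \<psi>"
  by (simp add: trace_eq \<epsilon>_add sum.distrib)

lemma trace_scale: "trace s (\<lambda>v. s a (\<phi> v)) = a * trace s \<phi>"
  by (simp add: trace_eq \<epsilon>_scale sum_distrib_left)

lemma ahom_expand:
  fixes h :: "'v \<Rightarrow> 'w::ab_group_add"
  assumes "ahom s s' h" shows "h v = (\<Sum>j<n. s' (\<epsilon> j v) (h (e j)))"
proof -
  have "h v = h (\<Sum>j<n. s (\<epsilon> j v) (e j))" by (simp only: expand)
  also have "\<dots> = (\<Sum>j<n. s' (\<epsilon> j v) (h (e j)))"
    by (simp only: ahom_sum[OF assms] ahom_scale[OF assms])
  finally show ?thesis .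
qed

lemma trace_commute:
  assumes \<phi>: "ahom s s \<phi>" and \<psi>: "ahom s s \<psi>"
  shows "trace s (\<phi> \<circ> \<psi>) = trace s (\<psi> \<circ> \<phi>)"
proof -
  have expand_trace: "trace s (\<phi> \<circ> \<psi>) = (\<Sum>i<n. \<Sum>j<n. \<epsilon> j (\<psi> (e i)) * \<epsilon> i (\<phi> (e j)))"
    if "ahom s s \<phi>" "ahom s s \<psi>" for \<phi> \<psi>
    unfolding trace_eq
  proof (intro sum.cong refl)
    fix i assume "i \<in> {..<n}"
    then have "ahom s (*) (\<lambda>v. \<epsilon> i (\<phi> v))"
      using that(1) \<epsilon>_hom by (simp add: ahom_def)
    from ahom_expand[OF this, of "\<psi> (e i)"]
    show "\<epsilon> i ((\<phi> \<circ> \<psi>) (e i)) = (\<Sum>j<n. \<epsilon> j (\<psi> (e i)) * \<epsilon> i (\<phi> (e j)))"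
      by (simp only: o_apply)
  qed
  show ?thesis
    unfolding expand_trace[OF \<phi> \<psi>] expand_trace[OF \<psi> \<phi>]
    by (subst sum.swap) (simp add: mult.commute)
qed

text \<open>
  Let \<open>\<epsilon>' i = d \<circ> \<epsilon> i - \<epsilon> i \<circ> conn\<close> be the derivative of \<open>\<epsilon> i\<close> for the dual connection; it is
  again \<open>A\<close>-linear. Differentiating \<open>v = \<Sum>\<^sub>i \<epsilon> i v \<cdot> e i\<close> gives
  \<open>\<Sum>\<^sub>i \<epsilon>' i v \<cdot> e i = - \<Sum>\<^sub>i \<epsilon> i v \<cdot> conn (e i)\<close>. The two sides of the claim differ by
  \<open>\<Sum>\<^sub>i \<epsilon>' i (\<phi> (e i)) + \<Sum>\<^sub>i \<epsilon> i (\<phi> (conn (e i)))\<close>, which vanishes: expand \<open>\<phi> (e i)\<close> in the dual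
  basis and apply the identity to \<open>v = e j\<close>.
\<close>

lemma trace_derivation:
  fixes conn :: "'v \<Rightarrow> 'v" and d :: "'a \<Rightarrow> 'a"
  assumes conn_add: "\<And>x y. conn (x + y) = conn x + conn y"
    and leibniz: "\<And>a v. conn (s a v) = s (d a) v + s a (conn v)"
    and d_add: "\<And>a b. d (a + b) = d a + d b"
    and d_mult: "\<And>a b. d (a * b) = d a * b + a * d b"
    and \<phi>: "ahom s s \<phi>"
  shows "trace s (\<lambda>v. conn (\<phi> v) - \<phi> (conn v)) = d (trace s \<phi>)"
proof -
  have d0: "d 0 = 0" using d_add[of 0 0] by simp
  have d_sum: "d (sum f I) = (\<Sum>i\<in>I. d (f i))" for f and I :: "nat set"
    by (induction I rule: infinite_finite_induct) (simp_all add: d0 d_add)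
  have conn0: "conn 0 = 0" using conn_add[of 0 0] by simp
  have conn_sum: "conn (sum f I) = (\<Sum>i\<in>I. conn (f i))" for f and I :: "nat set"
    by (induction I rule: infinite_finite_induct) (simp_all add: conn0 conn_add)
  (* The derivative of the coordinate functions with respect to the dual connection. *)
  define \<epsilon>' where "\<epsilon>' i v = d (\<epsilon> i v) - \<epsilon> i (conn v)" for i v
  have \<epsilon>'_hom: "ahom s (*) (\<epsilon>' i)" if "i < n" for i
    using that by (simp add: ahom_def \<epsilon>'_def \<epsilon>_add \<epsilon>_scale d_add d_mult conn_add leibniz algebra_simps)
  have key: "(\<Sum>i<n. s (\<epsilon>' i v) (e i)) = - (\<Sum>i<n. s (\<epsilon> i v) (conn (e i)))" for v
  proof -
    have "conn v = (\<Sum>i<n. s (d (\<epsilon> i v)) (e i)) + (\<Sum>i<n. s (\<epsilon> i v) (conn (e i)))"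
      using arg_cong[OF expand[of v], of conn] by (simp add: conn_sum leibniz sum.distrib)
    moreover have "s (\<epsilon>' i v) (e i) = s (d (\<epsilon> i v)) (e i) - s (\<epsilon> i (conn v)) (e i)" for i
      using scale_left_distrib[of "\<epsilon>' i v" "\<epsilon> i (conn v)" "e i"] by (simp add: \<epsilon>'_def)
    then have "(\<Sum>i<n. s (\<epsilon>' i v) (e i)) = (\<Sum>i<n. s (d (\<epsilon> i v)) (e i)) - conn v"
      by (simp add: sum_subtractf expand)
    ultimately show ?thesis by simp
  qed
  have \<phi>_minus: "\<phi> (- x) = - \<phi> x" for x
    using ahom_add[OF \<phi>, of x "- x"] ahom_zero[OF \<phi>] by (simp add: add_eq_0_iff)
  have "(\<Sum>i<n. \<epsilon>' i (\<phi> (e i))) = (\<Sum>i<n. \<Sum>j<n. \<epsilon> j (\<phi> (e i)) * \<epsilon>' i (e j))"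
    by (intro sum.cong refl ahom_expand[OF \<epsilon>'_hom]) simp
  also have "\<dots> = (\<Sum>j<n. \<epsilon> j (\<phi> (\<Sum>i<n. s (\<epsilon>' i (e j)) (e i))))"
    by (subst sum.swap, intro sum.cong refl)
      (simp add: ahom_sum[OF \<phi>] ahom_scale[OF \<phi>] ahom_sum[OF \<epsilon>_hom] \<epsilon>_scale mult.commute)
  also have "\<dots> = - (\<Sum>j<n. \<Sum>i<n. \<epsilon> i (e j) * \<epsilon> j (\<phi> (conn (e i))))"
  proof -
    have "\<epsilon> j (\<phi> (\<Sum>i<n. s (\<epsilon>' i (e j)) (e i))) = - (\<Sum>i<n. \<epsilon> i (e j) * \<epsilon> j (\<phi> (conn (e i))))"
      if "j < n" for j
    proof -
      have "\<epsilon> j (- x) = - \<epsilon> j x" for x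
        using \<epsilon>_add[OF that, of x "- x"] ahom_zero[OF \<epsilon>_hom[OF that]] by (simp add: add_eq_0_iff)
      then show ?thesis
        by (simp add: key \<phi>_minus ahom_sum[OF \<phi>] ahom_scale[OF \<phi>] ahom_sum[OF \<epsilon>_hom[OF that]]
            \<epsilon>_scale[OF that])
    qed
    then show ?thesis by (simp add: sum_negf)
  qed
  also have "(\<Sum>j<n. \<Sum>i<n. \<epsilon> i (e j) * \<epsilon> j (\<phi> (conn (e i)))) = (\<Sum>i<n. \<epsilon> i (\<phi> (conn (e i))))"
  proof (subst sum.swap, intro sum.cong refl)
    fix i assume "i \<in> {..<n}"
    then have "\<epsilon> i x = (\<Sum>j<n. \<epsilon> j x * \<epsilon> i (e j))" for x
      by (intro ahom_expand[OF \<epsilon>_hom]) simp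
    from this[of "\<phi> (conn (e i))"]
    show "(\<Sum>j<n. \<epsilon> i (e j) * \<epsilon> j (\<phi> (conn (e i)))) = \<epsilon> i (\<phi> (conn (e i)))"
      by (simp only: mult.commute)
  qed
  finally have "(\<Sum>i<n. \<epsilon>' i (\<phi> (e i))) = - (\<Sum>i<n. \<epsilon> i (\<phi> (conn (e i))))" .
  moreover have "trace s (\<lambda>v. conn (\<phi> v) - \<phi> (conn v)) =
      (\<Sum>i<n. \<epsilon> i (conn (\<phi> (e i)))) - (\<Sum>i<n. \<epsilon> i (\<phi> (conn (e i))))"
  proof -
    have "\<epsilon> i (x - y) = \<epsilon> i x - \<epsilon> i y" if "i < n" for i x y
      using \<epsilon>_add[OF that, of "x - y" y] by simp
    then show ?thesis by (simp add: trace_eq sum_subtractf[symmetric])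
  qed
  ultimately show ?thesis
    by (simp add: trace_eq d_sum \<epsilon>'_def sum_subtractf algebra_simps) (metis add_left_imp_eq)
qed

end

lemma dual_basis_module_exists:
  assumes "amodule s" "finitely_generated s" "projective s"
  shows "\<exists>n e \<epsilon>. dual_basis_module s n e \<epsilon>"
proof -
  obtain n e \<epsilon> where b: "(SOME b. dual_basis s b) = (n, e, \<epsilon>)" by (rule prod_cases3)
  have "dual_basis s (n, e, \<epsilon>)"
    using someI_ex[OF dual_basis_exists[OF assms]] b by simp
  then have "dual_basis_module s n e \<epsilon>"
    using assms(1) b by (simp add: dual_basis_module_def dual_basis_module_axioms_def dual_basis_def trace_def)
  then show ?thesis by blast
qed

section \<open>De Rham classes\<close>

context lie_rinehart
begin

lemma sk_one_mult: "sk c 1 * a = sk c a"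
  using algebra_compat[of c 1 a] by simp

lemma sk_mult_right: "sk c (a * b) = a * sk c b"
  using algebra_compat[of c b a] by (simp add: mult.commute)

lemma sk_of_nat: "sk (of_nat n) a = nat_scale n a"
  by (induction n) (simp_all add: nat_scale_Suc nat_scale_0 scale_left_distrib)

lemma d_dR_add: "d_dR br act (\<omega> + \<omega>') = d_dR br act \<omega> + d_dR br act \<omega>'"
  by (simp add: fun_eq_iff d_dR_def act_add sum.distrib algebra_simps)

lemma d_dR_scale: "d_dR br act (\<lambda>xs. sk c (\<omega> xs)) = (\<lambda>xs. sk c (d_dR br act \<omega> xs))"
proof -
  have "signed b (sk c a) = sk c (signed b a)" for b a
    by (simp add: signed_def)
  then show ?thesis
    by (simp add: fun_eq_iff d_dR_def act_scale scale_sum_right scale_right_distrib)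
qed

lemma d_dR_zero: "d_dR br act (\<lambda>_. 0) = (\<lambda>_. 0)"
  using d_dR_scale[of 0 "\<lambda>_. 0"] by simp

lemma d_dR_diff: "d_dR br act (\<omega> - \<omega>') = d_dR br act \<omega> - d_dR br act \<omega>'"
  using d_dR_add[of "\<omega> - \<omega>'" \<omega>'] by simp

lemma d_dR_sum: "d_dR br act (\<lambda>xs. \<Sum>i\<in>I. \<omega> i xs) = (\<lambda>xs. \<Sum>i\<in>I. d_dR br act (\<omega> i) xs)"
proof (induction I rule: infinite_finite_induct)
  case (insert i I)
  have "(\<lambda>xs. \<Sum>i\<in>insert i I. \<omega> i xs) = \<omega> i + (\<lambda>xs. \<Sum>i\<in>I. \<omega> i xs)"
    using insert.hyps by (simp add: fun_eq_iff)
  then have "d_dR br act (\<lambda>xs. \<Sum>i\<in>insert i I. \<omega> i xs) =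
      d_dR br act (\<omega> i) + d_dR br act (\<lambda>xs. \<Sum>i\<in>I. \<omega> i xs)"
    by (simp only: d_dR_add)
  then show ?case using insert by (simp add: fun_eq_iff)
qed (simp_all add: d_dR_zero)

lemma alternating_sk: "alternating sL (*) \<omega> \<Longrightarrow> alternating sL (*) (\<lambda>xs. sk c (\<omega> xs))"
  by (erule alternating_map[where h = "sk c"])
    (rule scale_right_distrib sk_mult_right scale_zero_right)+

lemma Alt_diff:
  assumes "\<omega> \<in> Alt sL (*) UNIV" "\<omega>' \<in> Alt sL (*) UNIV"
  shows "\<omega> - \<omega>' \<in> Alt sL (*) UNIV"
proof -
  have bounded: "\<exists>N. \<forall>xs. N < length xs \<longrightarrow> \<omega> xs = 0" if Alt: "\<omega> \<in> Alt sL (*) UNIV" for \<omega> :: "'l list \<Rightarrow> 'a"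
  proof -
    obtain N where N: "\<And>m. m > N \<Longrightarrow> component m \<omega> = (\<lambda>_. 0)" using Alt unfolding Alt_def by blast
    have "\<omega> xs = 0" if "N < length xs" for xs
    proof -
      have "\<omega> xs = component (length xs) \<omega> xs" by (simp add: component_def)
      also have "\<dots> = 0" by (simp only: N[OF that])
      finally show ?thesis .
    qed
    then show ?thesis by blast
  qed
  obtain N N' where N: "\<And>xs. N < length xs \<Longrightarrow> \<omega> xs = 0" "\<And>xs. N' < length xs \<Longrightarrow> \<omega>' xs = 0"
    using bounded[OF assms(1)] bounded[OF assms(2)] by blast
  note alt = Alt_imp_alternating[OF assms(1)] Alt_imp_alternating[OF assms(2)]
  have "alternating sL (*) (\<omega> - \<omega>')"
    by (rule alternatingI)
      (simp_all add: alternating_add[OF alt(1)] alternating_add[OF alt(2)] alternating_scale[OF alt(1)]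
        alternating_scale[OF alt(2)] alternating_repeat[OF alt(1)] alternating_repeat[OF alt(2)]
        right_diff_distrib)
  then show ?thesis
    by (rule alternating_imp_Alt[where N = "max N N'"]) (simp_all add: N)
qed

text \<open>
  Differences of exact forms are exact, so forms that differ by an exact form have the same cosets.
\<close>

lemma dR_class_eqI:
  assumes "\<omega> \<in> closed_forms sL br act" "\<omega>' \<in> closed_forms sL br act"
    and "\<omega>' - \<omega> \<in> d_dR br act ` Alt sL (*) UNIV"
  shows "dR_class sL br act \<omega>' = dR_class sL br act \<omega>"
proof -
  let ?B = "d_dR br act ` Alt sL (*) UNIV"
  have diff: "\<rho> - \<rho>' \<in> ?B" if "\<rho> \<in> ?B" "\<rho>' \<in> ?B" for \<rho> \<rho>'
    using that Alt_diff by (auto simp: d_dR_diff[symmetric])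
  have "0 \<in> ?B" using diff[OF assms(3) assms(3)] by simp
  have "\<chi> - \<omega>' \<in> ?B \<longleftrightarrow> \<chi> - \<omega> \<in> ?B" for \<chi>
  proof
    assume "\<chi> - \<omega>' \<in> ?B"
    from diff[OF this diff[OF \<open>0 \<in> ?B\<close> assms(3)]] show "\<chi> - \<omega> \<in> ?B" by simp
  next
    assume "\<chi> - \<omega> \<in> ?B"
    from diff[OF this assms(3)] show "\<chi> - \<omega>' \<in> ?B" by simp
  qed
  then show ?thesis
    using assms(1,2) by (auto simp: dR_class_def cohomologous_def)
qed

end

section \<open>The pencil of connections\<close>

locale connection_pencil = lie_rinehart sk sL br act + V: dual_basis_module sV r e \<epsilon>
  for sk :: "'k::field_char_0 \<Rightarrow> 'a::{comm_ring,comm_monoid_mult} \<Rightarrow> 'a"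
    and sL :: "'a \<Rightarrow> 'l::ab_group_add \<Rightarrow> 'l" and br act
    and sV :: "'a \<Rightarrow> 'v::ab_group_add \<Rightarrow> 'v" and r e \<epsilon> +
  fixes D \<eta> :: "'l \<Rightarrow> 'v \<Rightarrow> 'v"
  assumes D_connection: "connection sk sL act sV D"
    and \<eta>_End: "\<eta> X \<in> End sV"
    and \<eta>_hom: "ahom sL (endo_scale sV) \<eta>"
begin

definition scal :: "'a \<Rightarrow> 'v endo" where
  "scal a = Endo (sV a)"

text \<open>
  The operator \<open>\<nabla>\<^sub>X + s \<eta> X\<close> as a power series in \<open>s\<close>.
\<close>

definition pencil_series :: "'l \<Rightarrow> 'v endo fps" where
  "pencil_series X = Abs_fps (\<lambda>i. if i = 0 then Endo (D X) else if i = 1 then Endo (\<eta> X) else 0)"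

definition trace_series :: "'v endo fps \<Rightarrow> 'a fps" where
  "trace_series F = Abs_fps (\<lambda>i. trace sV (apply_endo (F $ i)))"

definition act_series :: "'l \<Rightarrow> 'a fps \<Rightarrow> 'a fps" where
  "act_series X g = Abs_fps (\<lambda>i. act X (g $ i))"

lemma sV_zero [simp]: "sV a 0 = 0"
  using V.scale_right_distrib[of a 0 0] by simp

lemma D_endo: "D X (v + w) = D X v + D X w"
  using D_connection by (simp add: connection_def ahom_def)

lemma D_leibniz_module: "D X (sV a v) = sV (act X a) v + sV a (D X v)"
  using D_connection by (simp add: connection_def)

lemma D_linear: "D (X + Y) v = D X v + D Y v" "D (sL a X) v = sV a (D X v)"
  using D_connection by (simp_all add: connection_def ahom_def endo_scale_def)

lemma \<eta>_endo: "\<eta> X (v + w) = \<eta> X v + \<eta> X w" "\<eta> X (sV a v) = sV a (\<eta> X v)"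
  using \<eta>_End[of X] by (simp_all add: End_def ahom_def)

lemma \<eta>_linear: "\<eta> (X + Y) v = \<eta> X v + \<eta> Y v" "\<eta> (sL a X) v = sV a (\<eta> X v)"
  using \<eta>_hom by (simp_all add: ahom_def endo_scale_def)

lemma apply_endos [simp]:
  "apply_endo (scal a) v = sV a v" "apply_endo (Endo (D X)) v = D X v"
  "apply_endo (Endo (\<eta> X)) v = \<eta> X v"
  by (simp_all add: scal_def apply_Endo V.scale_right_distrib D_endo \<eta>_endo)

lemma pencil_series_nth:
  "pencil_series X $ 0 = Endo (D X)" "pencil_series X $ 1 = Endo (\<eta> X)"
  "i > 1 \<Longrightarrow> pencil_series X $ i = 0"
  by (simp_all add: pencil_series_def)

text \<open>
  The pencil satisfies the Leibniz rule over the scalars because \<open>\<nabla>\<^sub>X\<close> does and \<open>\<eta> X\<close> commutes with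
  them. So it is a connection with values in the ring of power series, and \<open>R.curv\<close> is its curvature
  \<open>\<R>\<^sup>s\<close>.
\<close>

sublocale R: connection_ring sk sL br act "\<lambda>a. fps_const (scal a)" "fps_const id_endo" pencil_series
proof
  fix x :: "'v endo fps" and a b :: 'a and X Y :: 'l
  show "fps_const id_endo * x = x" "x * fps_const id_endo = x"
    by (auto intro!: fps_ext endo_eqI)
  show "fps_const (scal (a + b)) = fps_const (scal a) + fps_const (scal b)"
    by (auto intro!: fps_ext endo_eqI simp: V.scale_left_distrib)
  show "pencil_series (X + Y) = pencil_series X + pencil_series Y"
    by (auto intro!: fps_ext endo_eqI simp: pencil_series_def D_linear \<eta>_linear)
  show "pencil_series (sL a X) = fps_const (scal a) * pencil_series X"
    by (auto intro!: fps_ext endo_eqI simp: pencil_series_def D_linear \<eta>_linear)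
  show "pencil_series X * fps_const (scal a) =
      fps_const (scal (act X a)) + fps_const (scal a) * pencil_series X"
    by (auto intro!: fps_ext endo_eqI simp: pencil_series_def D_leibniz_module \<eta>_endo)
qed

lemma linear_endos_iff: "F \<in> R.linear_endos \<longleftrightarrow> (\<forall>i. ahom sV sV (apply_endo (F $ i)))"
proof -
  have "F * fps_const (scal a) = fps_const (scal a) * F \<longleftrightarrow>
      (\<forall>i v. apply_endo (F $ i) (sV a v) = sV a (apply_endo (F $ i) v))" for a
    by (simp add: fps_eq_iff apply_endo_inject[symmetric] fun_eq_iff)
  then show ?thesis
    unfolding R.linear_endos_def ahom_def by (auto simp: apply_endo_add)
qed

lemma trace_zero: "trace sV (\<lambda>_. 0) = 0"
  using V.trace_add[of "\<lambda>_. 0" "\<lambda>_. 0"] by (simp add: plus_fun_def)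

lemma trace_apply_zero: "trace sV (apply_endo 0) = 0"
  using trace_zero by (simp add: apply_fun_simps zero_fun_def)

lemma trace_apply_add:
  "trace sV (apply_endo (\<phi> + \<psi>)) = trace sV (apply_endo \<phi>) + trace sV (apply_endo \<psi>)"
  by (simp only: apply_fun_simps V.trace_add)

lemma trace_apply_sum: "trace sV (apply_endo (sum f I)) = (\<Sum>i\<in>I. trace sV (apply_endo (f i)))"
proof (induction I rule: infinite_finite_induct)
  case (insert i I)
  show ?case by (simp only: sum.insert[OF insert.hyps] trace_apply_add insert.IH)
next
  case (infinite I)
  then show ?case by (simp only: sum.infinite trace_apply_zero not_False_eq_True)
qed (simp only: sum.empty trace_apply_zero)

lemma trace_apply_scal: "trace sV (apply_endo (scal a * \<phi>)) = a * trace sV (apply_endo \<phi>)"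
proof -
  have "apply_endo (scal a * \<phi>) = (\<lambda>v. sV a (apply_endo \<phi> v))" by (simp add: fun_eq_iff)
  then show ?thesis by (simp only: V.trace_scale)
qed

lemma trace_series_add: "trace_series (F + G) = trace_series F + trace_series G"
  by (simp add: fps_eq_iff trace_series_def trace_apply_add)

lemma trace_series_commute:
  assumes "F \<in> R.linear_endos" "G \<in> R.linear_endos"
  shows "trace_series (F * G) = trace_series (G * F)"
proof (rule fps_ext)
  fix n
  have "trace sV (apply_endo (F $ i * G $ j)) = trace sV (apply_endo (G $ j * F $ i))" for i j
    using assms unfolding linear_endos_iff apply_fun_simps by (intro V.trace_commute) auto
  then have "trace_series (F * G) $ n = (\<Sum>i=0..n. trace sV (apply_endo (G $ (n - i) * F $ i)))"
    by (simp add: trace_series_def fps_mult_nth trace_apply_sum)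
  also have "\<dots> = (\<Sum>i=0..n. trace sV (apply_endo (G $ i * F $ (n - i))))"
    by (rule sum.reindex_bij_witness[where i = "\<lambda>i. n - i" and j = "\<lambda>i. n - i"]) auto
  also have "\<dots> = trace_series (G * F) $ n"
    by (simp add: trace_series_def fps_mult_nth trace_apply_sum)
  finally show "trace_series (F * G) $ n = trace_series (G * F) $ n" .
qed

text \<open>
  The constant term \<open>\<nabla>\<^sub>X\<close> of the pencil contributes the action of \<open>X\<close> by \<open>trace_derivation\<close>. The
  remaining term \<open>s \<eta> X\<close> is \<open>A\<close>-linear, so the trace of its commutator vanishes.
\<close>

lemma trace_series_ad:
  assumes F: "F \<in> R.linear_endos"
  shows "trace_series (R.ad X F) = act_series X (trace_series F)"
proof -
  (* The part of the pencil that is linear in s. *)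
  define H :: "'v endo fps" where "H = Abs_fps (\<lambda>i. if i = 1 then Endo (\<eta> X) else 0)"
  have "H \<in> R.linear_endos"
    by (simp add: linear_endos_iff H_def ahom_def \<eta>_endo)
  have split: "pencil_series X = fps_const (Endo (D X)) + H"
    by (auto intro!: fps_ext simp: pencil_series_def H_def)
  have diff: "trace_series (G - G') = trace_series G - trace_series G'" for G G'
    using trace_series_add[of "G - G'" G'] by simp
  have "trace_series (R.ad X F) =
      trace_series (fps_const (Endo (D X)) * F - F * fps_const (Endo (D X))) +
      (trace_series (H * F) - trace_series (F * H))"
    by (simp add: R.ad_def split distrib_left distrib_right diff trace_series_add)
  also have "trace_series (H * F) - trace_series (F * H) = 0"
    using trace_series_commute[OF \<open>H \<in> R.linear_endos\<close> F] by simp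
  also have "trace_series (fps_const (Endo (D X)) * F - F * fps_const (Endo (D X))) =
      act_series X (trace_series F)"
  proof (rule fps_ext)
    fix i
    have "trace sV (\<lambda>v. D X (apply_endo (F $ i) v) - apply_endo (F $ i) (D X v)) =
        act X (trace sV (apply_endo (F $ i)))"
      using F by (intro V.trace_derivation)
        (simp_all add: D_endo D_leibniz_module act_add act_mult linear_endos_iff)
    moreover have "apply_endo (Endo (D X) * F $ i - F $ i * Endo (D X)) =
        (\<lambda>v. D X (apply_endo (F $ i) v) - apply_endo (F $ i) (D X v))"
      by (simp add: fun_eq_iff)
    ultimately show "trace_series (fps_const (Endo (D X)) * F - F * fps_const (Endo (D X))) $ i =
        act_series X (trace_series F) $ i"
      by (simp add: trace_series_def act_series_def)
  qed
  finally show ?thesis by simp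
qed

text \<open>
  The velocity \<open>d/ds (\<nabla>\<^sub>X + s \<eta> X)\<close> of the pencil is the constant series \<open>\<eta> X\<close>.
\<close>

sublocale T: transgression_setting sk sL br act "\<lambda>a. fps_const (scal a)" "fps_const id_endo"
  pencil_series "\<lambda>X. fps_const (Endo (\<eta> X))" series_derivative trace_series act_series
proof
  fix x y \<phi> \<psi> :: "'v endo fps" and X :: 'l
  show "series_derivative (x + y) = series_derivative x + series_derivative y"
    by (rule series_derivative_add)
  show "series_derivative (x * y) = series_derivative x * y + x * series_derivative y"
    by (rule series_derivative_mult)
  show "series_derivative (pencil_series X) = fps_const (Endo (\<eta> X))"
    by (simp add: fps_eq_iff series_derivative_nth pencil_series_def nat_scale_zero)
      (simp add: nat_scale_def)
  show "fps_const (Endo (\<eta> X)) \<in> R.linear_endos"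
    using R.subring_linear_endos
    by (auto simp: linear_endos_iff ahom_def \<eta>_endo apply_endo_add nonunital_subring_def)
  show "series_derivative \<phi> \<in> R.linear_endos" if "\<phi> \<in> R.linear_endos"
  proof -
    have "nat_scale n (\<phi> $ i) * scal a = scal a * nat_scale n (\<phi> $ i)" for n i a
      using that by (simp add: R.linear_endos_def fps_eq_iff nat_scale_mult[symmetric])
    then show ?thesis by (simp add: R.linear_endos_def fps_eq_iff series_derivative_nth)
  qed
  show "trace_series (x + y) = trace_series x + trace_series y" by (rule trace_series_add)
  show "trace_series (\<phi> * \<psi>) = trace_series (\<psi> * \<phi>)"
    if "\<phi> \<in> R.linear_endos" "\<psi> \<in> R.linear_endos" using that by (rule trace_series_commute)
  show "trace_series (R.ad X \<phi>) = act_series X (trace_series \<phi>)" if "\<phi> \<in> R.linear_endos"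
    using that by (rule trace_series_ad)
qed

abbreviation \<eta>_form :: "'l list \<Rightarrow> 'v endo fps" where
  "\<eta>_form \<equiv> one_form (\<lambda>X. fps_const (Endo (\<eta> X)))"

text \<open>
  The coefficients of \<open>s\<^sup>i\<close> in \<open>trace (\<R>\<^sup>s)\<^sup>m\<close> and, next, in \<open>trace (\<eta> \<smile> (\<R>\<^sup>s)\<^sup>m)\<close>.
\<close>

definition trace_power :: "nat \<Rightarrow> nat \<Rightarrow> 'l list \<Rightarrow> 'a" where
  "trace_power m i xs = trace sV (apply_endo (R.power m xs $ i))"

definition trace_eta_power :: "nat \<Rightarrow> nat \<Rightarrow> 'l list \<Rightarrow> 'a" where
  "trace_eta_power m i xs = trace sV (apply_endo ((\<eta>_form \<smile> R.power m) xs $ i))"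

lemma alternating_trace_coeff:
  assumes "alternating sL (\<lambda>a x. fps_const (scal a) * x) \<omega>"
  shows "alternating sL (*) (\<lambda>xs. trace sV (apply_endo (\<omega> xs $ i)))"
  by (rule alternating_map[OF assms, where h = "\<lambda>F. trace sV (apply_endo (F $ i))"])
    (simp_all add: trace_apply_add trace_apply_scal trace_apply_zero)

lemma trace_power_alternating: "alternating sL (*) (trace_power m i)"
  using alternating_trace_coeff[OF R.power_alternating] by (simp add: trace_power_def[abs_def])

lemma eta_form_alternating: "alternating sL (\<lambda>a x. fps_const (scal a) * x) \<eta>_form"
proof -
  have add: "\<eta>_form (ys @ (X + Y) # zs) = \<eta>_form (ys @ X # zs) + \<eta>_form (ys @ Y # zs)" for ys X Y zs
  proof (cases "ys = [] \<and> zs = []")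
    case True
    then show ?thesis by (auto intro!: fps_ext endo_eqI simp: one_form_def \<eta>_linear)
  qed (auto simp: one_form_other)
  have scale: "\<eta>_form (ys @ sL a X # zs) = fps_const (scal a) * \<eta>_form (ys @ X # zs)" for ys a X zs
  proof (cases "ys = [] \<and> zs = []")
    case True
    then show ?thesis by (auto intro!: fps_ext endo_eqI simp: one_form_def \<eta>_linear)
  qed (auto simp: one_form_other)
  show ?thesis
    by (rule alternatingI[OF add scale]) (simp add: one_form_other)
qed

lemma trace_eta_power_alternating: "alternating sL (*) (trace_eta_power m i)"
proof -
  have "alternating sL (\<lambda>a x. fps_const (scal a) * x) (\<eta>_form \<smile> R.power m)"
    by (intro alternating_cup eta_form_alternating R.power_alternating R.linear_endosD
        T.\<eta>_form_linear)
  then show ?thesis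
    using alternating_trace_coeff by (simp add: trace_eta_power_def[abs_def])
qed

lemma power_homogeneous: "length xs \<noteq> 2 * m \<Longrightarrow> R.power m xs = 0"
proof (induction m arbitrary: xs)
  case (Suc m)
  then show ?case unfolding R.power_Suc
    by (intro cup_homogeneous[of 2 _ "2 * m"]) (auto simp: R.curv_other)
qed simp

lemma eta_power_homogeneous: "length xs \<noteq> Suc (2 * m) \<Longrightarrow> (\<eta>_form \<smile> R.power m) xs = 0"
  by (rule cup_homogeneous[of 1 _ "2 * m"])
    (auto simp: one_form_def power_homogeneous split: list.splits)

lemma curv_degree: "series_degree_le 2 (R.curv xs)"
proof (cases "length xs = 2")
  case True
  then obtain X Y where xs: "xs = [X, Y]" by (auto simp: length_Suc_conv numeral_2_eq_2)
  have p: "series_degree_le 1 (pencil_series X)" for X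
    by (simp add: series_degree_le_def pencil_series_def)
  have "series_degree_le 2 (pencil_series X * pencil_series Y)" for X Y
    using series_degree_le_mult[OF p[of X] p[of Y]] by (simp add: numeral_2_eq_2)
  then show ?thesis
    using p[of "br X Y"] by (simp add: xs R.curv_pair series_degree_le_def)
qed (simp add: R.curv_other series_degree_le_def)

lemma power_degree: "series_degree_le (2 * m) (R.power m xs)"
proof (induction m arbitrary: xs)
  case (Suc m)
  then show ?case
    unfolding R.power_Suc using series_degree_le_cup[of 2 R.curv "2 * m" "R.power m" xs] curv_degree by simp
qed (simp add: series_degree_le_def)

lemma eta_power_degree: "series_degree_le (2 * m) ((\<eta>_form \<smile> R.power m) xs)"
proof -
  have "series_degree_le 0 (\<eta>_form xs)" for xs :: "'l list"
    by (auto simp: series_degree_le_def one_form_def split: list.splits)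
  then show ?thesis using series_degree_le_cup[of 0 \<eta>_form "2 * m" "R.power m" xs] power_degree by simp
qed

lemma trace_power_closed: "d_dR br act (trace_power m i) = 0"
proof -
  have nth: "trace_power m i = (\<lambda>xs. trace_series (R.power m xs) $ i)"
    by (simp add: trace_power_def[abs_def] trace_series_def)
  have "d_dR br act (trace_power m i) = cartan_d br act (\<lambda>xs. trace_series (R.power m xs) $ i)"
    using d_dR_eq_cartan_d[OF trace_power_alternating, of br act m i] by (simp only: nth)
  also have "\<dots> = (\<lambda>xs. cartan_d br act_series (\<lambda>xs. trace_series (R.power m xs)) xs $ i)"
    by (rule cartan_d_map[where h = "\<lambda>g. g $ i"]) (simp_all add: act_series_def)
  also have "\<dots> = 0" by (simp only: T.trace_closed) (simp add: fun_eq_iff)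
  finally show ?thesis .
qed

text \<open>
  The coefficient of \<open>s\<^sup>i\<close> in \<open>derivative_trace_power\<close>. The differential of series-valued forms acts
  on coefficients, so the de Rham differential appears on the right.
\<close>

lemma transgression_coefficients:
  "nat_scale (Suc i) (trace_power (Suc m) (Suc i) xs) =
    nat_scale (Suc m) (d_dR br act (trace_eta_power m i) xs)"
proof -
  have nth: "nat_scale n g $ i = nat_scale n (g $ i)" for n and g :: "'a fps"
    by (rule nat_scale_map[where h = "\<lambda>g. g $ i"]) simp
  have "nat_scale (Suc i) (trace_power (Suc m) (Suc i) xs) =
      trace_series (series_derivative (R.power (Suc m) xs)) $ i"
    unfolding trace_power_def trace_series_def fps_nth_Abs_fps series_derivative_nth
    by (rule nat_scale_map[where h = "\<lambda>\<phi>. trace sV (apply_endo \<phi>)", symmetric]) (rule trace_apply_add)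
  also have "\<dots> = nat_scale (Suc m)
      (cartan_d br act_series (\<lambda>ys. trace_series ((\<eta>_form \<smile> R.power m) ys)) xs $ i)"
    by (simp only: T.derivative_trace_power nth)
  also have "cartan_d br act_series (\<lambda>ys. trace_series ((\<eta>_form \<smile> R.power m) ys)) xs $ i =
      cartan_d br act (\<lambda>ys. trace_series ((\<eta>_form \<smile> R.power m) ys) $ i) xs"
    by (subst cartan_d_map[where h = "\<lambda>g. g $ i" and \<delta> = act_series]) (simp_all add: act_series_def)
  also have "\<dots> = d_dR br act (trace_eta_power m i) xs"
  proof -
    have "trace_eta_power m i = (\<lambda>ys. trace_series ((\<eta>_form \<smile> R.power m) ys) $ i)"
      by (simp add: trace_eta_power_def[abs_def] trace_series_def)
    then show ?thesis
      using d_dR_eq_cartan_d[OF trace_eta_power_alternating, of br act m i] by (simp only:)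
  qed
  finally show ?thesis .
qed

section \<open>Trace forms and transgression\<close>

lemma represents_pencil: "represents (pencil D \<eta> X) (pencil_series X)"
  by (auto simp: represents_def pencil_def pencil_series_def coeff_pCons fun_eq_iff split: nat.splits)

lemma represents_curvature: "represents (pencil_curvature br D \<eta> xs) (R.curv xs)"
  unfolding pencil_curvature_def R.curv_def
  by (rule curvature_rel[where R = represents])
    (rule represents_pencil represents_linear represents_mult | assumption)+

lemma represents_unit: "represents [:id:] (fps_const id_endo)"
  by (auto simp: represents_def coeff_pCons fun_eq_iff split: nat.splits)

lemma represents_power:
  "represents (cup_power endo_poly_mult [:id:] (pencil_curvature br D \<eta>) m xs) (R.power m xs)"
  by (rule cup_power_rel[where R = represents])
    (rule represents_curvature represents_unit represents_linear represents_mult | assumption)+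

lemma represents_degree:
  assumes "represents p F" "series_degree_le N F" shows "degree p \<le> N"
proof (rule degree_le, intro allI impI)
  fix i assume "N < i"
  then show "coeff p i = 0"
    using assms by (simp add: represents_def series_degree_le_def apply_fun_simps)
qed

text \<open>
  Taking constant coefficients is multiplicative and sends the pencil to the connection \<open>\<nabla>\<close>.
\<close>

lemma pencil_at_zero:
  "cup_power (\<circ>) id (curvature (\<circ>) br D) m xs = apply_endo (R.power m xs $ 0)"
proof -
  let ?R = "\<lambda>F \<phi>. apply_endo (fps_nth F 0) = \<phi>"
  have mult: "?R (F * G) (\<phi> \<circ> \<psi>)" if "?R F \<phi>" "?R G \<psi>" for F G and \<phi> \<psi> :: "'v \<Rightarrow> 'v"
    using that by (auto simp: apply_fun_simps)
  have linear: "?R 0 (0 :: 'v \<Rightarrow> 'v)" "?R F \<phi> \<Longrightarrow> ?R G \<psi> \<Longrightarrow> ?R (F + G) (\<phi> + \<psi>)" "?R F \<phi> \<Longrightarrow> ?R (- F) (- \<phi>)"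
    for F G and \<phi> \<psi> :: "'v \<Rightarrow> 'v"
    by (auto simp: apply_fun_simps)
  have D: "?R (pencil_series X) (D X)" for X
    by (simp add: fun_eq_iff pencil_series_nth)
  have curv: "?R (R.curv xs) (curvature (\<circ>) br D xs)" for xs
    unfolding R.curv_def
    by (rule curvature_rel[where R = ?R]) (rule D linear mult | assumption)+
  have unit: "?R (fps_const id_endo) (id :: 'v \<Rightarrow> 'v)" by (simp add: fun_eq_iff)
  have "?R (R.power m xs) (cup_power (\<circ>) id (curvature (\<circ>) br D) m xs)"
    by (rule cup_power_rel[where R = ?R]) (rule curv unit linear mult | assumption)+
  then show ?thesis by simp
qed

text \<open>
  Evaluation at \<open>s = 1\<close> is multiplicative on polynomials and sends the pencil to \<open>\<nabla> + \<eta>\<close>. The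
  degree in \<open>s\<close> is at most \<open>2 m\<close>, so the value is the sum of the coefficients up to any \<open>N \<ge> 2 m\<close>.
\<close>

lemma pencil_at_one:
  assumes "2 * m \<le> N"
  shows "cup_power (\<circ>) id (curvature (\<circ>) br (D + \<eta>)) m xs = apply_endo (\<Sum>i\<le>N. R.power m xs $ i)"
proof -
  let ?p = "cup_power endo_poly_mult [:id:] (pencil_curvature br D \<eta>) m xs"
  have pencil: "coeff_sum_is (pencil D \<eta> X) ((D + \<eta>) X)" for X
  proof -
    have "degree (pencil D \<eta> X) \<le> 1" by (simp add: pencil_def)
    then show ?thesis
      by (auto simp: coeff_sum_is_def coeff_sum_extend additive_coeffs_def)
        (auto simp: pencil_def coeff_pCons D_endo \<eta>_endo split: nat.splits)
  qed
  have curv: "coeff_sum_is (pencil_curvature br D \<eta> xs) (curvature (\<circ>) br (D + \<eta>) xs)" for xs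
    unfolding pencil_curvature_def
    by (rule curvature_rel[where R = coeff_sum_is])
      (rule pencil coeff_sum_is_linear coeff_sum_is_mult | assumption)+
  have unit: "coeff_sum_is [:id:] (id :: 'v \<Rightarrow> 'v)"
    by (auto simp: coeff_sum_is_def additive_coeffs_def coeff_pCons split: nat.splits)
  have "coeff_sum_is ?p (cup_power (\<circ>) id (curvature (\<circ>) br (D + \<eta>)) m xs)"
    by (rule cup_power_rel[where R = coeff_sum_is])
      (rule curv unit coeff_sum_is_linear coeff_sum_is_mult | assumption)+
  then have "cup_power (\<circ>) id (curvature (\<circ>) br (D + \<eta>)) m xs = (\<Sum>i\<le>degree ?p. coeff ?p i)"
    by (simp only: coeff_sum_is_def)
  also have "degree ?p \<le> N"
    using represents_degree[OF represents_power power_degree] assms by (rule le_trans)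
  then have "(\<Sum>i\<le>degree ?p. coeff ?p i) = (\<Sum>i\<le>N. coeff ?p i)"
    by (rule coeff_sum_extend)
  also have "\<dots> = (\<Sum>i\<le>N. apply_endo (R.power m xs $ i))"
    using represents_power by (simp only: represents_def)
  also have "\<dots> = apply_endo (\<Sum>i\<le>N. R.power m xs $ i)"
    by (induction N) (simp_all only: sum.atMost_Suc apply_fun_simps atMost_0 sum.insert sum.empty
        finite.emptyI empty_iff not_False_eq_True add_0_right)
  finally show ?thesis .
qed

lemma trace_power_sum_scale:
  "trace sV (\<Sum>m\<in>M. endo_scale (induced_scale sk sV) (c m) (\<phi> m)) = (\<Sum>m\<in>M. sk (c m) (trace sV (\<phi> m)))"
proof -
  have scale: "trace sV (endo_scale (induced_scale sk sV) c \<phi>) = sk c (trace sV \<phi>)" for c \<phi>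
    using V.trace_scale[of "sk c 1" \<phi>] by (simp add: endo_scale_def induced_scale_def sk_one_mult)
  show ?thesis
  proof (induction M rule: infinite_finite_induct)
    case (insert m M)
    show ?case by (simp only: sum.insert[OF insert.hyps] V.trace_add scale insert.IH)
  qed (simp_all add: trace_zero)
qed

lemma trace_form_eq: "trace_form sk sV br f D xs = (\<Sum>m\<le>degree f. sk (coeff f m) (trace_power m 0 xs))"
  unfolding trace_form_def poly_form_def trace_power_sum_scale pencil_at_zero trace_power_def ..

lemma trace_form_shifted_eq:
  assumes "2 * degree f \<le> N"
  shows "trace_form sk sV br f (D + \<eta>) xs =
    (\<Sum>m\<le>degree f. sk (coeff f m) (\<Sum>i\<le>N. trace_power m i xs))"
  unfolding trace_form_def poly_form_def trace_power_sum_scale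
proof (intro sum.cong refl arg_cong[where f = "sk _"])
  fix m assume "m \<in> {..degree f}"
  then have "2 * m \<le> N" using assms by simp
  then show "trace sV (cup_power (\<circ>) id (curvature (\<circ>) br (D + \<eta>)) m xs) = (\<Sum>i\<le>N. trace_power m i xs)"
    by (simp only: pencil_at_one trace_apply_sum trace_power_def)
qed

lemma alternating_combination:
  "(\<And>m. m \<in> M \<Longrightarrow> alternating sL (*) (\<omega> m)) \<Longrightarrow> alternating sL (*) (\<lambda>xs. \<Sum>m\<in>M. sk (c m) (\<omega> m xs))"
  by (intro alternating_sum alternating_sk) (auto simp: distrib_left)

lemma trace_form_Alt: "trace_form sk sV br f D \<in> Alt sL (*) UNIV"
proof (rule alternating_imp_Alt)
  show "alternating sL (*) (trace_form sk sV br f D)"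
    unfolding trace_form_eq[abs_def] by (intro alternating_combination trace_power_alternating)
  show "trace_form sk sV br f D xs = 0" if "2 * degree f < length xs" for xs
    unfolding trace_form_eq
  proof (intro sum.neutral ballI)
    fix m assume "m \<in> {..degree f}"
    then have "R.power m xs = 0" using that by (intro power_homogeneous) simp
    then show "sk (coeff f m) (trace_power m 0 xs) = 0"
      by (simp only: trace_power_def fps_zero_nth trace_apply_zero scale_zero_right)
  qed
qed simp

lemma trace_form_closed: "d_dR br act (trace_form sk sV br f D) = 0"
  unfolding trace_form_eq[abs_def] d_dR_sum d_dR_scale trace_power_closed
  by (simp add: fun_eq_iff)

lemma pencil_curvature_Alt_deg_poly:
  "pencil_curvature br D \<eta> \<in> Alt_deg_poly sL (endo_scale sV) (End sV) 2"
proof -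
  have coeff: "(\<lambda>xs. coeff (pencil_curvature br D \<eta> xs) i) = (\<lambda>xs. apply_endo (R.curv xs $ i))" for i
    using represents_curvature by (simp add: represents_def)
  have "(\<lambda>xs. apply_endo (R.curv xs $ i)) \<in> Alt_deg sL (endo_scale sV) (End sV) 2" for i
  proof -
    let ?\<omega> = "\<lambda>xs. apply_endo (R.curv xs $ i)"
    have "alternating sL (endo_scale sV) ?\<omega>"
      by (rule alternating_map[OF R.curv_alternating, where h = "\<lambda>F. apply_endo (F $ i)"])
        (simp_all add: fun_eq_iff endo_scale_def)
    moreover have "?\<omega> xs \<in> End sV" for xs
      using R.curv_linear by (simp add: linear_endos_iff End_def)
    ultimately have "component 2 ?\<omega> \<in> Alt_deg sL (endo_scale sV) (End sV) 2"
      by (rule alternating_imp_Alt_deg)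
    moreover have "component 2 ?\<omega> xs = ?\<omega> xs" for xs
      by (cases "length xs = 2") (simp_all add: component_def R.curv_other fun_eq_iff)
    ultimately show ?thesis by (simp only: ext[of "component 2 ?\<omega>" ?\<omega>])
  qed
  moreover have "degree (pencil_curvature br D \<eta> xs) \<le> 2" for xs
    by (rule represents_degree[OF represents_curvature curv_degree])
  ultimately show ?thesis
    unfolding Alt_deg_poly_def mem_Collect_eq coeff by blast
qed

lemma represents_poly_form:
  "represents
    (poly_form (\<lambda>c. map_poly (endo_scale (induced_scale sk sV) c)) endo_poly_mult [:id:] g (pencil_curvature br D \<eta>) xs)
    (\<Sum>m\<le>degree g. fps_const (scal (sk (coeff g m) 1)) * R.power m xs)"
proof -
  have scale: "represents (map_poly (endo_scale (induced_scale sk sV) c) p) (fps_const (scal (sk c 1)) * F)"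
    if "represents p F" for c p F
  proof -
    have "endo_scale (induced_scale sk sV) c 0 = 0"
      by (simp add: fun_eq_iff endo_scale_def induced_scale_def)
    then show ?thesis
      using that by (simp add: represents_def coeff_map_poly fun_eq_iff endo_scale_def induced_scale_def)
  qed
  have sum: "represents (sum p I) (sum F I)" if "\<And>i. i \<in> I \<Longrightarrow> represents (p i) (F i)"
    for p :: "nat \<Rightarrow> ('v \<Rightarrow> 'v) poly" and F I
    using that by (induction I rule: infinite_finite_induct) (auto intro: represents_linear)
  show ?thesis
    unfolding poly_form_def by (intro sum scale represents_power)
qed

text \<open>
  The coefficients of \<open>g\<close> act by scalars, which commute with the values of \<open>\<eta>\<close> and can be taken out
  of the cup product.
\<close>

lemma represents_transgression:
  "represents
    (cup endo_poly_mult (one_form (\<lambda>X. [:\<eta> X:]))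
      (poly_form (\<lambda>c. map_poly (endo_scale (induced_scale sk sV) c)) endo_poly_mult [:id:] g (pencil_curvature br D \<eta>)) xs)
    (\<Sum>m\<le>degree g. fps_const (scal (sk (coeff g m) 1)) * (\<eta>_form \<smile> R.power m) xs)"
  (is "represents ?p _")
proof -
  let ?\<kappa> = "\<lambda>m. fps_const (scal (sk (coeff g m) 1))"
  have \<eta>: "represents (one_form (\<lambda>X. [:\<eta> X:]) xs) (\<eta>_form xs)" for xs
  proof (cases "length xs = 1")
    case True
    then obtain X where "xs = [X]" by (auto simp: length_Suc_conv)
    then show ?thesis
      by (auto simp: represents_def coeff_pCons one_form_def fun_eq_iff split: nat.splits)
  qed (simp only: one_form_other represents_zero not_False_eq_True)
  have "represents ?p ((\<eta>_form \<smile> (\<lambda>ys. \<Sum>m\<le>degree g. ?\<kappa> m * R.power m ys)) xs)"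
    by (rule cup_rel[where P = represents and Q = represents])
      (rule \<eta> represents_poly_form represents_linear represents_mult | assumption)+
  also have "\<eta>_form \<smile> (\<lambda>ys. \<Sum>m\<in>M. ?\<kappa> m * R.power m ys) =
      (\<lambda>ys. \<Sum>m\<in>M. ?\<kappa> m * (\<eta>_form \<smile> R.power m) ys)" if "finite M" for M
    using that
  proof (induction M)
    case empty
    then show ?case using cup_zero_right[of \<eta>_form] by (simp add: zero_fun_def)
  next
    case (insert m M)
    have "(\<lambda>ys. \<Sum>m\<in>insert m M. ?\<kappa> m * R.power m ys) =
        (\<lambda>ys. ?\<kappa> m * R.power m ys) + (\<lambda>ys. \<Sum>m\<in>M. ?\<kappa> m * R.power m ys)"
      using insert.hyps by (simp add: fun_eq_iff)
    moreover have "\<eta>_form \<smile> (\<lambda>ys. ?\<kappa> m * R.power m ys) = (\<lambda>ys. ?\<kappa> m * (\<eta>_form \<smile> R.power m) ys)"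
      by (rule cup_scale_right) (rule R.linear_endosD[OF T.\<eta>_form_linear])
    ultimately show ?case
      using insert by (simp only: cup_add_right insert.IH) (simp add: fun_eq_iff)
  qed
  from this[OF finite_atMost[of "degree g"]] show ?thesis
    using \<open>represents ?p _\<close> by (simp only:)
qed

text \<open>
  The upper bound \<open>N\<close> does not depend on the arguments \<open>xs\<close>; hence the formal integral is a
  fixed linear combination of forms, and the differential can be applied term by term.
\<close>

lemma transgression_eq:
  assumes "2 * degree f \<le> N"
  shows "transgression sk sV br f D \<eta> xs =
    (\<Sum>i\<le>N. sk (1 / of_nat (i + 1))
      (\<Sum>m\<le>degree (pderiv f). sk (coeff (pderiv f) m) (trace_eta_power m i xs)))"
proof -
  let ?g = "pderiv f"
  define p where "p = cup endo_poly_mult (one_form (\<lambda>X. [:\<eta> X:]))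
      (poly_form (\<lambda>c. map_poly (endo_scale (induced_scale sk sV) c)) endo_poly_mult [:id:] ?g (pencil_curvature br D \<eta>)) xs"
  define F where "F = (\<Sum>m\<le>degree ?g. fps_const (scal (sk (coeff ?g m) 1)) * (\<eta>_form \<smile> R.power m) xs)"
  have pF: "represents p F"
    unfolding p_def F_def by (rule represents_transgression)
  have F_nth: "F $ i = (\<Sum>m\<le>degree ?g. scal (sk (coeff ?g m) 1) * (\<eta>_form \<smile> R.power m) xs $ i)" for i
    by (simp add: F_def fps_sum_nth)
  have "series_degree_le N F"
    unfolding series_degree_le_def F_nth
  proof (intro allI impI sum.neutral ballI)
    fix i m assume "N < i" "m \<in> {..degree ?g}"
    then have "2 * m < i" using assms by (simp add: degree_pderiv)
    then have "(\<eta>_form \<smile> R.power m) xs $ i = 0"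
      using eta_power_degree[of m xs] by (simp only: series_degree_le_def)
    then show "scal (sk (coeff ?g m) 1) * (\<eta>_form \<smile> R.power m) xs $ i = 0"
      by (simp only: mult_zero_right)
  qed
  then have deg: "degree p \<le> N" by (rule represents_degree[OF pF])
  have trace_zero': "trace sV 0 = 0" using V.trace_add[of 0 0] by simp
  have coeff: "coeff (map_poly (trace sV) p) i = trace sV (apply_endo (F $ i))" for i
    using pF[unfolded represents_def, rule_format, of i] by (simp only: coeff_map_poly trace_zero')
  have deg': "degree (map_poly (trace sV) p) \<le> N"
  proof (rule degree_le, intro allI impI)
    fix i assume "N < i"
    then have "coeff p i = 0" using deg by (simp add: coeff_eq_0)
    then show "coeff (map_poly (trace sV) p) i = 0"
      by (simp only: coeff_map_poly[where f = "trace sV", OF trace_zero'] trace_zero')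
  qed
  have "formal_integral sk (map_poly (trace sV) p) =
      (\<Sum>i\<le>N. sk (1 / of_nat (i + 1)) (coeff (map_poly (trace sV) p) i))"
    unfolding formal_integral_def
    by (rule sum.mono_neutral_left) (use deg' in \<open>auto simp: coeff_eq_0\<close>)
  moreover have "trace sV (apply_endo (F $ i)) =
      (\<Sum>m\<le>degree ?g. sk (coeff ?g m) (trace_eta_power m i xs))" for i
    by (simp only: F_nth trace_apply_sum trace_apply_scal trace_eta_power_def sk_one_mult)
  ultimately show ?thesis
    unfolding transgression_def p_def[symmetric] by (simp only: coeff)
qed

lemma transgression_Alt: "transgression sk sV br f D \<eta> \<in> Alt sL (*) UNIV"
proof (rule alternating_imp_Alt)
  show "alternating sL (*) (transgression sk sV br f D \<eta>)"
    unfolding transgression_eq[OF order_refl, abs_def]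
    by (intro alternating_combination trace_eta_power_alternating)
  show "transgression sk sV br f D \<eta> xs = 0" if "Suc (2 * degree f) < length xs" for xs
  proof -
    have "trace_eta_power m i xs = 0" if "m \<le> degree (pderiv f)" for m i
    proof -
      have "(\<eta>_form \<smile> R.power m) xs = 0"
        using that \<open>Suc (2 * degree f) < length xs\<close>
        by (intro eta_power_homogeneous) (simp add: degree_pderiv)
      then show ?thesis by (simp only: trace_eta_power_def fps_zero_nth trace_apply_zero)
    qed
    then show ?thesis by (simp add: transgression_eq[OF order_refl])
  qed
qed simp

text \<open>
  At \<open>s = 1\<close> minus at \<open>s = 0\<close> leaves the coefficients of positive degree in \<open>s\<close>. By
  \<open>transgression_coefficients\<close> the coefficient of degree \<open>i + 1\<close> is \<open>1 / (i + 1)\<close>, the integral of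
  \<open>s\<^sup>i\<close>, times a differential; the factor \<open>m + 1\<close> there is the one by which the coefficients of
  the derivative of \<open>f\<close> differ from those of \<open>f\<close>.
\<close>

lemma transgression_formula:
  "trace_form sk sV br f (D + \<eta>) - trace_form sk sV br f D = d_dR br act (transgression sk sV br f D \<eta>)"
proof
  fix xs
  define N where "N = 2 * degree f"
  define g where "g m = sk (coeff f m) (\<Sum>i\<le>N. trace_power m (Suc i) xs)" for m
  have "trace_form sk sV br f (D + \<eta>) xs =
      (\<Sum>m\<le>degree f. sk (coeff f m) (trace_power m 0 xs + (\<Sum>i\<le>N. trace_power m (Suc i) xs)))"
    using trace_form_shifted_eq[of f "Suc N" xs] by (simp add: N_def sum.atMost_Suc_shift del: sum.atMost_Suc)
  then have "(trace_form sk sV br f (D + \<eta>) - trace_form sk sV br f D) xs = (\<Sum>m\<le>degree f. g m)"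
    by (simp add: trace_form_eq g_def scale_right_distrib sum.distrib)
  (* The summand for m = 0 vanishes as the zeroth power does not depend on s. If f is constant, the
     single summand on the right vanishes because the coefficient of f in degree 1 is zero. *)
  also have "\<dots> = (\<Sum>m\<le>degree (pderiv f). g (Suc m))"
  proof (cases "degree f")
    case 0
    then show ?thesis by (simp add: degree_pderiv g_def trace_power_def trace_apply_zero coeff_eq_0)
  next
    case (Suc d)
    have "g 0 = 0" by (simp add: g_def trace_power_def trace_apply_zero)
    then show ?thesis using Suc by (simp add: degree_pderiv sum.atMost_Suc_shift del: sum.atMost_Suc)
  qed
  also have "\<dots> = (\<Sum>i\<le>N. \<Sum>m\<le>degree (pderiv f). sk (coeff f (Suc m)) (trace_power (Suc m) (Suc i) xs))"
    unfolding g_def scale_sum_right by (rule sum.swap)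
  also have "\<dots> = (\<Sum>i\<le>N. sk (1 / of_nat (i + 1))
      (\<Sum>m\<le>degree (pderiv f). sk (coeff (pderiv f) m) (d_dR br act (trace_eta_power m i) xs)))"
    unfolding scale_sum_right
  proof (intro sum.cong refl)
    fix i m
    have "sk (coeff (pderiv f) m) (d_dR br act (trace_eta_power m i) xs) =
        sk (coeff f (Suc m)) (nat_scale (Suc m) (d_dR br act (trace_eta_power m i) xs))"
      by (simp only: coeff_pderiv sk_of_nat[symmetric] scale_scale mult.commute)
    also have "\<dots> = sk (coeff f (Suc m)) (nat_scale (Suc i) (trace_power (Suc m) (Suc i) xs))"
      by (simp only: transgression_coefficients)
    also have "\<dots> = sk (of_nat (i + 1)) (sk (coeff f (Suc m)) (trace_power (Suc m) (Suc i) xs))"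
      by (simp only: sk_of_nat[symmetric] scale_scale mult.commute Suc_eq_plus1)
    finally show "sk (coeff f (Suc m)) (trace_power (Suc m) (Suc i) xs) =
        sk (1 / of_nat (i + 1)) (sk (coeff (pderiv f) m) (d_dR br act (trace_eta_power m i) xs))"
      by (simp del: of_nat_add of_nat_Suc)
  qed
  also have "\<dots> = d_dR br act (transgression sk sV br f D \<eta>) xs"
    unfolding transgression_eq[of f N, OF eq_refl[OF N_def[symmetric]], abs_def] d_dR_sum d_dR_scale ..
  finally show "(trace_form sk sV br f (D + \<eta>) - trace_form sk sV br f D) xs =
      d_dR br act (transgression sk sV br f D \<eta>) xs" .
qed

end

section \<open>Independence of the connection\<close>

theorem theorem6p4:
  fixes sk :: "'k::field_char_0 \<Rightarrow> 'a::{comm_ring,comm_monoid_mult} \<Rightarrow> 'a"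
    and sL :: "'a \<Rightarrow> 'l::ab_group_add \<Rightarrow> 'l"
    and br :: "'l \<Rightarrow> 'l \<Rightarrow> 'l"
    and act :: "'l \<Rightarrow> 'a \<Rightarrow> 'a"
    and sV :: "'a \<Rightarrow> 'v::ab_group_add \<Rightarrow> 'v"
    and D \<eta> :: "'l \<Rightarrow> 'v \<Rightarrow> 'v"
    and f :: "'k poly"
  assumes LR: "lie_rinehart sk sL br act"
    and V_module: "amodule sV"
    and V_fg: "finitely_generated sV"
    and V_proj: "projective sV"
    and D_conn: "connection sk sL act sV D"
    and eta_values: "\<And>X. \<eta> X \<in> End sV"
    and eta_hom: "ahom sL (endo_scale sV) \<eta>"
    and D_eta_conn: "connection sk sL act sV (D + \<eta>)"
  shows "trace_form sk sV br f D \<in> Alt sL (*) UNIV \<and>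
    d_dR br act (trace_form sk sV br f D) = 0 \<and>
    pencil_curvature br D \<eta> \<in> Alt_deg_poly sL (endo_scale sV) (End sV) 2 \<and>
    transgression sk sV br f D \<eta> \<in> Alt sL (*) UNIV \<and>
    trace_form sk sV br f (D + \<eta>) - trace_form sk sV br f D =
      d_dR br act (transgression sk sV br f D \<eta>) \<and>
    dR_class sL br act (trace_form sk sV br f D) \<in> H_dR sL br act \<and>
    (\<forall>D'. connection sk sL act sV D' \<longrightarrow>
       dR_class sL br act (trace_form sk sV br f D') = dR_class sL br act (trace_form sk sV br f D))"
proof -
  interpret lie_rinehart sk sL br act by (rule LR)
  obtain n e \<epsilon> where dual: "dual_basis_module sV n e \<epsilon>"
    using dual_basis_module_exists[OF V_module V_fg V_proj] by blast
  interpret V: dual_basis_module sV n e \<epsilon> by (rule dual)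
  have pencil: "connection_pencil sk sL br act sV n e \<epsilon> D' \<theta>"
    if "connection sk sL act sV D'" "\<And>X. \<theta> X \<in> End sV" "ahom sL (endo_scale sV) \<theta>" for D' \<theta>
    using LR dual that by (simp add: connection_pencil_def connection_pencil_axioms_def)
  interpret P: connection_pencil sk sL br act sV n e \<epsilon> D \<eta>
    by (rule pencil[OF D_conn eta_values eta_hom])
  have closed: "trace_form sk sV br f D' \<in> closed_forms sL br act"
    and exact: "trace_form sk sV br f D' - trace_form sk sV br f D \<in> d_dR br act ` Alt sL (*) UNIV"
    if D': "connection sk sL act sV D'" for D'
  proof -
    have sV0: "sV a 0 = 0" for a using V.scale_right_distrib[of a 0 0] by simp
    have sV_diff: "sV a (v - w) = sV a v - sV a w" for a v w
      using V.scale_right_distrib[of a "v - w" w] by simp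
    (* The constant pencil at the other connection shows that its trace form is closed. *)
    interpret Q: connection_pencil sk sL br act sV n e \<epsilon> D' "\<lambda>_ _. 0"
      by (rule pencil[OF D']) (simp_all add: End_def ahom_def endo_scale_def sV0 fun_eq_iff)
    show "trace_form sk sV br f D' \<in> closed_forms sL br act"
      by (simp add: closed_forms_def Q.trace_form_Alt Q.trace_form_closed)
    (* The pencil from one connection to the other gives the primitive of the difference. *)
    interpret S: connection_pencil sk sL br act sV n e \<epsilon> D "D' - D"
    proof (rule pencil[OF D_conn])
      show "(D' - D) X \<in> End sV" for X
        by (simp add: End_def ahom_def Q.D_endo P.D_endo Q.D_leibniz_module P.D_leibniz_module sV_diff)
      show "ahom sL (endo_scale sV) (D' - D)"
        by (simp add: ahom_def fun_eq_iff Q.D_linear P.D_linear endo_scale_def sV_diff)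
    qed
    show "trace_form sk sV br f D' - trace_form sk sV br f D \<in> d_dR br act ` Alt sL (*) UNIV"
      using S.transgression_formula[of f] S.transgression_Alt[of f] by simp
  qed
  have "dR_class sL br act (trace_form sk sV br f D') = dR_class sL br act (trace_form sk sV br f D)"
    if "connection sk sL act sV D'" for D'
    using dR_class_eqI[OF closed[OF D_conn] closed[OF that] exact[OF that]] .
  moreover have "dR_class sL br act (trace_form sk sV br f D) \<in> H_dR sL br act"
    unfolding dR_class_def H_dR_def by (rule quotientI) (rule closed[OF D_conn])
  ultimately show ?thesis
    using P.trace_form_Alt P.trace_form_closed P.pencil_curvature_Alt_deg_poly P.transgression_Alt
      P.transgression_formula by blast
qed

end
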